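(* Let $\alpha\in(1,2)$, $\beta=\alpha/2$, $\theta=\beta/2=\alpha/4$. Assume that $a_k(\mathbf{x},t)>0$, that $a_k$ is $C^1$ in $t\in[0,T]$ for fixed $\mathbf{x}$ $(k=1,2)$, and that $|(a_1)_t/a_1|+|(a_2)_t/a_2|\le C_p$ on $\Omega\times[0,T]$ for a constant $C_p>0$. Consider the numerical scheme, with $\tilde u_h^n:=u_h^n-t_n\psi_h$, $$(\mathcal{D}_\tau^\beta v_h)^{n-\theta}=\mathcal{A}_h^{n-\theta}\tilde u_h^{n-\theta}+f_h^{n-\theta}+\tilde\psi_h^{n-\theta},\qquad v_h^{n-\theta}=(\mathcal{D}_\tau^\beta\tilde u_h)^{n-\theta},\qquad\mathbf{x}_h\in\Omega_h,\ 1\le n\le N,$$ subject to zero boundary conditions and the initial conditions $u_h^0=\phi_h$, $v_h^0=0$, where $w_h^{n-\theta}:=(1-\theta)w_h^n+\theta w_h^{n-1}$ for $w=\tilde u,v$, $f_h^{n-\theta}:=f(\mathbf{x}_h,t_{n-\theta})$ and $\tilde\psi_h^{n-\theta}:=[\mathcal{A}(t\psi)](\mathbf{x}_h,t_{n-\theta})$. Then this scheme is unconditionally stable, and the discrete solutions $u_h^n$ $(\mathbf{x}_h\in\Omega_h,\ 1\le n\le N)$ satisfy $$\|\nabla_hu^n\|\le C\Big[\|\nabla_h\phi\|+t_n\|\nabla_h\psi\|+\max_{1\le k\le n}\sum_{j=1}^kP_{k-j}^{(k)}\big(\|f^{j-\theta}\|+\|\tilde\psi^{j-\theta}\|\big)\Big]$$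 $$\le C\Big[\|\nabla_h\phi\|+t_n\|\nabla_h\psi\|+\max_{1\le k\le n}\big\{t_k^{\alpha/2}\big(\|f^{k-\theta}\|+\|\tilde\psi^{k-\theta}\|\big)\big\}\Big],$$ where $C>0$ is a generic constant (it may differ between the two bounds), independent of $n$, the time steps, $M_x$, $M_y$, $\phi$, $\psi$ and $f$.
   Context: Problem. $\Omega=(x_l,x_r)\times(y_l,y_r)$, $\mathbf{x}=(x,y)$, $T>0$. The scheme approximates $\mathcal{D}_t^\alpha u=\mathcal{A}u+f(\mathbf{x},t)$ in $\Omega\times(0,T]$, $u(\mathbf{x},0)=\phi(\mathbf{x})$, $u_t(\mathbf{x},0)=\psi(\mathbf{x})$, $u=0$ on $\partial\Omega\times(0,T]$, with $\mathcal{D}_t^\alpha$ the Caputo derivative and $\mathcal{A}u=a_1\partial_{xx}^2u+a_2\partial_{yy}^2u+b_1\partial_xu+b_2\partial_yu+b_3u$, all coefficients being functions of $(\mathbf{x},t)$. Auxiliary functions. Let $d(\mathbf{x})$ be a positive and continuous function on $\Omega$ and set $p:=\dfrac{d(\mathbf{x})e^{-C_pt}}{a_1a_2}$, $p_1:=pa_1$, $p_2:=pa_2$, $p_3:=b_1-p^{-1}(p_1)_x$, $p_4:=b_2-p^{-1}(p_2)_y$. Standing assumptions: $a_1,a_2$ are $C^3$ in $\mathbf{x}\in\Omega$ for fixed $t$; $|b_l(\mathbf{x},t)|\le C_l$ for $l=1,2,3$ with positive constants $C_l$; and there are positive constants $\tilde C_l,\hat C_l$ with $\tilde C_0\le|p|\le\hat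 C_0$ and $\tilde C_l\le|p_l|\le\hat C_l$ for $l=1,2,3,4$ on $\Omega\times[0,T]$. Time mesh. $0=t_0<t_1<\cdots<t_N=T$, $\tau_k:=t_k-t_{k-1}$, $\rho_k:=\tau_k/\tau_{k+1}$ with $\max_k\rho_k\le7/4$; $t_{n-\theta}:=(1-\theta)t_n+\theta t_{n-1}$, $t_{k-\frac12}:=(t_{k-1}+t_k)/2$; $\omega_\mu(t):=t^{\mu-1}/\Gamma(\mu)$. Alikhanov formula. $a_{n-k}^{(n)}:=\frac1{\tau_k}\int_{t_{k-1}}^{\min\{t_k,t_{n-\theta}\}}\omega_{1-\beta}(t_{n-\theta}-s)\,ds$ $(1\le k\le n)$, $b_{n-k}^{(n)}:=\frac2{\tau_k(\tau_k+\tau_{k+1})}\int_{t_{k-1}}^{t_k}\omega_{1-\beta}(t_{n-\theta}-s)(s-t_{k-\frac12})\,ds$ $(1\le k\le n-1)$. $A_0^{(1)}:=a_0^{(1)}$; for $n\ge2$: $A_0^{(n)}:=a_0^{(n)}+\rho_{n-1}b_1^{(n)}$, $A_{n-k}^{(n)}:=a_{n-k}^{(n)}+\rho_{k-1}b_{n-k+1}^{(n)}-b_{n-k}^{(n)}$ $(2\le k\le n-1)$, $A_{n-1}^{(n)}:=a_{n-1}^{(n)}-b_{n-1}^{(n)}$. Then $(\mathcal{D}_\tau^\beta g)^{n-\theta}:=\sum_{k=1}^nA_{n-k}^{(n)}(g^k-g^{k-1})$. The discrete complementary convolution kernels $P_{n-j}^{(n)}$ are determined by $\sum_{j=k}^nP_{n-j}^{(n)}A_{j-k}^{(j)}=1$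 for $1\le k\le n\le N$. Space mesh. $h_x=(x_r-x_l)/M_x$, $h_y=(y_r-y_l)/M_y$, $x_i=x_l+ih_x$, $y_j=y_l+jh_y$; $\Omega_h=\{(x_i,y_j):1\le i\le M_x-1,1\le j\le M_y-1\}$, $\mathbf{x}_h$ denotes a point of $\Omega_h$. $\delta_xu_{i+\frac12,j}:=(u_{i+1,j}-u_{i,j})/h_x$, $\delta_{\hat x}u_{i,j}:=(u_{i+1,j}-u_{i-1,j})/(2h_x)$, and $\delta_y,\delta_{\hat y}$ analogously. Writing $w_h^{n-\theta}$ for $w(\cdot,t_{n-\theta})$ evaluated at grid points for the coefficient functions (or at half-points for $p_1,p_2$ inside $\delta_x[\,\cdot\,]$, $\delta_y[\,\cdot\,]$), $$\mathcal{A}_h^{n-\theta}:=(p_h^{n-\theta})^{-1}\{\delta_x[(p_1)_h^{n-\theta}\delta_x]+\delta_y[(p_2)_h^{n-\theta}\delta_y]\}+(p_3)_h^{n-\theta}\delta_{\hat x}+(p_4)_h^{n-\theta}\delta_{\hat y}+(b_3)_h^{n-\theta},$$ where e.g. $\delta_x[p_1\delta_x]u_{i,j}=\frac1{h_x}\big((p_1)_{i+\frac12,j}\delta_xu_{i+\frac12,j}-(p_1)_{i-\frac12,j}\delta_xu_{i-\frac12,j}\big)$. Norms. $\phi_h,\psi_h$ are the restrictions of $\phi,\psi$ to $\Omega_h$; all grid functions are taken to vanish at boundary grid points. $\|u\|^2=h_xh_y\sum_{\mathbf{x}_h\in\Omega_h}|u_h|^2$, $\|\delta_xu\|^2=h_xh_y\sum_{i=0}^{M_x-1}\sum_{j=1}^{M_y-1}|\delta_xu_{i+\frac12,j}|^2$,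 $\|\delta_yu\|^2=h_xh_y\sum_{i=1}^{M_x-1}\sum_{j=0}^{M_y-1}|\delta_yu_{i,j+\frac12}|^2$, $\|\nabla_hu\|:=\sqrt{\|\delta_xu\|^2+\|\delta_yu\|^2}$.
   Formalization: The first bound is proved only when all time steps are at most a threshold depending only on the continuous problem and α (not on the mesh, M_x, M_y or data); without it the bound fails, e.g. N=1, M_x=M_y=2 with a suitable large positive b_3. The second bound holds for all meshes. *)

theory Defs
  imports "HOL-Analysis.Analysis"
begin

section \<open>Problem data\<close>

text \<open>\<open>weight\<close> is the auxiliary function d, \<open>C_p\<close> the constant in its exponential factor. Space
  points are pairs; a coefficient takes a space point and a time.\<close>

record problem =
  x_l :: real
  x_r :: real
  y_l :: real
  y_r :: real
  T_end :: real
  a1 :: "real \<times> real \<Rightarrow> real \<Rightarrow> real"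
  a2 :: "real \<times> real \<Rightarrow> real \<Rightarrow> real"
  b1 :: "real \<times> real \<Rightarrow> real \<Rightarrow> real"
  b2 :: "real \<times> real \<Rightarrow> real \<Rightarrow> real"
  b3 :: "real \<times> real \<Rightarrow> real \<Rightarrow> real"
  weight :: "real \<times> real \<Rightarrow> real"
  C_p :: real

definition Omega :: "problem \<Rightarrow> (real \<times> real) set" where
  "Omega Q = {x_l Q <..< x_r Q} \<times> {y_l Q <..< y_r Q}"

definition pdx :: "(real \<times> real \<Rightarrow> real) \<Rightarrow> real \<times> real \<Rightarrow> real" where
  "pdx g z = deriv (\<lambda>s. g (s, snd z)) (fst z)"

definition pdy :: "(real \<times> real \<Rightarrow> real) \<Rightarrow> real \<times> real \<Rightarrow> real" where
  "pdy g z = deriv (\<lambda>s. g (fst z, s)) (snd z)"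

text \<open>k times continuously differentiable on S (meant for open S): all partial derivatives up to
  order k exist and are continuous.\<close>

fun Ck_on :: "nat \<Rightarrow> (real \<times> real \<Rightarrow> real) \<Rightarrow> (real \<times> real) set \<Rightarrow> bool" where
  "Ck_on 0 g S = continuous_on S g"
| "Ck_on (Suc k) g S =
     (continuous_on S g \<and>
      (\<forall>z\<in>S. (\<lambda>s. g (s, snd z)) differentiable (at (fst z)) \<and>
             (\<lambda>s. g (fst z, s)) differentiable (at (snd z))) \<and>
      Ck_on k (pdx g) S \<and> Ck_on k (pdy g) S)"

text \<open>Time derivative on \<open>[0, T]\<close>, one-sided at the end points.\<close>

definition dt_on :: "real \<Rightarrow> (real \<Rightarrow> real) \<Rightarrow> real \<Rightarrow> real" where
  "dt_on T g t = vector_derivative g (at t within {0..T})"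

definition C1_time :: "real \<Rightarrow> (real \<Rightarrow> real) \<Rightarrow> bool" where
  "C1_time T g \<longleftrightarrow> g differentiable_on {0..T} \<and> continuous_on {0..T} (dt_on T g)"

definition p0 :: "problem \<Rightarrow> real \<times> real \<Rightarrow> real \<Rightarrow> real" where
  "p0 Q z t = weight Q z * exp (- C_p Q * t) / (a1 Q z t * a2 Q z t)"

definition p1 :: "problem \<Rightarrow> real \<times> real \<Rightarrow> real \<Rightarrow> real" where
  "p1 Q z t = p0 Q z t * a1 Q z t"

definition p2 :: "problem \<Rightarrow> real \<times> real \<Rightarrow> real \<Rightarrow> real" where
  "p2 Q z t = p0 Q z t * a2 Q z t"

definition p3 :: "problem \<Rightarrow> real \<times> real \<Rightarrow> real \<Rightarrow> real" where
  "p3 Q z t = b1 Q z t - inverse (p0 Q z t) * pdx (\<lambda>w. p1 Q w t) z"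

definition p4 :: "problem \<Rightarrow> real \<times> real \<Rightarrow> real \<Rightarrow> real" where
  "p4 Q z t = b2 Q z t - inverse (p0 Q z t) * pdy (\<lambda>w. p2 Q w t) z"

definition elliptic_op ::
  "problem \<Rightarrow> (real \<times> real \<Rightarrow> real \<Rightarrow> real) \<Rightarrow> real \<times> real \<Rightarrow> real \<Rightarrow> real" where
  "elliptic_op Q g z t =
     a1 Q z t * pdx (pdx (\<lambda>w. g w t)) z + a2 Q z t * pdy (pdy (\<lambda>w. g w t)) z
     + b1 Q z t * pdx (\<lambda>w. g w t) z + b2 Q z t * pdy (\<lambda>w. g w t) z
     + b3 Q z t * g z t"

text \<open>\<open>C l\<close> bounds \<open>b_l\<close>; \<open>Clow l\<close> and \<open>Chigh l\<close> are the lower and upper bounds of \<open>|p_l|\<close>,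
  with index 0 for p itself.\<close>

definition standing_assumptions ::
  "problem \<Rightarrow> (nat \<Rightarrow> real) \<Rightarrow> (nat \<Rightarrow> real) \<Rightarrow> (nat \<Rightarrow> real) \<Rightarrow> bool" where
  "standing_assumptions Q C Clow Chigh \<longleftrightarrow>
     x_l Q < x_r Q \<and> y_l Q < y_r Q \<and> 0 < T_end Q \<and>
     (\<forall>z\<in>Omega Q. 0 < weight Q z) \<and> continuous_on (Omega Q) (weight Q) \<and>
     (\<forall>t\<in>{0..T_end Q}. Ck_on 3 (\<lambda>z. a1 Q z t) (Omega Q) \<and> Ck_on 3 (\<lambda>z. a2 Q z t) (Omega Q)) \<and>
     (\<forall>l\<in>{1..3}. 0 < C l) \<and> (\<forall>l\<in>{0..4}. 0 < Clow l \<and> 0 < Chigh l) \<and>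
     (\<forall>z\<in>Omega Q. \<forall>t\<in>{0..T_end Q}.
        \<bar>b1 Q z t\<bar> \<le> C 1 \<and> \<bar>b2 Q z t\<bar> \<le> C 2 \<and> \<bar>b3 Q z t\<bar> \<le> C 3 \<and>
        Clow 0 \<le> \<bar>p0 Q z t\<bar> \<and> \<bar>p0 Q z t\<bar> \<le> Chigh 0 \<and>
        Clow 1 \<le> \<bar>p1 Q z t\<bar> \<and> \<bar>p1 Q z t\<bar> \<le> Chigh 1 \<and>
        Clow 2 \<le> \<bar>p2 Q z t\<bar> \<and> \<bar>p2 Q z t\<bar> \<le> Chigh 2 \<and>
        Clow 3 \<le> \<bar>p3 Q z t\<bar> \<and> \<bar>p3 Q z t\<bar> \<le> Chigh 3 \<and>
        Clow 4 \<le> \<bar>p4 Q z t\<bar> \<and> \<bar>p4 Q z t\<bar> \<le> Chigh 4)"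


section \<open>Time mesh and the nonuniform Alikhanov formula\<close>

definition tau :: "(nat \<Rightarrow> real) \<Rightarrow> nat \<Rightarrow> real" where
  "tau t k = t k - t (k - 1)"

definition rho :: "(nat \<Rightarrow> real) \<Rightarrow> nat \<Rightarrow> real" where
  "rho t k = tau t k / tau t (k + 1)"

definition time_mesh :: "real \<Rightarrow> nat \<Rightarrow> (nat \<Rightarrow> real) \<Rightarrow> bool" where
  "time_mesh T N t \<longleftrightarrow>
     0 < N \<and> t 0 = 0 \<and> t N = T \<and> (\<forall>k\<in>{1..N}. t (k - 1) < t k) \<and>
     (\<forall>k\<in>{1..<N}. rho t k \<le> 7 / 4)"

text \<open>The value at the offset level \<open>n - \<theta>\<close>, for times as well as for sequences.\<close>

definition offset :: "real \<Rightarrow> (nat \<Rightarrow> real) \<Rightarrow> nat \<Rightarrow> real" where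
  "offset \<theta> g n = (1 - \<theta>) * g n + \<theta> * g (n - 1)"

definition omega :: "real \<Rightarrow> real \<Rightarrow> real" where
  "omega \<mu> s = s powr (\<mu> - 1) / Gamma \<mu>"

text \<open>In all the kernels below, including P, the last two arguments n k stand for the
  kernel with superscript (n) and subscript \<open>n - k\<close>.\<close>

definition alik_a :: "real \<Rightarrow> real \<Rightarrow> (nat \<Rightarrow> real) \<Rightarrow> nat \<Rightarrow> nat \<Rightarrow> real" where
  "alik_a \<beta> \<theta> t n k =
     1 / tau t k * integral {t (k - 1) .. min (t k) (offset \<theta> t n)}
       (\<lambda>s. omega (1 - \<beta>) (offset \<theta> t n - s))"

definition alik_b :: "real \<Rightarrow> real \<Rightarrow> (nat \<Rightarrow> real) \<Rightarrow> nat \<Rightarrow> nat \<Rightarrow> real" where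
  "alik_b \<beta> \<theta> t n k =
     2 / (tau t k * (tau t k + tau t (k + 1))) * integral {t (k - 1) .. t k}
       (\<lambda>s. omega (1 - \<beta>) (offset \<theta> t n - s) * (s - (t (k - 1) + t k) / 2))"

definition alik_A :: "real \<Rightarrow> real \<Rightarrow> (nat \<Rightarrow> real) \<Rightarrow> nat \<Rightarrow> nat \<Rightarrow> real" where
  "alik_A \<beta> \<theta> t n k =
     (if n = 1 then alik_a \<beta> \<theta> t 1 1
      else if k = n then alik_a \<beta> \<theta> t n n + rho t (n - 1) * alik_b \<beta> \<theta> t n (n - 1)
      else if k = 1 then alik_a \<beta> \<theta> t n 1 - alik_b \<beta> \<theta> t n 1
      else alik_a \<beta> \<theta> t n k + rho t (k - 1) * alik_b \<beta> \<theta> t n (k - 1) - alik_b \<beta> \<theta> t n k)"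

definition alik_D :: "real \<Rightarrow> real \<Rightarrow> (nat \<Rightarrow> real) \<Rightarrow> (nat \<Rightarrow> real) \<Rightarrow> nat \<Rightarrow> real" where
  "alik_D \<beta> \<theta> t g n = (\<Sum>k=1..n. alik_A \<beta> \<theta> t n k * (g k - g (k - 1)))"

text \<open>This triangular system determines \<open>P n j\<close> for \<open>1 \<le> j \<le> n \<le> N\<close>; other values are irrelevant.\<close>

definition complementary_kernels ::
  "real \<Rightarrow> real \<Rightarrow> nat \<Rightarrow> (nat \<Rightarrow> real) \<Rightarrow> (nat \<Rightarrow> nat \<Rightarrow> real) \<Rightarrow> bool" where
  "complementary_kernels \<beta> \<theta> N t P \<longleftrightarrow>
     (\<forall>n\<in>{1..N}. \<forall>k\<in>{1..n}. (\<Sum>j=k..n. P n j * alik_A \<beta> \<theta> t j k) = 1)"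


section \<open>Space mesh, difference operators and norms\<close>

text \<open>A grid function is a \<open>w :: nat \<Rightarrow> nat \<Rightarrow> real\<close>, used for arguments \<open>i \<le> Mx\<close>, \<open>j \<le> My\<close>.\<close>

definition hx :: "problem \<Rightarrow> nat \<Rightarrow> real" where
  "hx Q Mx = (x_r Q - x_l Q) / real Mx"

definition hy :: "problem \<Rightarrow> nat \<Rightarrow> real" where
  "hy Q My = (y_r Q - y_l Q) / real My"

text \<open>The indices are real numbers so that half-points are covered.\<close>

definition pt :: "problem \<Rightarrow> nat \<Rightarrow> nat \<Rightarrow> real \<Rightarrow> real \<Rightarrow> real \<times> real" where
  "pt Q Mx My i j = (x_l Q + i * hx Q Mx, y_l Q + j * hy Q My)"

definition interior_index :: "nat \<Rightarrow> nat \<Rightarrow> nat \<Rightarrow> nat \<Rightarrow> bool" where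
  "interior_index Mx My i j \<longleftrightarrow> 1 \<le> i \<and> i < Mx \<and> 1 \<le> j \<and> j < My"

definition restrict_grid ::
  "problem \<Rightarrow> nat \<Rightarrow> nat \<Rightarrow> (real \<times> real \<Rightarrow> real) \<Rightarrow> nat \<Rightarrow> nat \<Rightarrow> real" where
  "restrict_grid Q Mx My g i j =
     (if interior_index Mx My i j then g (pt Q Mx My (real i) (real j)) else 0)"

text \<open>\<open>delta_x Q Mx w i j\<close> is the difference quotient at \<open>(i + 1/2, j)\<close>; likewise \<open>delta_y\<close>
  at \<open>(i, j + 1/2)\<close>.\<close>

definition delta_x :: "problem \<Rightarrow> nat \<Rightarrow> (nat \<Rightarrow> nat \<Rightarrow> real) \<Rightarrow> nat \<Rightarrow> nat \<Rightarrow> real" where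
  "delta_x Q Mx w i j = (w (i + 1) j - w i j) / hx Q Mx"

definition delta_y :: "problem \<Rightarrow> nat \<Rightarrow> (nat \<Rightarrow> nat \<Rightarrow> real) \<Rightarrow> nat \<Rightarrow> nat \<Rightarrow> real" where
  "delta_y Q My w i j = (w i (j + 1) - w i j) / hy Q My"

definition delta_xhat :: "problem \<Rightarrow> nat \<Rightarrow> (nat \<Rightarrow> nat \<Rightarrow> real) \<Rightarrow> nat \<Rightarrow> nat \<Rightarrow> real" where
  "delta_xhat Q Mx w i j = (w (i + 1) j - w (i - 1) j) / (2 * hx Q Mx)"

definition delta_yhat :: "problem \<Rightarrow> nat \<Rightarrow> (nat \<Rightarrow> nat \<Rightarrow> real) \<Rightarrow> nat \<Rightarrow> nat \<Rightarrow> real" where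
  "delta_yhat Q My w i j = (w i (j + 1) - w i (j - 1)) / (2 * hy Q My)"

text \<open>The coefficients are taken at time s; for the scheme, \<open>s = offset \<theta> t n\<close>.\<close>

definition discrete_op ::
  "problem \<Rightarrow> nat \<Rightarrow> nat \<Rightarrow> real \<Rightarrow> (nat \<Rightarrow> nat \<Rightarrow> real) \<Rightarrow> nat \<Rightarrow> nat \<Rightarrow> real" where
  "discrete_op Q Mx My s w i j =
     inverse (p0 Q (pt Q Mx My (real i) (real j)) s) *
       ((p1 Q (pt Q Mx My (real i + 1/2) (real j)) s * delta_x Q Mx w i j
         - p1 Q (pt Q Mx My (real i - 1/2) (real j)) s * delta_x Q Mx w (i - 1) j) / hx Q Mx
        + (p2 Q (pt Q Mx My (real i) (real j + 1/2)) s * delta_y Q My w i j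
         - p2 Q (pt Q Mx My (real i) (real j - 1/2)) s * delta_y Q My w i (j - 1)) / hy Q My)
     + p3 Q (pt Q Mx My (real i) (real j)) s * delta_xhat Q Mx w i j
     + p4 Q (pt Q Mx My (real i) (real j)) s * delta_yhat Q My w i j
     + b3 Q (pt Q Mx My (real i) (real j)) s * w i j"

definition grid_norm :: "problem \<Rightarrow> nat \<Rightarrow> nat \<Rightarrow> (nat \<Rightarrow> nat \<Rightarrow> real) \<Rightarrow> real" where
  "grid_norm Q Mx My w =
     sqrt (hx Q Mx * hy Q My * (\<Sum>i=1..<Mx. \<Sum>j=1..<My. \<bar>w i j\<bar>\<^sup>2))"

definition norm_dx :: "problem \<Rightarrow> nat \<Rightarrow> nat \<Rightarrow> (nat \<Rightarrow> nat \<Rightarrow> real) \<Rightarrow> real" where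
  "norm_dx Q Mx My w =
     sqrt (hx Q Mx * hy Q My * (\<Sum>i=0..<Mx. \<Sum>j=1..<My. \<bar>delta_x Q Mx w i j\<bar>\<^sup>2))"

definition norm_dy :: "problem \<Rightarrow> nat \<Rightarrow> nat \<Rightarrow> (nat \<Rightarrow> nat \<Rightarrow> real) \<Rightarrow> real" where
  "norm_dy Q Mx My w =
     sqrt (hx Q Mx * hy Q My * (\<Sum>i=1..<Mx. \<Sum>j=0..<My. \<bar>delta_y Q My w i j\<bar>\<^sup>2))"

definition grad_norm :: "problem \<Rightarrow> nat \<Rightarrow> nat \<Rightarrow> (nat \<Rightarrow> nat \<Rightarrow> real) \<Rightarrow> real" where
  "grad_norm Q Mx My w = sqrt ((norm_dx Q Mx My w)\<^sup>2 + (norm_dy Q Mx My w)\<^sup>2)"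


section \<open>The scheme\<close>

definition f_offset ::
  "problem \<Rightarrow> real \<Rightarrow> (nat \<Rightarrow> real) \<Rightarrow> nat \<Rightarrow> nat \<Rightarrow> (real \<times> real \<Rightarrow> real \<Rightarrow> real) \<Rightarrow>
   nat \<Rightarrow> nat \<Rightarrow> nat \<Rightarrow> real" where
  "f_offset Q \<theta> t Mx My f n = restrict_grid Q Mx My (\<lambda>z. f z (offset \<theta> t n))"

definition psi_offset ::
  "problem \<Rightarrow> real \<Rightarrow> (nat \<Rightarrow> real) \<Rightarrow> nat \<Rightarrow> nat \<Rightarrow> (real \<times> real \<Rightarrow> real) \<Rightarrow>
   nat \<Rightarrow> nat \<Rightarrow> nat \<Rightarrow> real" where
  "psi_offset Q \<theta> t Mx My \<psi> n =
     restrict_grid Q Mx My (\<lambda>z. elliptic_op Q (\<lambda>w s. s * \<psi> w) z (offset \<theta> t n))"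

definition u_tilde ::
  "problem \<Rightarrow> (nat \<Rightarrow> real) \<Rightarrow> nat \<Rightarrow> nat \<Rightarrow> (real \<times> real \<Rightarrow> real) \<Rightarrow>
   (nat \<Rightarrow> nat \<Rightarrow> nat \<Rightarrow> real) \<Rightarrow> nat \<Rightarrow> nat \<Rightarrow> nat \<Rightarrow> real" where
  "u_tilde Q t Mx My \<psi> u n i j = u n i j - t n * restrict_grid Q Mx My \<psi> i j"

definition scheme_solution ::
  "problem \<Rightarrow> real \<Rightarrow> real \<Rightarrow> nat \<Rightarrow> (nat \<Rightarrow> real) \<Rightarrow> nat \<Rightarrow> nat \<Rightarrow>
   (real \<times> real \<Rightarrow> real) \<Rightarrow> (real \<times> real \<Rightarrow> real) \<Rightarrow> (real \<times> real \<Rightarrow> real \<Rightarrow> real) \<Rightarrow>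
   (nat \<Rightarrow> nat \<Rightarrow> nat \<Rightarrow> real) \<Rightarrow> (nat \<Rightarrow> nat \<Rightarrow> nat \<Rightarrow> real) \<Rightarrow> bool" where
  "scheme_solution Q \<beta> \<theta> N t Mx My \<phi> \<psi> f u v \<longleftrightarrow>
     (let ut = u_tilde Q t Mx My \<psi> u in
     (\<forall>i\<le>Mx. \<forall>j\<le>My. u 0 i j = restrict_grid Q Mx My \<phi> i j \<and> v 0 i j = 0) \<and>
     (\<forall>n\<in>{1..N}. \<forall>i\<le>Mx. \<forall>j\<le>My.
        \<not> interior_index Mx My i j \<longrightarrow> u n i j = 0 \<and> v n i j = 0) \<and>
     (\<forall>n\<in>{1..N}. \<forall>i j. interior_index Mx My i j \<longrightarrow>
        alik_D \<beta> \<theta> t (\<lambda>k. v k i j) n =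
          discrete_op Q Mx My (offset \<theta> t n) (\<lambda>i' j'. offset \<theta> (\<lambda>k. ut k i' j') n) i j
          + f_offset Q \<theta> t Mx My f n i j + psi_offset Q \<theta> t Mx My \<psi> n i j \<and>
        offset \<theta> (\<lambda>k. v k i j) n = alik_D \<beta> \<theta> t (\<lambda>k. ut k i j) n))"

definition source_norm ::
  "problem \<Rightarrow> real \<Rightarrow> (nat \<Rightarrow> real) \<Rightarrow> nat \<Rightarrow> nat \<Rightarrow> (real \<times> real \<Rightarrow> real) \<Rightarrow>
   (real \<times> real \<Rightarrow> real \<Rightarrow> real) \<Rightarrow> nat \<Rightarrow> real" where
  "source_norm Q \<theta> t Mx My \<psi> f k =
     grid_norm Q Mx My (f_offset Q \<theta> t Mx My f k) +
     grid_norm Q Mx My (psi_offset Q \<theta> t Mx My \<psi> k)"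

definition data_norm ::
  "problem \<Rightarrow> (nat \<Rightarrow> real) \<Rightarrow> nat \<Rightarrow> nat \<Rightarrow> (real \<times> real \<Rightarrow> real) \<Rightarrow>
   (real \<times> real \<Rightarrow> real) \<Rightarrow> nat \<Rightarrow> real" where
  "data_norm Q t Mx My \<phi> \<psi> n =
     grad_norm Q Mx My (restrict_grid Q Mx My \<phi>) +
     t n * grad_norm Q Mx My (restrict_grid Q Mx My \<psi>)"

end

theory Submission
  imports Defs
begin

text \<open>Why the estimate holds. Test the equation for v with \<open>p v\<close> at the offset level. After summation by
  parts in space, the second-order terms pair \<open>\<delta> u\<close> with \<open>\<delta> v\<close>, and v is itself the discrete fractional
  derivative of the shifted displacement \<open>u - t \<psi>\<close>; hence both v and the gradient of the shifted
  displacement enter through expressions of the form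
  \<open>w\<^bsup>n-\<theta>\<^esup> D w\<close>. Such an expression is bounded below by half of the discrete derivative of \<open>w\<^sup>2\<close>
  (\<open>alik_D_weighted_square_le\<close>). The weights \<open>p\<close>, \<open>p\<^sub>1\<close>, \<open>p\<^sub>2\<close> may be included because the factor
  \<open>e\<^sup>-\<^sup>C\<^sup>t\<close>, with C the constant \<open>C_p\<close>, makes them decrease in time (\<open>p_decreasing\<close>). With E the resulting
  discrete energy and S the norm of the data, this gives (\<open>energy_recursion\<close>)

    \<open>D E\<^sup>n \<le> \<Lambda> (E\<^sup>n + E\<^sup>n\<^sup>-\<^sup>1) + \<sigma> S\<^sup>n (\<surd>E\<^sup>n + \<surd>E\<^sup>n\<^sup>-\<^sup>1)\<close>,

  and a discrete Gronwall inequality (\<open>discrete_gronwall\<close>) finishes the first bound.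

  Three facts about the Alikhanov kernels \<open>A\<^bsub>n,k\<^esub>\<close> (lower index k for the increment from \<open>t\<^sub>k\<^sub>-\<^sub>1\<close> to
  \<open>t\<^sub>k\<close>) are used: the lower bound \<open>A\<^bsub>n,k\<^esub> \<ge> 4/11 \<omega>\<^bsub>1-\<beta>\<^esub>(t\<^sub>n - t\<^sub>k\<^sub>-\<^sub>1)\<close> (\<open>alik_A_ge\<close>), monotonicity in k
  (\<open>alik_A_mono\<close>), and \<open>(1 - \<theta>) A\<^bsub>n,n-1\<^esub> \<le> (1 - 2\<theta>) A\<^bsub>n,n\<^esub>\<close> (\<open>alik_A_gap\<close>). They follow from the
  monotonicity and convexity of the history kernel and from the restriction 7/4 on the step ratios.

  Monotonicity makes the complementary kernels P nonnegative, and P inverts the discrete derivative up to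
  the initial value (\<open>complementary_alik_D\<close>). So any sequence with a known lower bound for its discrete
  derivative yields an upper bound for a sum against P (\<open>complementary_comparison\<close>). The unit jump at
  \<open>t\<^sub>0\<close> gives a bound for \<open>\<Sum>\<^sub>j P\<^bsub>k,j\<^esub> t\<^sub>j\<^sup>-\<^sup>\<beta>\<close>, hence the second inequality. An exponential that jumps from 0
  at \<open>t\<^sub>0\<close> gives the Gronwall inequality: for a suitable exponent and small steps its discrete
  derivative exceeds any prescribed multiple of itself, so it dominates the feedback of the energy.\<close>

section \<open>The Alikhanov kernels\<close>

lemma has_integral_centred:
  fixes a b :: real
  assumes "a \<le> b"
  shows "((\<lambda>s. s - (a + b) / 2) has_integral 0) {a..b}"
proof -
  have "((\<lambda>s. s - (a + b) / 2) has_integral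
      (b - (a + b) / 2)\<^sup>2 / 2 - (a - (a + b) / 2)\<^sup>2 / 2) {a..b}"
    using assms
    by (intro fundamental_theorem_of_calculus)
       (auto intro!: derivative_eq_intros simp flip: has_real_derivative_iff_has_vector_derivative)
  moreover have "(b - (a + b) / 2)\<^sup>2 / 2 - (a - (a + b) / 2)\<^sup>2 / 2 = 0"
    by (simp add: power2_eq_square field_simps)
  ultimately show ?thesis by simp
qed

lemma has_integral_centred_square:
  fixes a b :: real
  assumes "a \<le> b"
  shows "((\<lambda>s. (s - (a + b) / 2)\<^sup>2) has_integral (b - a) ^ 3 / 12) {a..b}"
proof -
  have "((\<lambda>s. (s - (a + b) / 2)\<^sup>2) has_integral
      (b - (a + b) / 2) ^ 3 / 3 - (a - (a + b) / 2) ^ 3 / 3) {a..b}"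
    using assms
    by (intro fundamental_theorem_of_calculus)
       (auto intro!: derivative_eq_intros simp flip: has_real_derivative_iff_has_vector_derivative)
  moreover have "(b - (a + b) / 2) ^ 3 / 3 - (a - (a + b) / 2) ^ 3 / 3 = (b - a) ^ 3 / 12"
    by (simp add: power3_eq_cube field_simps)
  ultimately show ?thesis by simp
qed

lemma integral_centred:
  fixes g :: "real \<Rightarrow> real" and c :: real
  assumes "a \<le> b" and "continuous_on {a..b} g"
  shows "integral {a..b} (\<lambda>s. g s * (s - (a + b) / 2))
    = integral {a..b} (\<lambda>s. (g s - c) * (s - (a + b) / 2))"
proof -
  have "((\<lambda>s. g s * (s - (a + b) / 2)) has_integral
      integral {a..b} (\<lambda>s. g s * (s - (a + b) / 2))) {a..b}"
    using assms by (intro integrable_integral integrable_continuous_real continuous_intros)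
  from has_integral_diff[OF this has_integral_mult_right[OF has_integral_centred[OF assms(1)], of c]]
  have "((\<lambda>s. (g s - c) * (s - (a + b) / 2)) has_integral
      integral {a..b} (\<lambda>s. g s * (s - (a + b) / 2))) {a..b}"
    by (simp add: left_diff_distrib)
  then show ?thesis by (simp add: integral_unique)
qed

text \<open>The next four lemmas bound the mean and the centred first moment of g over an interval. In
  the last two, m bounds its difference quotients from above, respectively those ending at b from below.\<close>

lemma integral_centred_nonneg:
  fixes g :: "real \<Rightarrow> real"
  assumes "a \<le> b" and "continuous_on {a..b} g" and "mono_on {a..b} g"
  shows "0 \<le> integral {a..b} (\<lambda>s. g s * (s - (a + b) / 2))"
proof -
  let ?m = "(a + b) / 2"
  have "0 \<le> (g s - g ?m) * (s - ?m)" if "s \<in> {a..b}" for s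
    using that assms(1) mono_onD[OF assms(3), of s ?m] mono_onD[OF assms(3), of ?m s]
    by (cases "s \<le> ?m") (auto simp: zero_le_mult_iff)
  then show ?thesis
    unfolding integral_centred[OF assms(1,2), of "g ?m"]
    using assms by (intro integral_nonneg integrable_continuous_real continuous_intros)
qed

lemma integral_centred_le_average:
  fixes g :: "real \<Rightarrow> real"
  assumes "a \<le> b" and "continuous_on {a..b} g" and "\<And>s. s \<in> {a..b} \<Longrightarrow> c \<le> g s"
  shows "integral {a..b} (\<lambda>s. g s * (s - (a + b) / 2))
    \<le> (b - a) / 2 * (integral {a..b} g - (b - a) * c)"
proof -
  have "integral {a..b} (\<lambda>s. (g s - c) * (s - (a + b) / 2))
      \<le> integral {a..b} (\<lambda>s. (g s - c) * ((b - a) / 2))"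
  proof (rule integral_le)
    show "(g s - c) * (s - (a + b) / 2) \<le> (g s - c) * ((b - a) / 2)" if "s \<in> {a..b}" for s
      using that assms(3)[OF that] by (intro mult_left_mono) (auto simp: field_simps)
  qed (use assms in \<open>auto intro!: integrable_continuous_real continuous_intros\<close>)
  also have "\<dots> = (b - a) / 2 * (integral {a..b} g - (b - a) * c)"
  proof -
    have "integral {a..b} (\<lambda>s. g s - c) = integral {a..b} g - (b - a) * c"
      using assms by (subst integral_diff) (auto intro!: integrable_continuous_real)
    then show ?thesis by simp
  qed
  finally show ?thesis using integral_centred[OF assms(1,2), of c] by simp
qed

lemma integral_centred_le_slope:
  fixes g :: "real \<Rightarrow> real"
  assumes "a \<le> b" and "continuous_on {a..b} g"
    and slope: "\<And>r s. \<lbrakk>a \<le> r; r \<le> s; s \<le> b\<rbrakk> \<Longrightarrow> g s - g r \<le> m * (s - r)"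
  shows "integral {a..b} (\<lambda>s. g s * (s - (a + b) / 2)) \<le> m * ((b - a) ^ 3 / 12)"
proof -
  let ?m = "(a + b) / 2"
  have "integral {a..b} (\<lambda>s. (g s - g ?m) * (s - ?m)) \<le> integral {a..b} (\<lambda>s. m * (s - ?m)\<^sup>2)"
  proof (rule integral_le)
    show "(g s - g ?m) * (s - ?m) \<le> m * (s - ?m)\<^sup>2" if s: "s \<in> {a..b}" for s
    proof (cases "s \<le> ?m")
      case True
      then have "(g ?m - g s) * (?m - s) \<le> (m * (?m - s)) * (?m - s)"
        using s slope[of s ?m] by (intro mult_right_mono) auto
      then have "(g ?m - g s) * (?m - s) \<le> m * (?m - s)\<^sup>2"
        by (simp only: power2_eq_square mult.assoc)
      moreover have "(g ?m - g s) * (?m - s) = (g s - g ?m) * (s - ?m)"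
        by (metis minus_diff_eq minus_mult_minus)
      ultimately show ?thesis by (simp only: power2_commute)
    next
      case False
      then have "(g s - g ?m) * (s - ?m) \<le> (m * (s - ?m)) * (s - ?m)"
        using s slope[of ?m s] by (intro mult_right_mono) auto
      then show ?thesis by (simp only: power2_eq_square mult.assoc)
    qed
  qed (use assms in \<open>auto intro!: integrable_continuous_real continuous_intros\<close>)
  also have "\<dots> = m * ((b - a) ^ 3 / 12)"
    using has_integral_mult_right[OF has_integral_centred_square[OF assms(1)], of m]
    by (rule integral_unique)
  finally show ?thesis using integral_centred[OF assms(1,2), of "g ?m"] by simp
qed

lemma integral_le_slope:
  fixes g :: "real \<Rightarrow> real"
  assumes "a \<le> b" and "continuous_on {a..b} g"
    and slope: "\<And>s. \<lbrakk>a \<le> s; s \<le> b\<rbrakk> \<Longrightarrow> m * (b - s) \<le> g b - g s"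
  shows "integral {a..b} g \<le> (b - a) * g b - m * ((b - a)\<^sup>2 / 2)"
proof -
  have "((\<lambda>s. g b - m * (b - s)) has_integral
      (g b * b + m * ((b - b)\<^sup>2 / 2)) - (g b * a + m * ((b - a)\<^sup>2 / 2))) {a..b}"
    using assms(1)
    by (intro fundamental_theorem_of_calculus)
       (auto intro!: derivative_eq_intros simp: field_simps
          simp flip: has_real_derivative_iff_has_vector_derivative)
  moreover have "(g b * b + m * ((b - b)\<^sup>2 / 2)) - (g b * a + m * ((b - a)\<^sup>2 / 2))
      = (b - a) * g b - m * ((b - a)\<^sup>2 / 2)"
    by (simp add: algebra_simps)
  ultimately have upper:
    "((\<lambda>s. g b - m * (b - s)) has_integral (b - a) * g b - m * ((b - a)\<^sup>2 / 2)) {a..b}"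
    by (simp only:)
  have lower: "(g has_integral integral {a..b} g) {a..b}"
    using assms(2) by (intro integrable_integral integrable_continuous_real)
  have "g s \<le> g b - m * (b - s)" if "s \<in> {a..b}" for s
    using slope[of s] that by simp
  then show ?thesis by (rule has_integral_le[OF lower upper])
qed

text \<open>The history kernel \<open>s \<mapsto> \<omega>\<^bsub>1-\<beta>\<^esub>(T - s)\<close> is positive, increasing and convex on \<open>s < T\<close>;
  its slope at x separates the difference quotients on the two sides of x.\<close>

lemma omega_pos: "0 < \<beta> \<Longrightarrow> \<beta> < 1 \<Longrightarrow> 0 < r \<Longrightarrow> 0 < omega (1 - \<beta>) r"
  by (simp add: omega_def)

lemma omega_antimono:
  assumes "0 < \<beta>" "\<beta> < 1" "0 < r" "r \<le> s"
  shows "omega (1 - \<beta>) s \<le> omega (1 - \<beta>) r"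
  unfolding omega_def using assms
  by (intro divide_right_mono powr_mono2') auto

lemma continuous_on_history:
  assumes "\<And>s. s \<in> S \<Longrightarrow> s < T"
  shows "continuous_on S (\<lambda>s. omega (1 - \<beta>) (T - s))"
  unfolding omega_def divide_inverse using assms
  by (intro continuous_intros) (auto simp: less_imp_neq)

text \<open>The derivative of the history kernel \<open>s \<mapsto> \<omega>\<^bsub>1-\<beta>\<^esub>(T - s)\<close> at x.\<close>

definition history_slope :: "real \<Rightarrow> real \<Rightarrow> real \<Rightarrow> real" where
  "history_slope \<beta> T x = \<beta> * (T - x) powr (- \<beta> - 1) / Gamma (1 - \<beta>)"

lemma history_slope_pos: "0 < \<beta> \<Longrightarrow> \<beta> < 1 \<Longrightarrow> x < T \<Longrightarrow> 0 < history_slope \<beta> T x"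
  by (simp add: history_slope_def)

lemma history_mean_value:
  assumes "0 < \<beta>" "\<beta> < 1" "r < s" "s < T"
  obtains \<xi> where "r < \<xi>" "\<xi> < s"
    "omega (1 - \<beta>) (T - s) - omega (1 - \<beta>) (T - r) = (s - r) * history_slope \<beta> T \<xi>"
proof -
  have Gamma_nz: "Gamma (1 - \<beta>) \<noteq> 0"
    using assms Gamma_real_pos[of "1 - \<beta>"] by linarith
  have "\<exists>\<xi>>r. \<xi> < s \<and> omega (1 - \<beta>) (T - s) - omega (1 - \<beta>) (T - r)
      = (s - r) * history_slope \<beta> T \<xi>"
  proof (rule MVT2[OF assms(3)])
    fix x assume "r \<le> x" "x \<le> s"
    then show "((\<lambda>s. omega (1 - \<beta>) (T - s)) has_real_derivative history_slope \<beta> T x) (at x)"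
      using assms Gamma_nz unfolding omega_def history_slope_def
      by (auto intro!: derivative_eq_intros simp: Gamma_nz)
  qed
  then show ?thesis using that by blast
qed

lemma history_slope_mono:
  assumes "0 < \<beta>" "\<beta> < 1" "r \<le> s" "s < T"
  shows "history_slope \<beta> T r \<le> history_slope \<beta> T s"
  unfolding history_slope_def using assms
  by (intro divide_right_mono mult_left_mono powr_mono2') auto

lemma history_quotient_le:
  assumes "0 < \<beta>" "\<beta> < 1" "r \<le> s" "s \<le> x" "x < T"
  shows "omega (1 - \<beta>) (T - s) - omega (1 - \<beta>) (T - r) \<le> history_slope \<beta> T x * (s - r)"
proof (cases "r < s")
  case True
  then obtain \<xi> where "r < \<xi>" "\<xi> < s"
    "omega (1 - \<beta>) (T - s) - omega (1 - \<beta>) (T - r) = (s - r) * history_slope \<beta> T \<xi>"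
    using history_mean_value[of \<beta> r s T] assms by auto
  then show ?thesis
    using history_slope_mono[of \<beta> \<xi> x T] assms by (simp add: mult.commute mult_right_mono)
qed (use assms in auto)

lemma history_quotient_ge:
  assumes "0 < \<beta>" "\<beta> < 1" "x \<le> r" "r \<le> s" "s < T"
  shows "history_slope \<beta> T x * (s - r) \<le> omega (1 - \<beta>) (T - s) - omega (1 - \<beta>) (T - r)"
proof (cases "r < s")
  case True
  then obtain \<xi> where "r < \<xi>" "\<xi> < s"
    "omega (1 - \<beta>) (T - s) - omega (1 - \<beta>) (T - r) = (s - r) * history_slope \<beta> T \<xi>"
    using history_mean_value[of \<beta> r s T] assms by auto
  then show ?thesis
    using history_slope_mono[of \<beta> x \<xi> T] assms by (simp add: mult.commute mult_right_mono)
qed (use assms in auto)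

lemma has_integral_history_to_singularity:
  assumes "0 < \<beta>" "\<beta> < 1" "a < T"
  shows "((\<lambda>s. omega (1 - \<beta>) (T - s)) has_integral (T - a) / (1 - \<beta>) * omega (1 - \<beta>) (T - a)) {a..T}"
proof -
  have Gamma_nz: "Gamma (1 - \<beta>) \<noteq> 0"
    using assms Gamma_real_pos[of "1 - \<beta>"] by linarith
  let ?F = "\<lambda>s. - ((T - s) powr (1 - \<beta>) / ((1 - \<beta>) * Gamma (1 - \<beta>)))"
  have "((\<lambda>s. omega (1 - \<beta>) (T - s)) has_integral ?F T - ?F a) {a..T}"
  proof (rule fundamental_theorem_of_calculus_interior)
    show "continuous_on {a..T} ?F"
      using assms by (intro continuous_intros continuous_on_powr') (auto simp: Gamma_nz)
    fix x assume "x \<in> {a<..<T}"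
    then have "(?F has_real_derivative omega (1 - \<beta>) (T - x)) (at x)"
      using assms unfolding omega_def
      by (auto intro!: derivative_eq_intros simp: Gamma_nz divide_simps)
    then show "(?F has_vector_derivative omega (1 - \<beta>) (T - x)) (at x)"
      by (simp add: has_real_derivative_iff_has_vector_derivative)
  qed (use assms in auto)
  moreover have "(T - a) powr (1 - \<beta>) = (T - a) * (T - a) powr (- \<beta>)"
    using assms powr_add[of "T - a" 1 "- \<beta>"] by simp
  ultimately show ?thesis using assms by (simp add: omega_def)
qed

text \<open>A time mesh together with the exponent and the offset of the Alikhanov formula.\<close>

locale alikhanov_mesh =
  fixes \<beta> \<theta> T :: real and N :: nat and t :: "nat \<Rightarrow> real"
  assumes beta_pos: "0 < \<beta>" and beta_less_1: "\<beta> < 1" and theta_eq: "2 * \<theta> = \<beta>"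
    and mesh: "time_mesh T N t"
begin

text \<open>The history kernel seen from the offset level \<open>t\<^bsub>n-\<theta>\<^esub>\<close>.\<close>

abbreviation hist :: "nat \<Rightarrow> real \<Rightarrow> real" where
  "hist n s \<equiv> omega (1 - \<beta>) (offset \<theta> t n - s)"

lemma theta_pos: "0 < \<theta>" and theta_less_half: "\<theta> < 1 / 2"
  using beta_pos beta_less_1 theta_eq by auto

lemma t_0: "t 0 = 0"
  using mesh by (simp add: time_mesh_def)

lemma t_Suc_less: "k < N \<Longrightarrow> t k < t (Suc k)"
  using mesh bspec[of "{1..N}" "\<lambda>k. t (k - 1) < t k" "Suc k"] by (simp add: time_mesh_def)

lemma t_mono: "i \<le> j \<Longrightarrow> j \<le> N \<Longrightarrow> t i \<le> t j"
proof (induction j rule: dec_induct)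
  case (step j)
  then show ?case using t_Suc_less[of j] by simp
qed simp

lemma t_nonneg: "k \<le> N \<Longrightarrow> 0 \<le> t k"
  using t_mono[of 0 k] t_0 by simp

lemma t_pos: "1 \<le> k \<Longrightarrow> k \<le> N \<Longrightarrow> 0 < t k"
  using t_mono[of 1 k] t_Suc_less[of 0] t_0 by simp

lemma t_le_T: "k \<le> N \<Longrightarrow> t k \<le> T"
  using t_mono[of k N] mesh by (simp add: time_mesh_def)

lemma tau_pos: "1 \<le> k \<Longrightarrow> k \<le> N \<Longrightarrow> 0 < tau t k"
  using t_Suc_less[of "k - 1"] by (simp add: tau_def)

lemma tau_ratio: "1 \<le> k \<Longrightarrow> k < N \<Longrightarrow> tau t k \<le> 7 / 4 * tau t (Suc k)"
proof -
  assume k: "1 \<le> k" "k < N"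
  then have "tau t k / tau t (Suc k) \<le> 7 / 4"
    using mesh by (auto simp: time_mesh_def rho_def)
  then show ?thesis
    using tau_pos[of "Suc k"] k by (simp only: pos_divide_le_eq)
qed

lemma rho_nonneg: "1 \<le> k \<Longrightarrow> k < N \<Longrightarrow> 0 \<le> rho t k"
  using tau_pos[of k] tau_pos[of "Suc k"] by (simp add: rho_def)

lemma offset_eq: "offset \<theta> t n = t n - \<theta> * tau t n"
  by (simp add: offset_def tau_def algebra_simps)

lemma offset_less: "1 \<le> n \<Longrightarrow> n \<le> N \<Longrightarrow> offset \<theta> t n < t n"
  using tau_pos[of n] theta_pos by (simp add: offset_eq)

lemma offset_diff: "offset \<theta> t n - t (n - 1) = (1 - \<theta>) * tau t n"
  by (simp add: offset_def tau_def algebra_simps)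

lemma offset_greater: "1 \<le> n \<Longrightarrow> n \<le> N \<Longrightarrow> t (n - 1) < offset \<theta> t n"
  using tau_pos[of n] theta_less_half offset_diff[of n] mult_pos_pos[of "1 - \<theta>" "tau t n"]
  by linarith

lemma node_less_offset: "k < n \<Longrightarrow> n \<le> N \<Longrightarrow> t k < offset \<theta> t n"
proof -
  assume "k < n" "n \<le> N"
  then have "t k \<le> t (n - 1)" by (intro t_mono) auto
  also have "\<dots> < offset \<theta> t n"
    using offset_greater[of n] \<open>k < n\<close> \<open>n \<le> N\<close> by simp
  finally show ?thesis .
qed

lemma offset_0: "offset \<theta> t 0 = 0"
  by (simp add: offset_def t_0)

lemma offset_mono: "k \<le> n \<Longrightarrow> n \<le> N \<Longrightarrow> offset \<theta> t k \<le> offset \<theta> t n"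
proof (cases "k = n")
  case False
  assume "k \<le> n" "n \<le> N"
  with False have "offset \<theta> t k \<le> t k"
    using offset_less[of k] offset_0 t_0 by (cases "k = 0") auto
  also have "t k \<le> offset \<theta> t n"
    using node_less_offset[of k n] \<open>k \<le> n\<close> \<open>n \<le> N\<close> False by simp
  finally show ?thesis .
qed simp

lemma offset_in: "n \<le> N \<Longrightarrow> offset \<theta> t n \<in> {0..T}"
  using offset_mono[of 0 n] offset_0 offset_less[of n] t_le_T[of n] t_0
  by (cases "n = 0") auto

subsection \<open>Bounds on the two coefficient families\<close>

context
  fixes n :: nat
  assumes n: "1 \<le> n" "n \<le> N"
begin

lemma hist_mono: "r \<le> s \<Longrightarrow> s < offset \<theta> t n \<Longrightarrow> hist n r \<le> hist n s"
  by (intro omega_antimono beta_pos beta_less_1) auto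

lemma hist_pos: "s < offset \<theta> t n \<Longrightarrow> 0 < hist n s"
  by (intro omega_pos beta_pos beta_less_1) auto

lemma hist_continuous: "k < n \<Longrightarrow> continuous_on {t (k - 1)..t k} (hist n)"
  using node_less_offset[of k n] n by (intro continuous_on_history) auto

lemma alik_a_history:
  assumes "1 \<le> k" "k < n"
  shows "alik_a \<beta> \<theta> t n k = 1 / tau t k * integral {t (k - 1)..t k} (hist n)"
  using node_less_offset[of k n] n assms by (simp add: alik_a_def min_def)

text \<open>The singular integral over the last, shortened interval is explicit. With \<open>\<beta> = 2 \<theta>\<close> its value is
  exactly what makes the diagonal dominate in \<open>alik_A_gap\<close>.\<close>

lemma alik_a_last:
  "(1 - \<beta>) * alik_a \<beta> \<theta> t n n = (1 - \<theta>) * hist n (t (n - 1))"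
proof -
  have "integral {t (n - 1)..offset \<theta> t n} (hist n)
      = (1 - \<theta>) * tau t n / (1 - \<beta>) * hist n (t (n - 1))"
    using has_integral_history_to_singularity[OF beta_pos beta_less_1 offset_greater[OF n]]
      offset_diff[of n] by (simp add: integral_unique)
  moreover have "min (t n) (offset \<theta> t n) = offset \<theta> t n"
    using offset_less[OF n] by simp
  ultimately show ?thesis
    using tau_pos[OF n] beta_less_1 by (simp add: alik_a_def)
qed

lemma alik_a_last_ge: "(1 - \<theta>) * hist n (t (n - 1)) \<le> alik_a \<beta> \<theta> t n n"
proof -
  have "0 \<le> (1 - \<theta>) * hist n (t (n - 1))"
    using hist_pos[OF offset_greater[OF n]] theta_less_half
    by (intro mult_nonneg_nonneg) auto
  then have "0 \<le> (1 - \<beta>) * alik_a \<beta> \<theta> t n n"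
    using alik_a_last by simp
  then have "0 \<le> alik_a \<beta> \<theta> t n n"
    using beta_less_1 by (simp add: zero_le_mult_iff)
  then have "(1 - \<beta>) * alik_a \<beta> \<theta> t n n \<le> 1 * alik_a \<beta> \<theta> t n n"
    using beta_pos by (intro mult_right_mono) auto
  then show ?thesis using alik_a_last by simp
qed

lemma alik_a_ge:
  assumes "1 \<le> k" "k < n"
  shows "hist n (t (k - 1)) \<le> alik_a \<beta> \<theta> t n k"
proof -
  have "integral {t (k - 1)..t k} (\<lambda>_. hist n (t (k - 1))) \<le> integral {t (k - 1)..t k} (hist n)"
    using hist_mono node_less_offset[of k n] n hist_continuous assms
    by (intro integral_le integrable_continuous_real continuous_intros) auto
  then show ?thesis
    using tau_pos[of k] t_mono[of "k - 1" k] assms n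
    by (simp add: alik_a_history tau_def pos_le_divide_eq mult.commute)
qed

lemma alik_b_nonneg:
  assumes "1 \<le> k" "k < n"
  shows "0 \<le> alik_b \<beta> \<theta> t n k"
proof -
  have "0 \<le> integral {t (k - 1)..t k} (\<lambda>s. hist n s * (s - (t (k - 1) + t k) / 2))"
    using hist_mono node_less_offset[of k n] n assms t_mono[of "k - 1" k]
    by (intro integral_centred_nonneg hist_continuous mono_onI) auto
  then show ?thesis
    using tau_pos[of k] tau_pos[of "Suc k"] assms n by (simp add: alik_b_def)
qed

lemma alik_b_le:
  assumes "1 \<le> k" "k < n" and c: "\<And>s. s \<in> {t (k - 1)..t k} \<Longrightarrow> c \<le> hist n s"
  shows "alik_b \<beta> \<theta> t n k \<le> tau t k / (tau t k + tau t (Suc k)) * (alik_a \<beta> \<theta> t n k - c)"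
proof -
  define \<tau> \<tau>' where "\<tau> = tau t k" and "\<tau>' = tau t (Suc k)"
  have pos: "0 < \<tau>" "0 < \<tau>'"
    using tau_pos[of k] tau_pos[of "Suc k"] assms n by (auto simp: \<tau>_def \<tau>'_def)
  define I where "I = integral {t (k - 1)..t k} (hist n)"
  have "integral {t (k - 1)..t k} (\<lambda>s. hist n s * (s - (t (k - 1) + t k) / 2)) \<le> \<tau> / 2 * (I - \<tau> * c)"
    using integral_centred_le_average[OF t_mono[of "k - 1" k] hist_continuous c] assms n
    by (simp add: \<tau>_def tau_def I_def)
  then have "alik_b \<beta> \<theta> t n k \<le> 2 / (\<tau> * (\<tau> + \<tau>')) * (\<tau> / 2 * (I - \<tau> * c))"
    using pos unfolding alik_b_def \<tau>_def \<tau>'_def Suc_eq_plus1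
    by (intro mult_left_mono) auto
  also have "\<dots> = \<tau> / (\<tau> + \<tau>') * (1 / \<tau> * I - c)"
  proof -
    have "2 / (\<tau> * \<sigma>) * (\<tau> / 2 * (I - \<tau> * c)) = \<tau> / \<sigma> * (1 / \<tau> * I - c)" if "0 < \<sigma>" for \<sigma>
      using that pos by (simp add: field_simps)
    from this[of "\<tau> + \<tau>'"] show ?thesis using pos by linarith
  qed
  finally show ?thesis
    using assms by (simp add: alik_a_history \<tau>_def \<tau>'_def I_def)
qed

lemma alik_b_le_increment:
  assumes "1 \<le> k" "k < n"
  shows "alik_b \<beta> \<theta> t n k \<le> alik_a \<beta> \<theta> t n k - hist n (t (k - 1))"
proof -
  have "alik_b \<beta> \<theta> t n k
      \<le> tau t k / (tau t k + tau t (Suc k)) * (alik_a \<beta> \<theta> t n k - hist n (t (k - 1)))"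
    using hist_mono node_less_offset[of k n] n assms by (intro alik_b_le) auto
  also have "\<dots> \<le> 1 * (alik_a \<beta> \<theta> t n k - hist n (t (k - 1)))"
    using tau_pos[of k] tau_pos[of "Suc k"] assms n alik_a_ge[of k]
    by (intro mult_right_mono) auto
  finally show ?thesis by simp
qed

lemma alik_b_le_fraction:
  assumes "1 \<le> k" "k < n"
  shows "alik_b \<beta> \<theta> t n k \<le> 7 / 11 * alik_a \<beta> \<theta> t n k"
proof -
  have g0: "0 < hist n (t (k - 1))"
    using hist_pos node_less_offset[of "k - 1" n] n assms by auto
  have "alik_b \<beta> \<theta> t n k \<le> tau t k / (tau t k + tau t (Suc k)) * (alik_a \<beta> \<theta> t n k - 0)"
    using hist_pos node_less_offset[of k n] n assms by (intro alik_b_le) (auto intro!: less_imp_le)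
  also have "\<dots> \<le> 7 / 11 * (alik_a \<beta> \<theta> t n k - 0)"
    using tau_pos[of k] tau_pos[of "Suc k"] tau_ratio[of k] assms n alik_a_ge[of k] g0
    by (intro mult_right_mono) (auto simp: divide_simps)
  finally show ?thesis by simp
qed

text \<open>Convexity of the history kernel controls the contribution of the previous interval: with m the
  slope of the history kernel at the common node, the left side is at most \<open>m \<tau>\<^sup>3 / (6 \<tau>' (\<tau> + \<tau>'))\<close>
  and the right side at least \<open>m \<tau>' / 2\<close>, where \<open>\<tau>\<close> and \<open>\<tau>'\<close> are the two consecutive steps.\<close>

lemma rho_alik_b_le:
  assumes "1 \<le> j" "Suc j < n"
  shows "rho t j * alik_b \<beta> \<theta> t n j \<le> hist n (t (Suc j)) - alik_a \<beta> \<theta> t n (Suc j)"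
proof -
  define \<tau> \<tau>' m where "\<tau> = tau t j" and "\<tau>' = tau t (Suc j)"
    and "m = history_slope \<beta> (offset \<theta> t n) (t j)"
  have pos: "0 < \<tau>" "0 < \<tau>'"
    using tau_pos[of j] tau_pos[of "Suc j"] assms n by (auto simp: \<tau>_def \<tau>'_def)
  have m: "0 < m"
    using node_less_offset[of j n] assms n beta_pos beta_less_1
    by (simp add: m_def history_slope_pos)
  have "integral {t (j - 1)..t j} (\<lambda>s. hist n s * (s - (t (j - 1) + t j) / 2)) \<le> m * (\<tau> ^ 3 / 12)"
    unfolding \<tau>_def tau_def m_def
    using t_mono[of "j - 1" j] node_less_offset[of j n] assms n beta_pos beta_less_1
    by (intro integral_centred_le_slope hist_continuous history_quotient_le) auto
  then have "alik_b \<beta> \<theta> t n j \<le> 2 / (\<tau> * (\<tau> + \<tau>')) * (m * (\<tau> ^ 3 / 12))"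
    using pos unfolding alik_b_def \<tau>_def \<tau>'_def Suc_eq_plus1
    by (intro mult_left_mono) auto
  then have "rho t j * alik_b \<beta> \<theta> t n j \<le> \<tau> / \<tau>' * (2 / (\<tau> * (\<tau> + \<tau>')) * (m * (\<tau> ^ 3 / 12)))"
    using pos unfolding rho_def \<tau>_def \<tau>'_def by (intro mult_mono alik_b_nonneg) (use assms in auto)
  also have "\<dots> = m * (\<tau> ^ 3 / (6 * \<tau>' * (\<tau> + \<tau>')))"
  proof -
    have "\<tau> / \<tau>' * (2 / (\<tau> * \<sigma>) * (m * (\<tau> ^ 3 / 12))) = m * (\<tau> ^ 3 / (6 * \<tau>' * \<sigma>))" if "0 < \<sigma>" for \<sigma>
      using that pos by (simp add: field_simps)
    from this[of "\<tau> + \<tau>'"] show ?thesis using pos by linarith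
  qed
  also have "\<dots> \<le> m * (\<tau>' / 2)"
  proof -
    have le: "\<tau> \<le> 7 / 4 * \<tau>'"
      using tau_ratio[of j] assms n by (simp add: \<tau>_def \<tau>'_def)
    have "\<tau> ^ 3 = \<tau>\<^sup>2 * \<tau>" by (simp add: power3_eq_cube power2_eq_square)
    also have "\<dots> \<le> (7 / 4 * \<tau>')\<^sup>2 * \<tau>"
      using le pos by (intro mult_right_mono power_mono) auto
    also have "\<dots> = 3 * \<tau>'\<^sup>2 * \<tau> + \<tau>'\<^sup>2 * (\<tau> / 16)"
      by (simp add: power2_eq_square)
    also have "\<dots> \<le> 3 * \<tau>'\<^sup>2 * \<tau> + \<tau>'\<^sup>2 * (3 * \<tau>')"
      using le pos by (intro add_left_mono mult_left_mono) auto
    also have "\<dots> = \<tau>' / 2 * (6 * \<tau>' * (\<tau> + \<tau>'))"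
      by (simp add: power2_eq_square algebra_simps)
    finally have "\<tau> ^ 3 / (6 * \<tau>' * (\<tau> + \<tau>')) \<le> \<tau>' / 2"
      using pos by (subst pos_divide_le_eq) auto
    then show ?thesis using m by (intro mult_left_mono) auto
  qed
  also have "m * (\<tau>' / 2) \<le> hist n (t (Suc j)) - alik_a \<beta> \<theta> t n (Suc j)"
  proof -
    have d: "t (Suc j) - t j = \<tau>'" by (simp add: \<tau>'_def tau_def)
    have "integral {t j..t (Suc j)} (hist n) \<le> (t (Suc j) - t j) * hist n (t (Suc j)) - m * ((t (Suc j) - t j)\<^sup>2 / 2)"
    proof (rule integral_le_slope)
      show "m * (t (Suc j) - s) \<le> hist n (t (Suc j)) - hist n s" if "t j \<le> s" "s \<le> t (Suc j)" for s
        unfolding m_def using node_less_offset[of "Suc j" n] assms n that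
        by (intro history_quotient_ge beta_pos beta_less_1) auto
    qed (use t_mono[of j "Suc j"] hist_continuous[of "Suc j"] assms n in auto)
    then have "integral {t j..t (Suc j)} (hist n) \<le> \<tau>' * (hist n (t (Suc j)) - m * (\<tau>' / 2))"
      unfolding d by (simp add: power2_eq_square right_diff_distrib mult.left_commute)
    then have "1 / \<tau>' * integral {t j..t (Suc j)} (hist n) \<le> hist n (t (Suc j)) - m * (\<tau>' / 2)"
      using pos by (simp add: pos_divide_le_eq mult.commute)
    then show ?thesis
      using alik_a_history[of "Suc j"] assms by (simp add: \<tau>'_def)
  qed
  finally show ?thesis .
qed

subsection \<open>Positivity, monotonicity and the gap at the diagonal\<close>

lemma alik_A_eq:
  assumes "1 \<le> k" "k \<le> n"
  shows "alik_A \<beta> \<theta> t n k = alik_a \<beta> \<theta> t n k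
    + (if 1 < k then rho t (k - 1) * alik_b \<beta> \<theta> t n (k - 1) else 0)
    - (if k < n then alik_b \<beta> \<theta> t n k else 0)"
  using assms by (auto simp: alik_A_def)

lemma alik_A_ge:
  assumes "1 \<le> k" "k \<le> n"
  shows "4 / 11 * omega (1 - \<beta>) (t n - t (k - 1)) \<le> alik_A \<beta> \<theta> t n k"
proof -
  have less: "t (k - 1) < offset \<theta> t n"
    using node_less_offset[of "k - 1" n] assms n by auto
  have "4 / 11 * omega (1 - \<beta>) (t n - t (k - 1)) \<le> 4 / 11 * hist n (t (k - 1))"
    using less offset_less[OF n] beta_pos beta_less_1
    by (intro mult_left_mono omega_antimono) auto
  also have "\<dots> \<le> alik_a \<beta> \<theta> t n k - (if k < n then alik_b \<beta> \<theta> t n k else 0)"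
  proof (cases "k < n")
    case True
    then show ?thesis using alik_a_ge[of k] alik_b_le_fraction[of k] assms by simp
  next
    case False
    have "4 / 11 * hist n (t (k - 1)) \<le> (1 - \<theta>) * hist n (t (k - 1))"
      using theta_less_half less_imp_le[OF hist_pos[OF less]] by (intro mult_right_mono) auto
    then show ?thesis using False alik_a_last_ge assms by simp
  qed
  also have "\<dots> \<le> alik_A \<beta> \<theta> t n k"
    using alik_A_eq[OF assms] rho_nonneg[of "k - 1"] alik_b_nonneg[of "k - 1"] assms n by auto
  finally show ?thesis .
qed

lemma alik_A_pos: "1 \<le> k \<Longrightarrow> k \<le> n \<Longrightarrow> 0 < alik_A \<beta> \<theta> t n k"
proof -
  assume k: "1 \<le> k" "k \<le> n"
  then have "k - 1 < n" by simp
  then have "t (k - 1) < t n"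
    using node_less_offset[of "k - 1" n] offset_less[OF n] n by linarith
  then have "0 < omega (1 - \<beta>) (t n - t (k - 1))"
    using beta_pos beta_less_1 by (intro omega_pos) auto
  then show ?thesis using alik_A_ge[OF k] by linarith
qed

text \<open>The average over the interval that ends at \<open>t\<^sub>k\<close>, together with the correction from the interval
  before it, does not exceed the value of the history kernel at \<open>t\<^sub>k\<close>.\<close>

lemma alik_A_le_node:
  assumes "1 \<le> k" "k < n"
  shows "alik_A \<beta> \<theta> t n k \<le> hist n (t k) - alik_b \<beta> \<theta> t n k"
proof (cases "k = 1")
  case True
  have "integral {t (k - 1)..t k} (hist n) \<le> integral {t (k - 1)..t k} (\<lambda>_. hist n (t k))"
    using hist_mono node_less_offset[of k n] n hist_continuous assms
    by (intro integral_le integrable_continuous_real continuous_intros) auto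
  then have "alik_a \<beta> \<theta> t n k \<le> hist n (t k)"
    using tau_pos[of k] t_mono[of "k - 1" k] assms n
    by (simp add: alik_a_history tau_def pos_divide_le_eq mult.commute)
  then show ?thesis using True assms alik_A_eq[of k] by simp
next
  case False
  then obtain j where "k = Suc j" "1 \<le> j" using assms by (cases k) auto
  then show ?thesis using rho_alik_b_le[of j] assms alik_A_eq[of k] by simp
qed

lemma alik_A_gap:
  assumes "2 \<le> n"
  shows "(1 - \<theta>) * alik_A \<beta> \<theta> t n (n - 1) \<le> (1 - 2 * \<theta>) * alik_A \<beta> \<theta> t n n"
proof -
  have b: "0 \<le> alik_b \<beta> \<theta> t n (n - 1)" and r: "0 \<le> rho t (n - 1)"
    using alik_b_nonneg[of "n - 1"] rho_nonneg[of "n - 1"] assms n by auto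
  have "1 \<le> n - 1" "n - 1 < n" using assms by auto
  then have "alik_A \<beta> \<theta> t n (n - 1) \<le> hist n (t (n - 1))"
    using alik_A_le_node[of "n - 1"] b by linarith
  then have "(1 - \<theta>) * alik_A \<beta> \<theta> t n (n - 1) \<le> (1 - \<theta>) * hist n (t (n - 1))"
    using theta_less_half by (intro mult_left_mono) auto
  also have "\<dots> = (1 - 2 * \<theta>) * alik_a \<beta> \<theta> t n n"
    using alik_a_last theta_eq by simp
  also have "\<dots> \<le> (1 - 2 * \<theta>) * alik_A \<beta> \<theta> t n n"
    using alik_A_eq[of n] assms b r theta_less_half by (intro mult_left_mono) auto
  finally show ?thesis .
qed

lemma alik_A_mono:
  assumes "1 \<le> k" "k < n"
  shows "alik_A \<beta> \<theta> t n k \<le> alik_A \<beta> \<theta> t n (Suc k)"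
proof (cases "Suc k = n")
  case True
  have "(1 - \<theta>) * alik_A \<beta> \<theta> t n k \<le> (1 - 2 * \<theta>) * alik_A \<beta> \<theta> t n n"
    using alik_A_gap True assms by auto
  also have "\<dots> \<le> (1 - \<theta>) * alik_A \<beta> \<theta> t n n"
    using alik_A_pos[of n] n theta_pos by (intro mult_right_mono) auto
  finally show ?thesis using True theta_less_half by simp
next
  case False
  have "0 \<le> rho t k * alik_b \<beta> \<theta> t n k" and "0 \<le> alik_b \<beta> \<theta> t n k"
    using alik_b_nonneg[of k] rho_nonneg[of k] assms n by auto
  moreover have "alik_b \<beta> \<theta> t n (Suc k) \<le> alik_a \<beta> \<theta> t n (Suc k) - hist n (t k)"
    using alik_b_le_increment[of "Suc k"] assms False by simp
  ultimately show ?thesis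
    using alik_A_le_node[OF assms] alik_A_eq[of "Suc k"] assms False by simp
qed

end

end

section \<open>The quadratic form of the discrete fractional derivative\<close>

text \<open>Increments of a kernel, where the kernel is extended by 0 at index 0. They are the coefficients of
  \<open>v\<^sub>n - v\<^sub>k\<close> after summation by parts.\<close>

definition kernel_step :: "(nat \<Rightarrow> real) \<Rightarrow> nat \<Rightarrow> real" where
  "kernel_step A k = A (Suc k) - (if k = 0 then 0 else A k)"

lemma sum_kernel_step: "(\<Sum>k<Suc m. kernel_step A k) = A (Suc m)"
  by (induction m) (simp_all add: kernel_step_def)

lemma sum_by_parts_kernel:
  fixes A v :: "nat \<Rightarrow> real"
  shows "(\<Sum>k=1..n. A k * (v k - v (k - 1))) = (\<Sum>k<n. kernel_step A k * (v n - v k))"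
proof (induction n)
  case (Suc n)
  have "(\<Sum>k<Suc n. kernel_step A k * (v (Suc n) - v k))
      = (\<Sum>k<Suc n. kernel_step A k * (v n - v k)) + (\<Sum>k<Suc n. kernel_step A k * (v (Suc n) - v n))"
    by (simp only: sum.distrib[symmetric]) (auto intro!: sum.cong simp: algebra_simps)
  also have "(\<Sum>k<Suc n. kernel_step A k * (v (Suc n) - v n)) = A (Suc n) * (v (Suc n) - v n)"
    by (simp only: sum_distrib_right[symmetric] sum_kernel_step)
  finally show ?case using Suc by simp
qed simp

text \<open>After summation by parts the difference of the two sides is
  \<open>\<Sum> c\<^sub>k (x\<^sub>k\<^sup>2 - 2 \<theta> y x\<^sub>k)\<close> with \<open>x\<^sub>k = v\<^sub>n - v\<^sub>k\<close> and \<open>y = x\<^sub>n\<^sub>-\<^sub>1\<close>. Completing the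
  square costs \<open>c\<^sub>k \<theta>\<^sup>2 y\<^sup>2\<close> for every older k; by the gap condition the newest term covers
  the sum of these.\<close>

lemma quadratic_form_lower_bound:
  fixes A v :: "nat \<Rightarrow> real"
  assumes theta: "0 \<le> \<theta>" "\<theta> \<le> 1 / 2" and n: "1 \<le> n"
    and pos: "\<And>k. k < n \<Longrightarrow> 0 \<le> kernel_step A k"
    and gap: "2 \<le> n \<Longrightarrow> (1 - \<theta>) * A (n - 1) \<le> (1 - 2 * \<theta>) * A n"
  shows "(\<Sum>k<n. kernel_step A k * ((v n)\<^sup>2 - (v k)\<^sup>2))
    \<le> 2 * offset \<theta> v n * (\<Sum>k=1..n. A k * (v k - v (k - 1)))"
proof -
  obtain m where m: "n = Suc m" using n by (cases n) auto
  define y where "y = v n - v m"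
  define x where "x k = v n - v k" for k
  let ?c = "kernel_step A"
  have "2 * offset \<theta> v n * (\<Sum>k=1..n. A k * (v k - v (k - 1)))
      - (\<Sum>k<n. ?c k * ((v n)\<^sup>2 - (v k)\<^sup>2))
      = (\<Sum>k<n. ?c k * ((x k)\<^sup>2 - 2 * \<theta> * y * x k))"
    unfolding sum_by_parts_kernel sum_distrib_left sum_subtractf[symmetric] x_def y_def offset_def m
    by (intro sum.cong) (auto simp: power2_eq_square algebra_simps)
  also have "\<dots> \<ge> 0"
  proof -
    have "(\<Sum>k<m. ?c k * (- (\<theta> * y)\<^sup>2)) \<le> (\<Sum>k<m. ?c k * ((x k)\<^sup>2 - 2 * \<theta> * y * x k))"
    proof (intro sum_mono mult_left_mono)
      fix k
      have "0 \<le> (x k - \<theta> * y)\<^sup>2" by simp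
      also have "\<dots> = (x k)\<^sup>2 - 2 * \<theta> * y * x k + (\<theta> * y)\<^sup>2"
        by (simp add: power2_diff algebra_simps)
      finally show "- (\<theta> * y)\<^sup>2 \<le> (x k)\<^sup>2 - 2 * \<theta> * y * x k" by simp
    qed (use pos m in auto)
    moreover have "0 \<le> (\<Sum>k<m. ?c k * (- (\<theta> * y)\<^sup>2)) + ?c m * ((1 - 2 * \<theta>) * y\<^sup>2)"
    proof (cases m)
      case 0
      then show ?thesis using pos[of 0] m theta by simp
    next
      case (Suc l)
      have sum_eq: "(\<Sum>k<m. ?c k) = A m" using sum_kernel_step[of A l] Suc by simp
      have "0 \<le> (\<Sum>k<m. ?c k)" using pos m by (intro sum_nonneg) auto
      then have "\<theta>\<^sup>2 * A m \<le> \<theta> * A m"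
        using theta sum_eq by (intro mult_right_mono) (auto simp: power2_eq_square mult_left_le_one_le)
      also have "\<dots> \<le> (1 - 2 * \<theta>) * ?c m"
        using gap m Suc by (simp add: kernel_step_def algebra_simps)
      finally have "\<theta>\<^sup>2 * A m * y\<^sup>2 \<le> (1 - 2 * \<theta>) * ?c m * y\<^sup>2"
        by (intro mult_right_mono) auto
      then show ?thesis
        unfolding sum_distrib_right[symmetric] sum_eq by (simp add: power_mult_distrib algebra_simps)
    qed
    moreover have "x m = y" by (simp add: x_def y_def)
    ultimately show ?thesis by (simp add: m power2_eq_square algebra_simps)
  qed
  finally show ?thesis by simp
qed

lemma alik_D_sum: "alik_D \<beta> \<theta> t (\<lambda>k. \<Sum>i\<in>I. f i k) n = (\<Sum>i\<in>I. alik_D \<beta> \<theta> t (f i) n)"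
  unfolding alik_D_def sum_subtractf[symmetric] sum_distrib_left by (rule sum.swap)

lemma alik_D_add:
  "alik_D \<beta> \<theta> t (\<lambda>k. f k + g k) n = alik_D \<beta> \<theta> t f n + alik_D \<beta> \<theta> t g n"
  unfolding alik_D_def sum.distrib[symmetric] by (intro sum.cong) (auto simp: algebra_simps)

lemma alik_D_diff:
  "alik_D \<beta> \<theta> t (\<lambda>k. f k - g k) n = alik_D \<beta> \<theta> t f n - alik_D \<beta> \<theta> t g n"
  unfolding alik_D_def sum_subtractf[symmetric] by (intro sum.cong) (auto simp: algebra_simps)

lemma alik_D_cmult: "alik_D \<beta> \<theta> t (\<lambda>k. c * f k) n = c * alik_D \<beta> \<theta> t f n"
  unfolding alik_D_def sum_distrib_left by (intro sum.cong) (auto simp: algebra_simps)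

context alikhanov_mesh
begin

text \<open>A weight that decreases in time only helps: the history terms carry the nonnegative factors
  \<open>kernel_step\<close> and a negative sign.\<close>

lemma alik_D_weighted_square_le:
  assumes n: "1 \<le> n" "n \<le> N" and "0 \<le> p n" and p: "\<And>k. k < n \<Longrightarrow> p n \<le> p k"
  shows "alik_D \<beta> \<theta> t (\<lambda>k. p k * (v k)\<^sup>2) n \<le> 2 * (p n * (offset \<theta> v n * alik_D \<beta> \<theta> t v n))"
proof -
  let ?c = "kernel_step (alik_A \<beta> \<theta> t n)"
  have c: "0 \<le> ?c k" if "k < n" for k
    using alik_A_mono[OF n, of k] alik_A_pos[OF n, of 1] that n
    by (cases "k = 0") (auto simp: kernel_step_def)
  have "alik_D \<beta> \<theta> t (\<lambda>k. p k * (v k)\<^sup>2) n = (\<Sum>k<n. ?c k * (p n * (v n)\<^sup>2 - p k * (v k)\<^sup>2))"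
    unfolding alik_D_def by (rule sum_by_parts_kernel)
  also have "\<dots> \<le> (\<Sum>k<n. ?c k * (p n * (v n)\<^sup>2 - p n * (v k)\<^sup>2))"
    using c p by (intro sum_mono mult_left_mono diff_mono mult_right_mono) auto
  also have "\<dots> = p n * (\<Sum>k<n. ?c k * ((v n)\<^sup>2 - (v k)\<^sup>2))"
    unfolding sum_distrib_left by (intro sum.cong) (auto simp: algebra_simps)
  also have "\<dots> \<le> p n * (2 * offset \<theta> v n * alik_D \<beta> \<theta> t v n)"
    unfolding alik_D_def using alik_A_gap[OF n] c n assms(3) theta_pos theta_less_half
    by (intro mult_left_mono quadratic_form_lower_bound) auto
  finally show ?thesis by (simp add: algebra_simps)
qed

end

section \<open>Complementary kernels and a discrete Gronwall inequality\<close>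

text \<open>A time mesh together with its complementary kernels.\<close>

locale alikhanov_mesh_complementary = alikhanov_mesh +
  fixes P :: "nat \<Rightarrow> nat \<Rightarrow> real"
  assumes complementary: "complementary_kernels \<beta> \<theta> N t P"
begin

lemma complementary_eq:
  "1 \<le> k \<Longrightarrow> k \<le> n \<Longrightarrow> n \<le> N \<Longrightarrow> (\<Sum>j=k..n. P n j * alik_A \<beta> \<theta> t j k) = 1"
  using complementary unfolding complementary_kernels_def by auto

text \<open>Subtracting the defining equations for k and k + 1 expresses \<open>P\<^bsub>n,k\<^esub>\<close> through the later values with
  the nonnegative increments of A as coefficients.\<close>

lemma complementary_nonneg:
  assumes "1 \<le> k" "k \<le> n" "n \<le> N"
  shows "0 \<le> P n k"
  using assms(2,1)
proof (induction k rule: measure_induct_rule[of "\<lambda>k. n - k"])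
  case (less k)
  have diag: "0 < alik_A \<beta> \<theta> t k k" using alik_A_pos[of k k] less.prems assms(3) by simp
  have eq: "P n k * alik_A \<beta> \<theta> t k k + (\<Sum>j=Suc k..n. P n j * alik_A \<beta> \<theta> t j k) = 1"
    using complementary_eq[of k n] less.prems assms(3) by (simp add: sum.atLeast_Suc_atMost)
  have "0 \<le> P n k * alik_A \<beta> \<theta> t k k"
  proof (cases "k = n")
    case True
    then show ?thesis using eq by simp
  next
    case False
    have "(\<Sum>j=Suc k..n. P n j * alik_A \<beta> \<theta> t j k) \<le> (\<Sum>j=Suc k..n. P n j * alik_A \<beta> \<theta> t j (Suc k))"
      using less.prems less.IH assms(3) by (intro sum_mono mult_left_mono alik_A_mono) auto
    also have "\<dots> = 1"
      using complementary_eq[of "Suc k" n] less.prems False assms(3) by simp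
    finally show ?thesis using eq by simp
  qed
  then show ?case using diag by (simp add: zero_le_mult_iff)
qed

lemma complementary_alik_D:
  assumes "m \<le> N"
  shows "(\<Sum>n=1..m. P m n * alik_D \<beta> \<theta> t f n) = f m - f 0"
proof -
  have "(\<Sum>n=1..m. P m n * alik_D \<beta> \<theta> t f n)
      = (\<Sum>n=1..m. \<Sum>k=1..n. P m n * alik_A \<beta> \<theta> t n k * (f k - f (k - 1)))"
    unfolding alik_D_def sum_distrib_left by (simp add: mult.assoc)
  also have "\<dots> = (\<Sum>n\<in>{1..m}. \<Sum>k\<in>{k\<in>{1..m}. k \<le> n}. P m n * alik_A \<beta> \<theta> t n k * (f k - f (k - 1)))"
    by (intro sum.cong) auto
  also have "\<dots> = (\<Sum>k\<in>{1..m}. \<Sum>n\<in>{n\<in>{1..m}. k \<le> n}. P m n * alik_A \<beta> \<theta> t n k * (f k - f (k - 1)))"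
    by (rule sum.swap_restrict) auto
  also have "\<dots> = (\<Sum>k\<in>{1..m}. (\<Sum>n=k..m. P m n * alik_A \<beta> \<theta> t n k) * (f k - f (k - 1)))"
    unfolding sum_distrib_right by (intro sum.cong) auto
  also have "\<dots> = (\<Sum>k\<in>{1..m}. f k - f (k - 1))"
    using complementary_eq assms by (intro sum.cong) auto
  also have "\<dots> = f m - f 0"
    by (induction m) auto
  finally show ?thesis .
qed

lemma complementary_comparison:
  assumes "m \<le> N" and "\<And>n. 1 \<le> n \<Longrightarrow> n \<le> m \<Longrightarrow> h n \<le> alik_D \<beta> \<theta> t f n"
  shows "(\<Sum>n=1..m. P m n * h n) \<le> f m - f 0"
proof -
  have "(\<Sum>n=1..m. P m n * h n) \<le> (\<Sum>n=1..m. P m n * alik_D \<beta> \<theta> t f n)"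
    using assms complementary_nonneg by (intro sum_mono mult_left_mono) auto
  then show ?thesis using complementary_alik_D[OF assms(1)] by simp
qed

text \<open>The comparison function is the unit jump at \<open>t\<^sub>0\<close>, whose discrete derivative is the oldest
  kernel value and hence at least a multiple of \<open>t\<^sub>n\<^sup>-\<^sup>\<beta>\<close>.\<close>

lemma sum_complementary_powr_le:
  assumes "m \<le> N"
  shows "(\<Sum>n=1..m. P m n * t n powr - \<beta>) \<le> 11 / 4 * Gamma (1 - \<beta>)"
proof -
  define c where "c = 4 / (11 * Gamma (1 - \<beta>))"
  have Gamma_pos: "0 < Gamma (1 - \<beta>)" using beta_less_1 by (simp add: Gamma_real_pos)
  then have c: "0 < c" by (simp add: c_def)
  define f :: "nat \<Rightarrow> real" where "f k = (if k = 0 then 0 else 1)" for k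
  have "(\<Sum>n=1..m. P m n * (c * t n powr - \<beta>)) \<le> f m - f 0"
  proof (rule complementary_comparison[OF assms])
    fix n assume n: "1 \<le> n" "n \<le> m"
    have "alik_D \<beta> \<theta> t f n = (\<Sum>k=1..n. if k = 1 then alik_A \<beta> \<theta> t n k else 0)"
      unfolding alik_D_def f_def by (intro sum.cong) auto
    also have "\<dots> = alik_A \<beta> \<theta> t n 1" using n by simp
    also have "\<dots> \<ge> 4 / 11 * omega (1 - \<beta>) (t n - t (1 - 1))"
      using n assms by (intro alik_A_ge) auto
    finally show "c * t n powr - \<beta> \<le> alik_D \<beta> \<theta> t f n"
      by (simp add: omega_def t_0 c_def)
  qed
  also have "\<dots> \<le> 1" by (simp add: f_def)
  finally have "c * (\<Sum>n=1..m. P m n * t n powr - \<beta>) \<le> 1"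
    by (simp add: sum_distrib_left algebra_simps)
  then have "(\<Sum>n=1..m. P m n * t n powr - \<beta>) \<le> 1 / c"
    using c by (simp add: pos_le_divide_eq mult.commute)
  then show ?thesis by (simp add: c_def)
qed

lemma sum_complementary_le_Max:
  assumes "1 \<le> k" "k \<le> n" "n \<le> N" and S: "\<And>j. 0 \<le> S j"
  shows "(\<Sum>j=1..k. P k j * S j)
    \<le> 11 / 4 * Gamma (1 - \<beta>) * (MAX j\<in>{1..n}. t j powr \<beta> * S j)"
proof -
  let ?M = "MAX j\<in>{1..n}. t j powr \<beta> * S j"
  have le: "t j powr \<beta> * S j \<le> ?M" if "1 \<le> j" "j \<le> n" for j
    using that by (intro Max_ge) auto
  have "0 \<le> ?M" using le[of k] assms(1,2) S[of k] by (meson mult_nonneg_nonneg order_trans powr_ge_zero)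
  have "(\<Sum>j=1..k. P k j * S j) = (\<Sum>j=1..k. P k j * (t j powr - \<beta> * (t j powr \<beta> * S j)))"
  proof (intro sum.cong arg_cong2[of _ _ _ _ "(*)"] refl)
    fix j assume "j \<in> {1..k}"
    then have "0 < t j" using t_pos[of j] assms by auto
    then have "t j powr - \<beta> * t j powr \<beta> = 1" by (simp add: powr_minus)
    then show "S j = t j powr - \<beta> * (t j powr \<beta> * S j)" by (simp flip: mult.assoc)
  qed
  also have "\<dots> \<le> (\<Sum>j=1..k. P k j * (t j powr - \<beta> * ?M))"
    using assms le complementary_nonneg by (intro sum_mono mult_left_mono) auto
  also have "\<dots> = (\<Sum>j=1..k. P k j * t j powr - \<beta>) * ?M"
    by (simp add: sum_distrib_right mult.assoc)
  also have "\<dots> \<le> 11 / 4 * Gamma (1 - \<beta>) * ?M"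
    using sum_complementary_powr_le[of k] assms \<open>0 \<le> ?M\<close> by (intro mult_right_mono) auto
  finally show ?thesis .
qed

text \<open>An exponential that jumps from 0 at \<open>t\<^sub>0\<close> is a supersolution with arbitrarily large rate: only
  the history within \<open>2 \<delta>\<close> of \<open>t\<^sub>n\<close> is used, where the kernel is at least \<open>\<omega>\<^bsub>1-\<beta>\<^esub>(2 \<delta>)\<close> and
  across which the exponential at least doubles. The jump supplies the growth when \<open>t\<^sub>n < \<delta>\<close>.\<close>

definition barrier :: "real \<Rightarrow> nat \<Rightarrow> real" where
  "barrier \<delta> k = (if k = 0 then 0 else exp (t k / \<delta>))"

lemma barrier_supersolution:
  assumes "0 < \<delta>" and steps: "\<And>k. 1 \<le> k \<Longrightarrow> k \<le> N \<Longrightarrow> tau t k \<le> \<delta>"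
    and n: "1 \<le> n" "n \<le> N"
  shows "2 / 11 * omega (1 - \<beta>) (2 * \<delta>) * barrier \<delta> n \<le> alik_D \<beta> \<theta> t (barrier \<delta>) n"
proof -
  define \<kappa> where "\<kappa> = 4 / 11 * omega (1 - \<beta>) (2 * \<delta>)"
  have kappa: "0 \<le> \<kappa>"
    using omega_pos[OF beta_pos beta_less_1, of "2 * \<delta>"] assms(1) by (simp add: \<kappa>_def)
  \<comment> \<open>Flattening the barrier before \<open>t\<^sub>n - \<delta>\<close> removes the increments where the kernel may be small.\<close>
  define cut where "cut k = max (barrier \<delta> k) (exp ((t n - \<delta>) / \<delta>))" for k
  have mono: "barrier \<delta> (k - 1) \<le> barrier \<delta> k" if "1 \<le> k" "k \<le> n" for k
    using t_mono[of "k - 1" k] that n assms(1) by (auto simp: barrier_def divide_right_mono)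
  have "(\<Sum>k=1..n. \<kappa> * (cut k - cut (k - 1))) \<le> alik_D \<beta> \<theta> t (barrier \<delta>) n"
    unfolding alik_D_def
  proof (rule sum_mono)
    fix k assume "k \<in> {1..n}"
    then have k: "1 \<le> k" "k \<le> n" by auto
    show "\<kappa> * (cut k - cut (k - 1)) \<le> alik_A \<beta> \<theta> t n k * (barrier \<delta> k - barrier \<delta> (k - 1))"
    proof (cases "t n - 2 * \<delta> \<le> t (k - 1)")
      case True
      have "k - 1 < n" using k by simp
      then have "t (k - 1) < t n"
        using node_less_offset[of "k - 1" n] offset_less[OF n] n by linarith
      then have "\<kappa> \<le> 4 / 11 * omega (1 - \<beta>) (t n - t (k - 1))"
        unfolding \<kappa>_def using True beta_pos beta_less_1 by (intro mult_left_mono omega_antimono) auto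
      also have "\<dots> \<le> alik_A \<beta> \<theta> t n k" using alik_A_ge[OF n k] .
      finally have le: "\<kappa> \<le> alik_A \<beta> \<theta> t n k" .
      have "cut k - cut (k - 1) \<le> barrier \<delta> k - barrier \<delta> (k - 1)"
        using mono[OF k] by (auto simp: cut_def max_def)
      moreover have "0 \<le> cut k - cut (k - 1)"
        using mono[OF k] by (auto simp: cut_def max_def)
      ultimately show ?thesis
        using le kappa by (intro mult_mono) auto
    next
      case False
      then have "t k < t n - \<delta>" using steps[of k] k n by (simp add: tau_def)
      then have "t k / \<delta> \<le> (t n - \<delta>) / \<delta>" using assms(1) by (intro divide_right_mono) auto
      then have "barrier \<delta> k \<le> exp ((t n - \<delta>) / \<delta>)" using k by (simp add: barrier_def)
      then have "cut k - cut (k - 1) = 0" using mono[OF k] by (auto simp: cut_def max_def)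
      then show ?thesis using mono[OF k] alik_A_pos[OF n k] by simp
    qed
  qed
  moreover have "(\<Sum>k=1..n. \<kappa> * (cut k - cut (k - 1))) = \<kappa> * (cut n - cut 0)"
  proof -
    have "(\<Sum>k=1..n. cut k - cut (k - 1)) = cut n - cut 0" by (induction n) auto
    then show ?thesis by (simp flip: sum_distrib_left)
  qed
  moreover have "\<kappa> * (barrier \<delta> n / 2) \<le> \<kappa> * (cut n - cut 0)"
  proof (intro mult_left_mono kappa)
    have "(t n - \<delta>) / \<delta> = t n / \<delta> + - 1"
      using assms(1) by (simp add: field_simps)
    then have "exp ((t n - \<delta>) / \<delta>) = exp (t n / \<delta>) * exp (- 1)"
      by (simp only: exp_add)
    also have "\<dots> \<le> exp (t n / \<delta>) * (1 / 2)"
      using exp_ge_add_one_self[of 1] by (intro mult_left_mono) (auto simp: exp_minus field_simps)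
    finally have "exp ((t n - \<delta>) / \<delta>) \<le> barrier \<delta> n / 2"
      using n by (simp add: barrier_def)
    moreover have "cut 0 = exp ((t n - \<delta>) / \<delta>)"
      by (simp add: cut_def barrier_def max_def less_imp_le)
    moreover have "barrier \<delta> n \<le> cut n" by (simp add: cut_def)
    ultimately show "barrier \<delta> n / 2 \<le> cut n - cut 0" by linarith
  qed
  moreover have "\<kappa> * (barrier \<delta> n / 2) = 2 / 11 * omega (1 - \<beta>) (2 * \<delta>) * barrier \<delta> n"
    by (simp add: \<kappa>_def)
  ultimately show ?thesis by linarith
qed

text \<open>Proved as a maximum principle: at the index where the energy is largest relative to the exponential,
  the rate condition bounds the feedback by half of the energy itself. The constant 22 ensures that the
  rate of the barrier, 2/11 of the kernel value at \<open>2 \<delta>\<close>, is at least \<open>4 L\<close>. The factor \<open>\<surd>E\<close> of the source is handled by its maximum, which is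
  divided out at the end.\<close>

lemma discrete_gronwall:
  assumes lam: "0 < L" and delta: "0 < \<delta>" and rate: "22 * L \<le> omega (1 - \<beta>) (2 * \<delta>)"
    and steps: "\<And>k. 1 \<le> k \<Longrightarrow> k \<le> N \<Longrightarrow> tau t k \<le> \<delta>"
    and n: "1 \<le> n" "n \<le> N" and E: "\<And>k. k \<le> n \<Longrightarrow> 0 \<le> E k" and xi: "\<And>k. 0 \<le> \<xi> k"
    and le: "\<And>m. 1 \<le> m \<Longrightarrow> m \<le> n \<Longrightarrow> alik_D \<beta> \<theta> t E m
      \<le> L * (E m + E (m - 1)) + \<xi> m * (sqrt (E m) + sqrt (E (m - 1)))"
    and q: "\<And>m. 1 \<le> m \<Longrightarrow> m \<le> n \<Longrightarrow> (\<Sum>j=1..m. P m j * \<xi> j) \<le> q"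
  shows "sqrt (E n) \<le> 2 * exp (T / \<delta>) * (sqrt (E 0) + 2 * q)"
proof -
  define M where "M = Max (E ` {0..n})"
  have M_ge: "E k \<le> M" if "k \<le> n" for k
    unfolding M_def using that by (intro Max_ge) auto
  have "M \<in> E ` {0..n}" unfolding M_def by (intro Max_in) auto
  then obtain k0 where k0: "k0 \<le> n" "M = E k0" by auto
  have M: "0 \<le> M" using k0 E by simp
  have q_nonneg: "0 \<le> q"
  proof -
    have "0 \<le> (\<Sum>j=1..n. P n j * \<xi> j)"
      using complementary_nonneg xi n by (intro sum_nonneg mult_nonneg_nonneg) auto
    then show ?thesis using q[OF n(1) order_refl] by simp
  qed
  define B where "B = E 0 + 2 * sqrt M * q"
  have B: "0 \<le> B" using E[of 0] M q_nonneg by (simp add: B_def)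
  have step: "E m \<le> B + L * (\<Sum>j=1..m. P m j * (E j + E (j - 1)))" if m: "1 \<le> m" "m \<le> n" for m
  proof -
    have "E m - E 0 = (\<Sum>j=1..m. P m j * alik_D \<beta> \<theta> t E j)"
      using complementary_alik_D[of m] m n by simp
    also have "\<dots> \<le> (\<Sum>j=1..m. P m j * (L * (E j + E (j - 1)) + \<xi> j * (2 * sqrt M)))"
    proof (intro sum_mono mult_left_mono)
      fix j assume "j \<in> {1..m}"
      then have j: "1 \<le> j" "j \<le> n" using m by auto
      then have "j - 1 \<le> n" by simp
      then have "sqrt (E j) + sqrt (E (j - 1)) \<le> 2 * sqrt M"
        using real_sqrt_le_mono[OF M_ge[of j]] real_sqrt_le_mono[OF M_ge[of "j - 1"]] j by linarith
      then have "\<xi> j * (sqrt (E j) + sqrt (E (j - 1))) \<le> \<xi> j * (2 * sqrt M)"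
        using xi[of j] by (intro mult_left_mono) auto
      then show "alik_D \<beta> \<theta> t E j \<le> L * (E j + E (j - 1)) + \<xi> j * (2 * sqrt M)"
        using le[OF j] by simp
    qed (use complementary_nonneg m n in auto)
    also have "\<dots> = L * (\<Sum>j=1..m. P m j * (E j + E (j - 1))) + 2 * sqrt M * (\<Sum>j=1..m. P m j * \<xi> j)"
      unfolding sum_distrib_left sum.distrib[symmetric]
      by (intro sum.cong) (auto simp: algebra_simps)
    also have "2 * sqrt M * (\<Sum>j=1..m. P m j * \<xi> j) \<le> 2 * sqrt M * q"
      using q[OF m] M by (intro mult_left_mono) auto
    finally show ?thesis by (simp add: B_def)
  qed
  define R where "R = Max ((\<lambda>k. E k / exp (t k / \<delta>)) ` {0..n})"
  have R_ge: "E k \<le> R * exp (t k / \<delta>)" if "k \<le> n" for k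
  proof -
    have "E k / exp (t k / \<delta>) \<le> R" unfolding R_def using that by (intro Max_ge) auto
    then show ?thesis by (simp add: pos_divide_le_eq)
  qed
  have "R \<in> (\<lambda>k. E k / exp (t k / \<delta>)) ` {0..n}" unfolding R_def by (intro Max_in) auto
  then obtain m where m: "m \<le> n" "R = E m / exp (t m / \<delta>)" by auto
  then have Em: "E m = R * exp (t m / \<delta>)" by simp
  have R: "0 \<le> R" using m E by simp
  have "R \<le> 2 * B"
  proof (cases "m = 0")
    case True
    then have "R = E 0" using Em t_0 by simp
    also have "\<dots> \<le> B" using M q_nonneg by (simp add: B_def)
    finally show ?thesis using B by simp
  next
    case False
    then have m1: "1 \<le> m" by simp
    have "(\<Sum>j=1..m. P m j * (E j + E (j - 1))) \<le> (\<Sum>j=1..m. P m j * (2 * R * barrier \<delta> j))"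
    proof (intro sum_mono mult_left_mono)
      fix j assume "j \<in> {1..m}"
      then have j: "1 \<le> j" "j \<le> n" using m by auto
      have "exp (t (j - 1) / \<delta>) \<le> exp (t j / \<delta>)"
        using t_mono[of "j - 1" j] j n delta by (simp add: divide_right_mono)
      then have "R * exp (t (j - 1) / \<delta>) \<le> R * exp (t j / \<delta>)" using R by (intro mult_left_mono)
      moreover have "E j \<le> R * exp (t j / \<delta>)" and "E (j - 1) \<le> R * exp (t (j - 1) / \<delta>)"
        using j by (auto intro!: R_ge)
      ultimately show "E j + E (j - 1) \<le> 2 * R * barrier \<delta> j"
        using j by (simp add: barrier_def)
    qed (use complementary_nonneg m n in auto)
    also have "\<dots> = 2 * R * (\<Sum>j=1..m. P m j * barrier \<delta> j)"
      unfolding sum_distrib_left by (intro sum.cong) (auto simp: algebra_simps)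
    finally have "L * (\<Sum>j=1..m. P m j * (E j + E (j - 1)))
        \<le> L * (2 * R * (\<Sum>j=1..m. P m j * barrier \<delta> j))"
      using lam by (intro mult_left_mono) auto
    also have "\<dots> = R / 2 * (\<Sum>j=1..m. P m j * (4 * L * barrier \<delta> j))"
      unfolding sum_distrib_left by (intro sum.cong) (auto simp: algebra_simps)
    also have "\<dots> \<le> R / 2 * (barrier \<delta> m - barrier \<delta> 0)"
    proof (intro mult_left_mono complementary_comparison)
      fix j assume j: "1 \<le> j" "j \<le> m"
      have "4 * L * barrier \<delta> j \<le> 2 / 11 * omega (1 - \<beta>) (2 * \<delta>) * barrier \<delta> j"
        using rate by (intro mult_right_mono) (auto simp: barrier_def)
      also have "\<dots> \<le> alik_D \<beta> \<theta> t (barrier \<delta>) j"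
        using barrier_supersolution[OF delta steps] j m n by simp
      finally show "4 * L * barrier \<delta> j \<le> alik_D \<beta> \<theta> t (barrier \<delta>) j" .
    qed (use R m n in auto)
    also have "\<dots> = E m / 2" using m1 Em by (simp add: barrier_def)
    finally have "E m \<le> 2 * B" using step[OF m1 m(1)] by simp
    have "0 \<le> t m / \<delta>" using t_nonneg[of m] m n delta by simp
    then have "R * 1 \<le> R * exp (t m / \<delta>)" using R by (intro mult_left_mono) auto
    with \<open>E m \<le> 2 * B\<close> show ?thesis using Em by linarith
  qed
  have "M \<le> R * exp (t k0 / \<delta>)" using R_ge[OF k0(1)] k0 by simp
  also have "\<dots> \<le> 2 * B * exp (T / \<delta>)"
    using \<open>R \<le> 2 * B\<close> B t_le_T[of k0] k0 n delta
    by (intro mult_mono) (auto simp: divide_right_mono)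
  also have "\<dots> \<le> 2 * (sqrt M * (sqrt (E 0) + 2 * q)) * exp (T / \<delta>)"
  proof -
    have "E 0 = sqrt (E 0) * sqrt (E 0)" using E by simp
    also have "\<dots> \<le> sqrt M * sqrt (E 0)" using M_ge[of 0] E by (intro mult_right_mono) auto
    finally have "B \<le> sqrt M * (sqrt (E 0) + 2 * q)" by (simp add: B_def algebra_simps)
    then show ?thesis by simp
  qed
  finally have main: "sqrt M * sqrt M \<le> sqrt M * (2 * exp (T / \<delta>) * (sqrt (E 0) + 2 * q))"
    using M by (simp add: algebra_simps)
  have "sqrt M \<le> 2 * exp (T / \<delta>) * (sqrt (E 0) + 2 * q)"
  proof (cases "M = 0")
    case False
    then have "0 < sqrt M" using M by simp
    with main show ?thesis by (rule mult_left_le_imp_le)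
  qed (use E q_nonneg in simp)
  moreover have "sqrt (E n) \<le> sqrt M" using M_ge[of n] by simp
  ultimately show ?thesis by linarith
qed

end

section \<open>Monotone weights\<close>

lemma nondecreasing_on_interval:
  fixes F F' :: "real \<Rightarrow> real"
  assumes "\<And>x. x \<in> {0..T} \<Longrightarrow> (F has_real_derivative F' x) (at x within {0..T})"
    and "\<And>x. x \<in> {0..T} \<Longrightarrow> 0 \<le> F' x"
    and "0 \<le> r" "r \<le> s" "s \<le> T"
  shows "F r \<le> F s"
proof (cases "r = s")
  case False
  then have "r < s" using assms by simp
  have "(F has_derivative (*) (F' x)) (at x within {r..s})" if "r \<le> x" "x \<le> s" for x
    using assms(1)[of x] that assms(3-5)
    unfolding has_field_derivative_def by (auto intro: has_derivative_subset)
  then have "\<exists>x\<in>{r<..<s}. F s - F r = F' x * (s - r)"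
    by (intro mvt_simple \<open>r < s\<close>) auto
  then obtain x where "x \<in> {r<..<s}" "F s - F r = F' x * (s - r)" by auto
  moreover from this have "0 \<le> F' x * (s - r)" using assms by (intro mult_nonneg_nonneg) auto
  ultimately show ?thesis by simp
qed simp

text \<open>The spatial problem with the assumptions that make the weights positive, bounded and decreasing in
  time.\<close>

locale weighted_problem =
  fixes Q :: problem and Cb Clow Chigh :: "nat \<Rightarrow> real"
  assumes standing: "standing_assumptions Q Cb Clow Chigh"
    and a_pos: "\<And>z t. z \<in> Omega Q \<Longrightarrow> t \<in> {0..T_end Q} \<Longrightarrow> 0 < a1 Q z t \<and> 0 < a2 Q z t"
    and C1: "\<And>z. z \<in> Omega Q \<Longrightarrow> C1_time (T_end Q) (a1 Q z) \<and> C1_time (T_end Q) (a2 Q z)"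
    and log_derivative: "\<And>z t. z \<in> Omega Q \<Longrightarrow> t \<in> {0..T_end Q} \<Longrightarrow>
      \<bar>dt_on (T_end Q) (a1 Q z) t / a1 Q z t\<bar> + \<bar>dt_on (T_end Q) (a2 Q z) t / a2 Q z t\<bar> \<le> C_p Q"
begin

lemma weight_pos: "z \<in> Omega Q \<Longrightarrow> 0 < weight Q z"
  using standing by (simp add: standing_assumptions_def)

lemma p_pos:
  assumes "z \<in> Omega Q" "t \<in> {0..T_end Q}"
  shows "0 < p0 Q z t" "0 < p1 Q z t" "0 < p2 Q z t"
  using a_pos[OF assms] weight_pos[OF assms(1)] by (simp_all add: p0_def p1_def p2_def)

lemma coefficient_bounds:
  assumes "z \<in> Omega Q" "t \<in> {0..T_end Q}"
  shows "Clow 0 \<le> p0 Q z t" "p0 Q z t \<le> Chigh 0" "Clow 1 \<le> p1 Q z t" "p1 Q z t \<le> Chigh 1"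
    "Clow 2 \<le> p2 Q z t" "p2 Q z t \<le> Chigh 2" "\<bar>p3 Q z t\<bar> \<le> Chigh 3" "\<bar>p4 Q z t\<bar> \<le> Chigh 4"
    "\<bar>b3 Q z t\<bar> \<le> Cb 3"
proof -
  have "Clow 0 \<le> \<bar>p0 Q z t\<bar> \<and> \<bar>p0 Q z t\<bar> \<le> Chigh 0 \<and> Clow 1 \<le> \<bar>p1 Q z t\<bar> \<and> \<bar>p1 Q z t\<bar> \<le> Chigh 1
      \<and> Clow 2 \<le> \<bar>p2 Q z t\<bar> \<and> \<bar>p2 Q z t\<bar> \<le> Chigh 2 \<and> \<bar>p3 Q z t\<bar> \<le> Chigh 3
      \<and> \<bar>p4 Q z t\<bar> \<le> Chigh 4 \<and> \<bar>b3 Q z t\<bar> \<le> Cb 3"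
    using standing assms unfolding standing_assumptions_def by blast
  with p_pos[OF assms]
  show "Clow 0 \<le> p0 Q z t" "p0 Q z t \<le> Chigh 0" "Clow 1 \<le> p1 Q z t" "p1 Q z t \<le> Chigh 1"
    "Clow 2 \<le> p2 Q z t" "p2 Q z t \<le> Chigh 2" "\<bar>p3 Q z t\<bar> \<le> Chigh 3" "\<bar>p4 Q z t\<bar> \<le> Chigh 4"
    "\<bar>b3 Q z t\<bar> \<le> Cb 3"
    by linarith+
qed

lemma constants_pos:
  "0 < Clow 0" "0 < Clow 1" "0 < Clow 2" "0 < Chigh 0" "0 < Chigh 1" "0 < Chigh 2" "0 < Chigh 3"
  "0 < Chigh 4" "0 < Cb 3" "x_l Q < x_r Q" "y_l Q < y_r Q" "0 < T_end Q"
  using standing by (auto simp: standing_assumptions_def)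

lemma has_derivative_dt_on:
  assumes "C1_time T f" "0 < T" "t \<in> {0..T}"
  shows "(f has_real_derivative dt_on T f t) (at t within {0..T})"
proof -
  have "f differentiable (at t within {0..T})"
    using assms by (auto simp: C1_time_def differentiable_on_def)
  then show ?thesis
    by (simp add: dt_on_def vector_derivative_works has_real_derivative_iff_has_vector_derivative)
qed

text \<open>The bound on the logarithmic derivatives of \<open>a\<^sub>1\<close> and \<open>a\<^sub>2\<close> says that the exponential factor outgrows any
  decrease of \<open>a\<^sub>1\<close>, of \<open>a\<^sub>2\<close> and of their product.\<close>

lemma exp_growth_mono:
  assumes z: "z \<in> Omega Q" and "0 \<le> r" "r \<le> s" "s \<le> T_end Q"
  shows "exp (C_p Q * r) * a1 Q z r \<le> exp (C_p Q * s) * a1 Q z s" (is ?A1)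
    and "exp (C_p Q * r) * a2 Q z r \<le> exp (C_p Q * s) * a2 Q z s" (is ?A2)
    and "exp (C_p Q * r) * (a1 Q z r * a2 Q z r) \<le> exp (C_p Q * s) * (a1 Q z s * a2 Q z s)" (is ?A12)
proof -
  let ?D1 = "dt_on (T_end Q) (a1 Q z)" and ?D2 = "dt_on (T_end Q) (a2 Q z)"
  have d: "(a1 Q z has_real_derivative ?D1 t) (at t within {0..T_end Q})"
    "(a2 Q z has_real_derivative ?D2 t) (at t within {0..T_end Q})" if "t \<in> {0..T_end Q}" for t
    using C1[OF z] constants_pos that by (auto intro: has_derivative_dt_on)
  have ineq: "0 \<le> C_p Q * a1 Q z t + ?D1 t" "0 \<le> C_p Q * a2 Q z t + ?D2 t"
    "0 \<le> C_p Q * (a1 Q z t * a2 Q z t) + (?D1 t * a2 Q z t + a1 Q z t * ?D2 t)"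
    if t: "t \<in> {0..T_end Q}" for t
  proof -
    define r1 r2 where "r1 = ?D1 t / a1 Q z t" and "r2 = ?D2 t / a2 Q z t"
    have pos: "0 < a1 Q z t" "0 < a2 Q z t" using a_pos[OF z t] by auto
    have D: "?D1 t = r1 * a1 Q z t" "?D2 t = r2 * a2 Q z t"
      using pos by (auto simp: r1_def r2_def)
    have "\<bar>r1\<bar> + \<bar>r2\<bar> \<le> C_p Q" using log_derivative[OF z t] by (simp add: r1_def r2_def)
    then have C: "0 \<le> C_p Q + r1" "0 \<le> C_p Q + r2" "0 \<le> C_p Q + r1 + r2" by linarith+
    have "0 \<le> (C_p Q + r1) * a1 Q z t" "0 \<le> (C_p Q + r2) * a2 Q z t"
      "0 \<le> (C_p Q + r1 + r2) * (a1 Q z t * a2 Q z t)"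
      using C pos by auto
    then show "0 \<le> C_p Q * a1 Q z t + ?D1 t" "0 \<le> C_p Q * a2 Q z t + ?D2 t"
      "0 \<le> C_p Q * (a1 Q z t * a2 Q z t) + (?D1 t * a2 Q z t + a1 Q z t * ?D2 t)"
      unfolding D by (simp_all add: algebra_simps)
  qed
  show ?A1
  proof (rule nondecreasing_on_interval[OF _ _ assms(2-4)])
    show "((\<lambda>t. exp (C_p Q * t) * a1 Q z t) has_real_derivative
        exp (C_p Q * t) * (C_p Q * a1 Q z t + ?D1 t)) (at t within {0..T_end Q})"
      if "t \<in> {0..T_end Q}" for t
      using d[OF that] by (auto intro!: derivative_eq_intros simp: algebra_simps)
  qed (use ineq in auto)
  show ?A2
  proof (rule nondecreasing_on_interval[OF _ _ assms(2-4)])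
    show "((\<lambda>t. exp (C_p Q * t) * a2 Q z t) has_real_derivative
        exp (C_p Q * t) * (C_p Q * a2 Q z t + ?D2 t)) (at t within {0..T_end Q})"
      if "t \<in> {0..T_end Q}" for t
      using d[OF that] by (auto intro!: derivative_eq_intros simp: algebra_simps)
  qed (use ineq in auto)
  show ?A12
  proof (rule nondecreasing_on_interval[OF _ _ assms(2-4)])
    show "((\<lambda>t. exp (C_p Q * t) * (a1 Q z t * a2 Q z t)) has_real_derivative
        exp (C_p Q * t) * (C_p Q * (a1 Q z t * a2 Q z t) + (?D1 t * a2 Q z t + a1 Q z t * ?D2 t)))
        (at t within {0..T_end Q})"
      if "t \<in> {0..T_end Q}" for t
      using d[OF that] by (auto intro!: derivative_eq_intros simp: algebra_simps)
  qed (use ineq in auto)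
qed

lemma p_decreasing:
  assumes z: "z \<in> Omega Q" and "0 \<le> r" "r \<le> s" "s \<le> T_end Q"
  shows "p0 Q z s \<le> p0 Q z r" "p1 Q z s \<le> p1 Q z r" "p2 Q z s \<le> p2 Q z r"
proof -
  have pos: "0 < a1 Q z r" "0 < a2 Q z r" "0 < a1 Q z s" "0 < a2 Q z s" "0 < weight Q z"
    using a_pos[OF z] weight_pos[OF z] assms by auto
  have p0: "p0 Q z t = weight Q z / (exp (C_p Q * t) * (a1 Q z t * a2 Q z t))" for t
    by (simp add: p0_def exp_minus divide_inverse)
  have p1: "p1 Q z t = weight Q z / (exp (C_p Q * t) * a2 Q z t)" if "0 < a1 Q z t" for t
    using that by (simp add: p1_def p0 field_simps)
  have p2: "p2 Q z t = weight Q z / (exp (C_p Q * t) * a1 Q z t)" if "0 < a2 Q z t" for t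
    using that by (simp add: p2_def p0 field_simps)
  show "p0 Q z s \<le> p0 Q z r" "p1 Q z s \<le> p1 Q z r" "p2 Q z s \<le> p2 Q z r"
    using pos exp_growth_mono[OF assms] by (auto simp: p0 p1 p2 intro!: divide_left_mono)
qed

end

section \<open>Grid functions\<close>

lemma sum_by_parts_grid:
  fixes r V :: "nat \<Rightarrow> real"
  assumes "0 < M" "V 0 = 0" "V M = 0"
  shows "(\<Sum>i=1..<M. (r i - r (i - 1)) * V i) = - (\<Sum>i=0..<M. r i * (V (i + 1) - V i))"
proof -
  have "(\<Sum>i=1..<Suc m. (r i - r (i - 1)) * V i) + (\<Sum>i=0..<Suc m. r i * (V (i + 1) - V i))
      = r m * V (Suc m) - r 0 * V 0" for m
    by (induction m) (simp_all add: algebra_simps)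
  from this[of "M - 1"] show ?thesis using assms by simp
qed

lemma discrete_poincare:
  fixes w :: "nat \<Rightarrow> real"
  assumes "w 0 = 0"
  shows "(\<Sum>i=1..<M. (w i)\<^sup>2) \<le> (real M)\<^sup>2 * (\<Sum>i=0..<M. (w (i + 1) - w i)\<^sup>2)"
proof -
  let ?D = "\<Sum>i=0..<M. (w (i + 1) - w i)\<^sup>2"
  have D: "0 \<le> ?D" by (intro sum_nonneg) auto
  have "(w i)\<^sup>2 \<le> real M * ?D" if "i < M" for i
  proof -
    have "w i = (\<Sum>l=0..<i. w (l + 1) - w l)"
      using assms by (induction i) auto
    then have "(w i)\<^sup>2 \<le> real i * (\<Sum>l=0..<i. (w (l + 1) - w l)\<^sup>2)"
      using sum_squared_le_sum_of_squares[of "\<lambda>l. w (l + 1) - w l" "{0..<i}"] by (simp add: mult.commute)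
    also have "\<dots> \<le> real M * ?D"
      using that by (intro mult_mono sum_mono2 sum_nonneg) auto
    finally show ?thesis .
  qed
  then have "(\<Sum>i=1..<M. (w i)\<^sup>2) \<le> (\<Sum>i=1..<M. real M * ?D)"
    by (intro sum_mono) auto
  also have "\<dots> = real (M - 1) * (real M * ?D)" by simp
  also have "\<dots> \<le> real M * (real M * ?D)"
    using D by (intro mult_right_mono) auto
  finally show ?thesis by (simp add: power2_eq_square mult.assoc)
qed

lemma centred_difference_le:
  fixes w :: "nat \<Rightarrow> real"
  shows "(\<Sum>i=1..<M. ((w (i + 1) - w (i - 1)) / 2)\<^sup>2) \<le> (\<Sum>i=0..<M. (w (i + 1) - w i)\<^sup>2)"
proof (cases "M = 0")
  case False
  then obtain m where M: "M = Suc m" by (cases M) auto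
  let ?d = "\<lambda>i. (w (i + 1) - w i)\<^sup>2"
  have "(\<Sum>i=1..<M. ((w (i + 1) - w (i - 1)) / 2)\<^sup>2) \<le> (\<Sum>i=1..<M. ?d i / 2 + ?d (i - 1) / 2)"
  proof (rule sum_mono)
    fix i assume "i \<in> {1..<M}"
    then have "w (i - 1 + 1) = w i" by simp
    moreover have "0 \<le> ((w (i + 1) - w i) - (w i - w (i - 1)))\<^sup>2" by simp
    ultimately show "((w (i + 1) - w (i - 1)) / 2)\<^sup>2 \<le> ?d i / 2 + ?d (i - 1) / 2"
      by (simp add: power2_eq_square field_simps)
  qed
  also have "\<dots> = (\<Sum>i=1..<M. ?d i) / 2 + (\<Sum>i=0..<m. ?d i) / 2"
    unfolding M One_nat_def sum.shift_bounds_Suc_ivl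
    by (simp add: sum.distrib sum_divide_distrib)
  also have "\<dots> \<le> (\<Sum>i=0..<M. ?d i) / 2 + (\<Sum>i=0..<M. ?d i) / 2"
    unfolding M by (intro add_mono divide_right_mono sum_mono2) auto
  finally show ?thesis by simp
qed simp

lemma grid_norm_L2_set:
  assumes "0 \<le> hx Q Mx * hy Q My"
  shows "grid_norm Q Mx My w
    = sqrt (hx Q Mx * hy Q My) * L2_set (\<lambda>(i, j). w i j) ({1..<Mx} \<times> {1..<My})"
  by (simp add: grid_norm_def L2_set_def sum.cartesian_product real_sqrt_mult split_def)

lemma grid_norm_nonneg: "0 \<le> hx Q Mx * hy Q My \<Longrightarrow> 0 \<le> grid_norm Q Mx My w"
  by (simp add: grid_norm_def sum_nonneg)

lemma grid_norm_square:
  "0 \<le> hx Q Mx * hy Q My \<Longrightarrow>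
    (grid_norm Q Mx My w)\<^sup>2 = hx Q Mx * hy Q My * (\<Sum>i=1..<Mx. \<Sum>j=1..<My. (w i j)\<^sup>2)"
  by (simp add: grid_norm_def sum_nonneg)

lemma norm_dx_square:
  "0 \<le> hx Q Mx * hy Q My \<Longrightarrow> (norm_dx Q Mx My w)\<^sup>2
    = hx Q Mx * hy Q My * (\<Sum>i=0..<Mx. \<Sum>j=1..<My. (delta_x Q Mx w i j)\<^sup>2)"
  by (simp add: norm_dx_def sum_nonneg)

lemma norm_dy_square:
  "0 \<le> hx Q Mx * hy Q My \<Longrightarrow> (norm_dy Q Mx My w)\<^sup>2
    = hx Q Mx * hy Q My * (\<Sum>i=1..<Mx. \<Sum>j=0..<My. (delta_y Q My w i j)\<^sup>2)"
  by (simp add: norm_dy_def sum_nonneg)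

lemma grad_norm_square:
  "(grad_norm Q Mx My w)\<^sup>2 = (norm_dx Q Mx My w)\<^sup>2 + (norm_dy Q Mx My w)\<^sup>2"
  by (simp add: grad_norm_def)

lemma grad_norm_nonneg: "0 \<le> grad_norm Q Mx My w"
  by (simp add: grad_norm_def)

lemma grid_pairing_le:
  assumes h: "0 \<le> hx Q Mx * hy Q My"
    and c: "\<And>i j. interior_index Mx My i j \<Longrightarrow> \<bar>c i j\<bar> \<le> c0" and "0 \<le> c0"
  shows "hx Q Mx * hy Q My * (\<Sum>i=1..<Mx. \<Sum>j=1..<My. c i j * (V i j * F i j))
    \<le> c0 * (grid_norm Q Mx My V * grid_norm Q Mx My F)"
proof -
  let ?I = "{1..<Mx} \<times> {1..<My}"
  have "(\<Sum>i=1..<Mx. \<Sum>j=1..<My. c i j * (V i j * F i j))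
      \<le> (\<Sum>i=1..<Mx. \<Sum>j=1..<My. c0 * (\<bar>V i j\<bar> * \<bar>F i j\<bar>))"
  proof (intro sum_mono)
    fix i j assume "i \<in> {1..<Mx}" "j \<in> {1..<My}"
    then have "\<bar>c i j\<bar> \<le> c0" using c[of i j] by (simp add: interior_index_def)
    have "c i j * (V i j * F i j) \<le> \<bar>c i j\<bar> * (\<bar>V i j\<bar> * \<bar>F i j\<bar>)"
      by (metis abs_ge_self abs_mult)
    also have "\<dots> \<le> c0 * (\<bar>V i j\<bar> * \<bar>F i j\<bar>)"
      using \<open>\<bar>c i j\<bar> \<le> c0\<close> by (intro mult_right_mono) auto
    finally show "c i j * (V i j * F i j) \<le> c0 * (\<bar>V i j\<bar> * \<bar>F i j\<bar>)" .
  qed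
  also have "\<dots> = c0 * (\<Sum>x\<in>?I. \<bar>case_prod V x\<bar> * \<bar>case_prod F x\<bar>)"
    by (simp add: sum.cartesian_product sum_distrib_left split_def)
  also have "\<dots> \<le> c0 * (L2_set (case_prod V) ?I * L2_set (case_prod F) ?I)"
    using assms(3) by (intro mult_left_mono L2_set_mult_ineq)
  finally have "hx Q Mx * hy Q My * (\<Sum>i=1..<Mx. \<Sum>j=1..<My. c i j * (V i j * F i j))
      \<le> (sqrt (hx Q Mx * hy Q My) * sqrt (hx Q Mx * hy Q My))
        * (c0 * (L2_set (case_prod V) ?I * L2_set (case_prod F) ?I))"
    using h by (simp add: mult_left_mono)
  also have "\<dots> = c0 * (grid_norm Q Mx My V * grid_norm Q Mx My F)"
    unfolding grid_norm_L2_set[OF h] by (simp add: algebra_simps)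
  finally show ?thesis .
qed

section \<open>The discrete energy\<close>

text \<open>The discrete energy of a velocity V and a displacement U, with the weights frozen at time s.\<close>

definition grid_energy ::
  "problem \<Rightarrow> nat \<Rightarrow> nat \<Rightarrow> real \<Rightarrow> (nat \<Rightarrow> nat \<Rightarrow> real) \<Rightarrow> (nat \<Rightarrow> nat \<Rightarrow> real) \<Rightarrow> real"
where
  "grid_energy Q Mx My s V U = hx Q Mx * hy Q My *
     ((\<Sum>i=1..<Mx. \<Sum>j=1..<My. p0 Q (pt Q Mx My (real i) (real j)) s * (V i j)\<^sup>2)
      + (\<Sum>i=0..<Mx. \<Sum>j=1..<My. p1 Q (pt Q Mx My (real i + 1 / 2) (real j)) s * (delta_x Q Mx U i j)\<^sup>2)
      + (\<Sum>i=1..<Mx. \<Sum>j=0..<My. p2 Q (pt Q Mx My (real i) (real j + 1 / 2)) s * (delta_y Q My U i j)\<^sup>2))"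

context weighted_problem
begin

text \<open>The contribution of the terms with \<open>p\<^sub>3\<close>, \<open>p\<^sub>4\<close> and \<open>b\<^sub>3\<close> is bounded by this multiple of the squared norms; the
  squared side length comes from the discrete Poincare inequality.\<close>

definition lower_order_constant :: real where
  "lower_order_constant = Chigh 0 * (Chigh 3 + Chigh 4 + Cb 3 * (1 + (x_r Q - x_l Q)\<^sup>2))"

context
  fixes Mx My :: nat
  assumes Mx: "0 < Mx" and My: "0 < My"
begin

lemma hx_pos: "0 < hx Q Mx" and hy_pos: "0 < hy Q My"
  using constants_pos Mx My by (auto simp: hx_def hy_def)

lemma cell_pos: "0 < hx Q Mx * hy Q My"
  using hx_pos hy_pos by simp

lemma pt_in_Omega:
  assumes "0 < i" "i < real Mx" "0 < j" "j < real My"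
  shows "pt Q Mx My i j \<in> Omega Q"
proof -
  have "i * hx Q Mx < real Mx * hx Q Mx" "j * hy Q My < real My * hy Q My"
    using assms hx_pos hy_pos by (auto intro: mult_strict_right_mono)
  moreover have "real Mx * hx Q Mx = x_r Q - x_l Q" "real My * hy Q My = y_r Q - y_l Q"
    using Mx My by (auto simp: hx_def hy_def)
  ultimately show ?thesis
    using assms hx_pos hy_pos by (auto simp: pt_def Omega_def)
qed

lemma pt_interior: "interior_index Mx My i j \<Longrightarrow> pt Q Mx My (real i) (real j) \<in> Omega Q"
  by (intro pt_in_Omega) (auto simp: interior_index_def)

lemma pt_half_x:
  assumes "i < Mx" "1 \<le> j" "j < My"
  shows "pt Q Mx My (real i + 1 / 2) (real j) \<in> Omega Q"
proof -
  have "real i + 1 \<le> real Mx" using assms(1) by linarith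
  then show ?thesis using assms by (intro pt_in_Omega) auto
qed

lemma pt_half_y:
  assumes "1 \<le> i" "i < Mx" "j < My"
  shows "pt Q Mx My (real i) (real j + 1 / 2) \<in> Omega Q"
proof -
  have "real j + 1 \<le> real My" using assms(3) by linarith
  then show ?thesis using assms by (intro pt_in_Omega) auto
qed

subsection \<open>Bounds for the energy\<close>

lemma energy_lower:
  assumes s: "s \<in> {0..T_end Q}" and c: "c \<le> Clow 0" "c \<le> Clow 1" "c \<le> Clow 2"
  shows "c * ((grid_norm Q Mx My V)\<^sup>2 + (grad_norm Q Mx My U)\<^sup>2) \<le> grid_energy Q Mx My s V U"
proof -
  have "(\<Sum>i=1..<Mx. \<Sum>j=1..<My. c * (V i j)\<^sup>2)
      \<le> (\<Sum>i=1..<Mx. \<Sum>j=1..<My. p0 Q (pt Q Mx My (real i) (real j)) s * (V i j)\<^sup>2)"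
    using c coefficient_bounds(1)[OF pt_interior s]
    by (intro sum_mono mult_right_mono) (auto simp: interior_index_def intro: order_trans)
  moreover have "(\<Sum>i=0..<Mx. \<Sum>j=1..<My. c * (delta_x Q Mx U i j)\<^sup>2)
      \<le> (\<Sum>i=0..<Mx. \<Sum>j=1..<My. p1 Q (pt Q Mx My (real i + 1 / 2) (real j)) s * (delta_x Q Mx U i j)\<^sup>2)"
    using c coefficient_bounds(3)[OF pt_half_x s]
    by (intro sum_mono mult_right_mono) (auto intro: order_trans)
  moreover have "(\<Sum>i=1..<Mx. \<Sum>j=0..<My. c * (delta_y Q My U i j)\<^sup>2)
      \<le> (\<Sum>i=1..<Mx. \<Sum>j=0..<My. p2 Q (pt Q Mx My (real i) (real j + 1 / 2)) s * (delta_y Q My U i j)\<^sup>2)"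
    using c coefficient_bounds(5)[OF pt_half_y s]
    by (intro sum_mono mult_right_mono) (auto intro: order_trans)
  ultimately have "hx Q Mx * hy Q My * ((\<Sum>i=1..<Mx. \<Sum>j=1..<My. c * (V i j)\<^sup>2)
      + (\<Sum>i=0..<Mx. \<Sum>j=1..<My. c * (delta_x Q Mx U i j)\<^sup>2)
      + (\<Sum>i=1..<Mx. \<Sum>j=0..<My. c * (delta_y Q My U i j)\<^sup>2)) \<le> grid_energy Q Mx My s V U"
    unfolding grid_energy_def using cell_pos by (intro mult_left_mono add_mono) auto
  then show ?thesis
    unfolding grad_norm_square grid_norm_square[OF less_imp_le[OF cell_pos]]
      norm_dx_square[OF less_imp_le[OF cell_pos]] norm_dy_square[OF less_imp_le[OF cell_pos]]
    by (simp only: sum_distrib_left[symmetric] distrib_left mult.left_commute add.assoc)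
qed

lemma energy_upper:
  assumes s: "s \<in> {0..T_end Q}" and c: "Chigh 1 \<le> c" "Chigh 2 \<le> c"
    and V: "\<And>i j. interior_index Mx My i j \<Longrightarrow> V i j = 0"
  shows "grid_energy Q Mx My s V U \<le> c * (grad_norm Q Mx My U)\<^sup>2"
proof -
  have "(\<Sum>i=1..<Mx. \<Sum>j=1..<My. p0 Q (pt Q Mx My (real i) (real j)) s * (V i j)\<^sup>2) = 0"
    using V by (intro sum.neutral ballI) (simp add: interior_index_def)
  moreover have "(\<Sum>i=0..<Mx. \<Sum>j=1..<My. p1 Q (pt Q Mx My (real i + 1 / 2) (real j)) s * (delta_x Q Mx U i j)\<^sup>2)
      \<le> (\<Sum>i=0..<Mx. \<Sum>j=1..<My. c * (delta_x Q Mx U i j)\<^sup>2)"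
    using c coefficient_bounds(4)[OF pt_half_x s]
    by (intro sum_mono mult_right_mono) (auto intro: order_trans)
  moreover have "(\<Sum>i=1..<Mx. \<Sum>j=0..<My. p2 Q (pt Q Mx My (real i) (real j + 1 / 2)) s * (delta_y Q My U i j)\<^sup>2)
      \<le> (\<Sum>i=1..<Mx. \<Sum>j=0..<My. c * (delta_y Q My U i j)\<^sup>2)"
    using c coefficient_bounds(6)[OF pt_half_y s]
    by (intro sum_mono mult_right_mono) (auto intro: order_trans)
  ultimately have "grid_energy Q Mx My s V U \<le> hx Q Mx * hy Q My *
      (0 + (\<Sum>i=0..<Mx. \<Sum>j=1..<My. c * (delta_x Q Mx U i j)\<^sup>2)
      + (\<Sum>i=1..<Mx. \<Sum>j=0..<My. c * (delta_y Q My U i j)\<^sup>2))"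
    unfolding grid_energy_def using cell_pos by (intro mult_left_mono add_mono) auto
  then show ?thesis
    unfolding grad_norm_square norm_dx_square[OF less_imp_le[OF cell_pos]]
      norm_dy_square[OF less_imp_le[OF cell_pos]]
    by (simp only: sum_distrib_left[symmetric] distrib_left mult.left_commute add_0_left)
qed

subsection \<open>Summation by parts\<close>

text \<open>The equation tested with \<open>p V\<close>. The factor p cancels its inverse in the second-order part of the
  difference operator, which is then summed by parts; in the scheme, Z is the discrete derivative of v
  and V is the discrete derivative of the shifted displacement.\<close>

lemma energy_identity:
  assumes s: "s \<in> {0..T_end Q}"
    and Vx: "\<And>j. 1 \<le> j \<Longrightarrow> j < My \<Longrightarrow> V 0 j = 0 \<and> V Mx j = 0"
    and Vy: "\<And>i. 1 \<le> i \<Longrightarrow> i < Mx \<Longrightarrow> V i 0 = 0 \<and> V i My = 0"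
    and Z: "\<And>i j. interior_index Mx My i j \<Longrightarrow> Z i j = discrete_op Q Mx My s U i j + F i j"
  shows "(\<Sum>i=1..<Mx. \<Sum>j=1..<My. p0 Q (pt Q Mx My (real i) (real j)) s * (V i j * Z i j))
      + (\<Sum>i=0..<Mx. \<Sum>j=1..<My. p1 Q (pt Q Mx My (real i + 1 / 2) (real j)) s
          * (delta_x Q Mx U i j * delta_x Q Mx V i j))
      + (\<Sum>i=1..<Mx. \<Sum>j=0..<My. p2 Q (pt Q Mx My (real i) (real j + 1 / 2)) s
          * (delta_y Q My U i j * delta_y Q My V i j))
    = (\<Sum>i=1..<Mx. \<Sum>j=1..<My. p0 Q (pt Q Mx My (real i) (real j)) s *
        (V i j * (p3 Q (pt Q Mx My (real i) (real j)) s * delta_xhat Q Mx U i j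
          + p4 Q (pt Q Mx My (real i) (real j)) s * delta_yhat Q My U i j
          + b3 Q (pt Q Mx My (real i) (real j)) s * U i j + F i j)))"
    (is "?Z + ?X + ?Y = ?R")
proof -
  define qx where "qx i j = p1 Q (pt Q Mx My (real i + 1 / 2) (real j)) s * delta_x Q Mx U i j" for i j
  define qy where "qy i j = p2 Q (pt Q Mx My (real i) (real j + 1 / 2)) s * delta_y Q My U i j" for i j
  have "?X = (\<Sum>j=1..<My. \<Sum>i=0..<Mx. qx i j * (V (i + 1) j - V i j) / hx Q Mx)"
    by (subst sum.swap) (simp add: qx_def delta_x_def mult.assoc)
  also have "\<dots> = (\<Sum>j=1..<My. - (\<Sum>i=1..<Mx. (qx i j - qx (i - 1) j) * V i j) / hx Q Mx)"
  proof (intro sum.cong refl)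
    fix j assume "j \<in> {1..<My}"
    then show "(\<Sum>i=0..<Mx. qx i j * (V (i + 1) j - V i j) / hx Q Mx)
        = - (\<Sum>i=1..<Mx. (qx i j - qx (i - 1) j) * V i j) / hx Q Mx"
      using sum_by_parts_grid[OF Mx, of "\<lambda>i. V i j" "\<lambda>i. qx i j"] Vx
      by (simp add: sum_divide_distrib[symmetric])
  qed
  also have "\<dots> = - (\<Sum>i=1..<Mx. \<Sum>j=1..<My. (qx i j - qx (i - 1) j) / hx Q Mx * V i j)"
    by (subst sum.swap) (simp add: sum_negf sum_divide_distrib)
  finally have X: "?X = - (\<Sum>i=1..<Mx. \<Sum>j=1..<My. (qx i j - qx (i - 1) j) / hx Q Mx * V i j)" .
  have "?Y = (\<Sum>i=1..<Mx. \<Sum>j=0..<My. qy i j * (V i (j + 1) - V i j) / hy Q My)"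
    by (simp add: qy_def delta_y_def mult.assoc)
  also have "\<dots> = (\<Sum>i=1..<Mx. - (\<Sum>j=1..<My. (qy i j - qy i (j - 1)) * V i j) / hy Q My)"
  proof (intro sum.cong refl)
    fix i assume "i \<in> {1..<Mx}"
    then show "(\<Sum>j=0..<My. qy i j * (V i (j + 1) - V i j) / hy Q My)
        = - (\<Sum>j=1..<My. (qy i j - qy i (j - 1)) * V i j) / hy Q My"
      using sum_by_parts_grid[OF My, of "V i" "qy i"] Vy
      by (simp add: sum_divide_distrib[symmetric])
  qed
  also have "\<dots> = - (\<Sum>i=1..<Mx. \<Sum>j=1..<My. (qy i j - qy i (j - 1)) / hy Q My * V i j)"
    by (simp add: sum_negf sum_divide_distrib)
  finally have Y: "?Y = - (\<Sum>i=1..<Mx. \<Sum>j=1..<My. (qy i j - qy i (j - 1)) / hy Q My * V i j)" .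
  have "?Z = ?R + (\<Sum>i=1..<Mx. \<Sum>j=1..<My. (qx i j - qx (i - 1) j) / hx Q Mx * V i j)
      + (\<Sum>i=1..<Mx. \<Sum>j=1..<My. (qy i j - qy i (j - 1)) / hy Q My * V i j)"
    unfolding sum.distrib[symmetric]
  proof (intro sum.cong refl)
    fix i j assume ij: "i \<in> {1..<Mx}" "j \<in> {1..<My}"
    then have int: "interior_index Mx My i j" by (simp add: interior_index_def)
    define p where "p = p0 Q (pt Q Mx My (real i) (real j)) s"
    define lower where "lower = p3 Q (pt Q Mx My (real i) (real j)) s * delta_xhat Q Mx U i j
          + p4 Q (pt Q Mx My (real i) (real j)) s * delta_yhat Q My U i j
          + b3 Q (pt Q Mx My (real i) (real j)) s * U i j"
    define dx dy where "dx = (qx i j - qx (i - 1) j) / hx Q Mx"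
      and "dy = (qy i j - qy i (j - 1)) / hy Q My"
    have "p \<noteq> 0" using p_pos(1)[OF pt_interior[OF int] s] by (simp add: p_def)
    have half: "real (i - 1) + 1 / 2 = real i - 1 / 2" "real (j - 1) + 1 / 2 = real j - 1 / 2"
      using ij by (auto simp: of_nat_diff)
    have "Z i j = inverse p * (dx + dy) + lower + F i j"
      unfolding Z[OF int] discrete_op_def p_def lower_def dx_def dy_def qx_def qy_def half by simp
    then have "p * (V i j * Z i j) = p * inverse p * (dx + dy) * V i j + p * (V i j * (lower + F i j))"
      by (simp add: algebra_simps)
    then show "p * (V i j * Z i j) = p * (V i j * (lower + F i j)) + dx * V i j + dy * V i j"
      using \<open>p \<noteq> 0\<close> by (simp add: algebra_simps)
  qed
  then show ?thesis unfolding X Y by simp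
qed

subsection \<open>Lower-order terms\<close>

lemma norm_xhat_le:
  "hx Q Mx * hy Q My * (\<Sum>i=1..<Mx. \<Sum>j=1..<My. (delta_xhat Q Mx U i j)\<^sup>2) \<le> (norm_dx Q Mx My U)\<^sup>2"
proof -
  have "(\<Sum>j=1..<My. \<Sum>i=1..<Mx. (delta_xhat Q Mx U i j)\<^sup>2) \<le> (\<Sum>j=1..<My. \<Sum>i=0..<Mx. (delta_x Q Mx U i j)\<^sup>2)"
  proof (rule sum_mono)
    fix j
    show "(\<Sum>i=1..<Mx. (delta_xhat Q Mx U i j)\<^sup>2) \<le> (\<Sum>i=0..<Mx. (delta_x Q Mx U i j)\<^sup>2)"
      using centred_difference_le[of "\<lambda>i. U i j / hx Q Mx" Mx]
      by (simp add: delta_xhat_def delta_x_def diff_divide_distrib[symmetric] mult.commute)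
  qed
  then show ?thesis
    unfolding norm_dx_square[OF less_imp_le[OF cell_pos]] using cell_pos
    by (subst (1 2) sum.swap) (simp add: mult_left_mono)
qed

lemma norm_yhat_le:
  "hx Q Mx * hy Q My * (\<Sum>i=1..<Mx. \<Sum>j=1..<My. (delta_yhat Q My U i j)\<^sup>2) \<le> (norm_dy Q Mx My U)\<^sup>2"
proof -
  have "(\<Sum>i=1..<Mx. \<Sum>j=1..<My. (delta_yhat Q My U i j)\<^sup>2) \<le> (\<Sum>i=1..<Mx. \<Sum>j=0..<My. (delta_y Q My U i j)\<^sup>2)"
  proof (rule sum_mono)
    fix i
    show "(\<Sum>j=1..<My. (delta_yhat Q My U i j)\<^sup>2) \<le> (\<Sum>j=0..<My. (delta_y Q My U i j)\<^sup>2)"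
      using centred_difference_le[of "\<lambda>j. U i j / hy Q My" My]
      by (simp add: delta_yhat_def delta_y_def diff_divide_distrib[symmetric] mult.commute)
  qed
  then show ?thesis
    unfolding norm_dy_square[OF less_imp_le[OF cell_pos]] using cell_pos by (simp add: mult_left_mono)
qed

lemma grid_norm_le_norm_dx:
  assumes U: "\<And>j. 1 \<le> j \<Longrightarrow> j < My \<Longrightarrow> U 0 j = 0"
  shows "(grid_norm Q Mx My U)\<^sup>2 \<le> (x_r Q - x_l Q)\<^sup>2 * (norm_dx Q Mx My U)\<^sup>2"
proof -
  have "(\<Sum>j=1..<My. \<Sum>i=1..<Mx. (U i j)\<^sup>2)
      \<le> (\<Sum>j=1..<My. (x_r Q - x_l Q)\<^sup>2 * (\<Sum>i=0..<Mx. (delta_x Q Mx U i j)\<^sup>2))"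
  proof (rule sum_mono)
    fix j assume j: "j \<in> {1..<My}"
    have eq: "(x_r Q - x_l Q)\<^sup>2 = (real Mx)\<^sup>2 * (hx Q Mx)\<^sup>2"
      using Mx by (simp add: hx_def power_divide)
    have "(\<Sum>i=1..<Mx. (U i j / hx Q Mx)\<^sup>2)
        \<le> (real Mx)\<^sup>2 * (\<Sum>i=0..<Mx. (delta_x Q Mx U i j)\<^sup>2)"
      using discrete_poincare[of "\<lambda>i. U i j / hx Q Mx" Mx] U j
      by (simp add: delta_x_def diff_divide_distrib[symmetric])
    then have "(hx Q Mx)\<^sup>2 * (\<Sum>i=1..<Mx. (U i j / hx Q Mx)\<^sup>2)
        \<le> (hx Q Mx)\<^sup>2 * ((real Mx)\<^sup>2 * (\<Sum>i=0..<Mx. (delta_x Q Mx U i j)\<^sup>2))"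
      by (intro mult_left_mono) auto
    moreover have "(hx Q Mx)\<^sup>2 * (\<Sum>i=1..<Mx. (U i j / hx Q Mx)\<^sup>2) = (\<Sum>i=1..<Mx. (U i j)\<^sup>2)"
      using hx_pos unfolding sum_distrib_left by (intro sum.cong) (auto simp: power_divide)
    ultimately show "(\<Sum>i=1..<Mx. (U i j)\<^sup>2)
        \<le> (x_r Q - x_l Q)\<^sup>2 * (\<Sum>i=0..<Mx. (delta_x Q Mx U i j)\<^sup>2)"
      unfolding eq by (simp only: mult.assoc mult.left_commute)
  qed
  also have "\<dots> = (x_r Q - x_l Q)\<^sup>2 * (\<Sum>i=0..<Mx. \<Sum>j=1..<My. (delta_x Q Mx U i j)\<^sup>2)"
    unfolding sum_distrib_left[symmetric] by (subst sum.swap) (rule refl)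
  finally have "(\<Sum>i=1..<Mx. \<Sum>j=1..<My. (U i j)\<^sup>2)
      \<le> (x_r Q - x_l Q)\<^sup>2 * (\<Sum>i=0..<Mx. \<Sum>j=1..<My. (delta_x Q Mx U i j)\<^sup>2)"
    by (subst sum.swap)
  then have "hx Q Mx * hy Q My * (\<Sum>i=1..<Mx. \<Sum>j=1..<My. (U i j)\<^sup>2) \<le> hx Q Mx * hy Q My *
      ((x_r Q - x_l Q)\<^sup>2 * (\<Sum>i=0..<Mx. \<Sum>j=1..<My. (delta_x Q Mx U i j)\<^sup>2))"
    using cell_pos by (intro mult_left_mono) auto
  then show ?thesis
    unfolding grid_norm_square[OF less_imp_le[OF cell_pos]] norm_dx_square[OF less_imp_le[OF cell_pos]]
    by (simp only: mult.left_commute)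
qed

lemma lower_order_bound:
  assumes s: "s \<in> {0..T_end Q}" and U: "\<And>j. 1 \<le> j \<Longrightarrow> j < My \<Longrightarrow> U 0 j = 0"
  shows "2 * (hx Q Mx * hy Q My * (\<Sum>i=1..<Mx. \<Sum>j=1..<My. p0 Q (pt Q Mx My (real i) (real j)) s *
        (V i j * (p3 Q (pt Q Mx My (real i) (real j)) s * delta_xhat Q Mx U i j
          + p4 Q (pt Q Mx My (real i) (real j)) s * delta_yhat Q My U i j
          + b3 Q (pt Q Mx My (real i) (real j)) s * U i j + (f i j + g i j)))))
    \<le> lower_order_constant * ((grid_norm Q Mx My V)\<^sup>2 + (grad_norm Q Mx My U)\<^sup>2)
      + 2 * Chigh 0 * (grid_norm Q Mx My V * (grid_norm Q Mx My f + grid_norm Q Mx My g))"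
proof -
  let ?z = "\<lambda>i j. pt Q Mx My (real i) (real j)"
  let ?h = "hx Q Mx * hy Q My"
  let ?S = "\<lambda>w::nat \<Rightarrow> nat \<Rightarrow> real. \<Sum>i=1..<Mx. \<Sum>j=1..<My. w i j"
  define c0 c3 c4 cb where "c0 = Chigh 0" and "c3 = Chigh 3" and "c4 = Chigh 4" and "cb = Cb 3"
  have cpos: "0 < c0" "0 < c3" "0 < c4" "0 < cb"
    using constants_pos by (auto simp: c0_def c3_def c4_def cb_def)
  have h: "0 \<le> ?h" using cell_pos by simp
  have young: "2 * (p * (x * (r * y))) \<le> c0 * c * (x\<^sup>2 + y\<^sup>2)"
    if "0 \<le> p" "p \<le> c0" "\<bar>r\<bar> \<le> c" for p r c x y :: real
  proof -
    have "2 * (x * (r * y)) \<le> \<bar>r\<bar> * (2 * \<bar>x * y\<bar>)"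
      using abs_ge_self[of "r * (x * y)"] by (simp add: abs_mult mult.left_commute)
    also have "\<dots> \<le> \<bar>r\<bar> * (x\<^sup>2 + y\<^sup>2)"
    proof (intro mult_left_mono)
      have "0 \<le> (\<bar>x\<bar> - \<bar>y\<bar>)\<^sup>2" by simp
      then show "2 * \<bar>x * y\<bar> \<le> x\<^sup>2 + y\<^sup>2" by (simp add: power2_diff abs_mult)
    qed simp
    also have "\<dots> \<le> c * (x\<^sup>2 + y\<^sup>2)" using that by (intro mult_right_mono) auto
    finally have "p * (2 * (x * (r * y))) \<le> c0 * (c * (x\<^sup>2 + y\<^sup>2))"
      using that by (intro order_trans[OF mult_left_mono[of _ _ p] mult_right_mono])
        (auto intro!: mult_nonneg_nonneg)
    then show ?thesis by (simp add: algebra_simps)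
  qed
  have "2 * ?S (\<lambda>i j. p0 Q (?z i j) s * (V i j * (p3 Q (?z i j) s * delta_xhat Q Mx U i j
          + p4 Q (?z i j) s * delta_yhat Q My U i j + b3 Q (?z i j) s * U i j + (f i j + g i j))))
      \<le> ?S (\<lambda>i j. c0 * (c3 + c4 + cb) * (V i j)\<^sup>2 + c0 * c3 * (delta_xhat Q Mx U i j)\<^sup>2
          + c0 * c4 * (delta_yhat Q My U i j)\<^sup>2 + c0 * cb * (U i j)\<^sup>2
          + 2 * (p0 Q (?z i j) s * (V i j * f i j)) + 2 * (p0 Q (?z i j) s * (V i j * g i j)))"
    unfolding sum_distrib_left
  proof (intro sum_mono)
    fix i j assume "i \<in> {1..<Mx}" "j \<in> {1..<My}"
    then have z: "?z i j \<in> Omega Q" by (intro pt_interior) (simp add: interior_index_def)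
    have p: "0 \<le> p0 Q (?z i j) s" "p0 Q (?z i j) s \<le> c0"
      using p_pos(1)[OF z s] coefficient_bounds[OF z s] by (auto simp: c0_def)
    have "2 * (p0 Q (?z i j) s * (V i j * (p3 Q (?z i j) s * delta_xhat Q Mx U i j)))
        \<le> c0 * c3 * ((V i j)\<^sup>2 + (delta_xhat Q Mx U i j)\<^sup>2)"
      using coefficient_bounds[OF z s] by (intro young p) (simp add: c3_def)
    moreover have "2 * (p0 Q (?z i j) s * (V i j * (p4 Q (?z i j) s * delta_yhat Q My U i j)))
        \<le> c0 * c4 * ((V i j)\<^sup>2 + (delta_yhat Q My U i j)\<^sup>2)"
      using coefficient_bounds[OF z s] by (intro young p) (simp add: c4_def)
    moreover have "2 * (p0 Q (?z i j) s * (V i j * (b3 Q (?z i j) s * U i j)))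
        \<le> c0 * cb * ((V i j)\<^sup>2 + (U i j)\<^sup>2)"
      using coefficient_bounds[OF z s] by (intro young p) (simp add: cb_def)
    ultimately show "2 * (p0 Q (?z i j) s * (V i j * (p3 Q (?z i j) s * delta_xhat Q Mx U i j
          + p4 Q (?z i j) s * delta_yhat Q My U i j + b3 Q (?z i j) s * U i j + (f i j + g i j))))
        \<le> c0 * (c3 + c4 + cb) * (V i j)\<^sup>2 + c0 * c3 * (delta_xhat Q Mx U i j)\<^sup>2
          + c0 * c4 * (delta_yhat Q My U i j)\<^sup>2 + c0 * cb * (U i j)\<^sup>2
          + 2 * (p0 Q (?z i j) s * (V i j * f i j)) + 2 * (p0 Q (?z i j) s * (V i j * g i j))"
      by (simp only: distrib_left distrib_right)
  qed
  then have "?h * (2 * ?S (\<lambda>i j. p0 Q (?z i j) s * (V i j * (p3 Q (?z i j) s * delta_xhat Q Mx U i j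
          + p4 Q (?z i j) s * delta_yhat Q My U i j + b3 Q (?z i j) s * U i j + (f i j + g i j)))))
      \<le> ?h * ?S (\<lambda>i j. c0 * (c3 + c4 + cb) * (V i j)\<^sup>2 + c0 * c3 * (delta_xhat Q Mx U i j)\<^sup>2
          + c0 * c4 * (delta_yhat Q My U i j)\<^sup>2 + c0 * cb * (U i j)\<^sup>2
          + 2 * (p0 Q (?z i j) s * (V i j * f i j)) + 2 * (p0 Q (?z i j) s * (V i j * g i j)))"
    using h by (rule mult_left_mono)
  also have "\<dots> = c0 * (c3 + c4 + cb) * (?h * ?S (\<lambda>i j. (V i j)\<^sup>2))
        + c0 * c3 * (?h * ?S (\<lambda>i j. (delta_xhat Q Mx U i j)\<^sup>2))
        + c0 * c4 * (?h * ?S (\<lambda>i j. (delta_yhat Q My U i j)\<^sup>2)) + c0 * cb * (?h * ?S (\<lambda>i j. (U i j)\<^sup>2))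
        + 2 * (?h * ?S (\<lambda>i j. p0 Q (?z i j) s * (V i j * f i j)))
        + 2 * (?h * ?S (\<lambda>i j. p0 Q (?z i j) s * (V i j * g i j)))"
    unfolding sum.distrib sum_distrib_left[symmetric] by (simp only: distrib_left mult.left_commute)
  also have "\<dots> \<le> c0 * (c3 + c4 + cb) * (grid_norm Q Mx My V)\<^sup>2
        + c0 * c3 * (norm_dx Q Mx My U)\<^sup>2 + c0 * c4 * (norm_dy Q Mx My U)\<^sup>2
        + c0 * cb * ((x_r Q - x_l Q)\<^sup>2 * (norm_dx Q Mx My U)\<^sup>2)
        + 2 * (c0 * (grid_norm Q Mx My V * grid_norm Q Mx My f))
        + 2 * (c0 * (grid_norm Q Mx My V * grid_norm Q Mx My g))"
  proof (intro add_mono mult_left_mono norm_xhat_le norm_yhat_le grid_pairing_le h)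
    show "?h * ?S (\<lambda>i j. (V i j)\<^sup>2) \<le> (grid_norm Q Mx My V)\<^sup>2"
      using grid_norm_square[OF h] by simp
    show "?h * ?S (\<lambda>i j. (U i j)\<^sup>2) \<le> (x_r Q - x_l Q)\<^sup>2 * (norm_dx Q Mx My U)\<^sup>2"
      using grid_norm_le_norm_dx[where U = U, OF U] grid_norm_square[OF h] by simp
    fix i j assume "interior_index Mx My i j"
    then have z: "?z i j \<in> Omega Q" by (rule pt_interior)
    show "\<bar>p0 Q (?z i j) s\<bar> \<le> c0" "\<bar>p0 Q (?z i j) s\<bar> \<le> c0"
      using p_pos(1)[OF z s] coefficient_bounds[OF z s] by (auto simp: c0_def)
  qed (use cpos in auto)
  also have "\<dots> \<le> c0 * (c3 + c4 + cb * (1 + (x_r Q - x_l Q)\<^sup>2))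
          * ((grid_norm Q Mx My V)\<^sup>2 + (grad_norm Q Mx My U)\<^sup>2)
        + 2 * c0 * (grid_norm Q Mx My V * (grid_norm Q Mx My f + grid_norm Q Mx My g))"
  proof -
    define a x y L where "a = (grid_norm Q Mx My V)\<^sup>2" and "x = (norm_dx Q Mx My U)\<^sup>2"
      and "y = (norm_dy Q Mx My U)\<^sup>2" and "L = (x_r Q - x_l Q)\<^sup>2"
    have pos: "0 \<le> a" "0 \<le> x" "0 \<le> y" "0 \<le> L" by (auto simp: a_def x_def y_def L_def)
    have "0 \<le> c0 * (cb * L * a + c4 * x + cb * x + c3 * y + cb * y + cb * L * y)"
      using pos cpos by simp
    then show ?thesis
      unfolding grad_norm_square a_def[symmetric] x_def[symmetric] y_def[symmetric] L_def[symmetric]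
      by (simp add: algebra_simps)
  qed
  finally show ?thesis
    by (simp add: lower_order_constant_def c0_def c3_def c4_def cb_def mult.left_commute)
qed

end

end

section \<open>Grid norms of sums and of offset values\<close>

lemma grad_norm_cong:
  assumes "\<And>i j. i \<le> Mx \<Longrightarrow> j \<le> My \<Longrightarrow> w i j = w' i j"
  shows "grad_norm Q Mx My w = grad_norm Q Mx My w'"
proof -
  have "norm_dx Q Mx My w = norm_dx Q Mx My w'" "norm_dy Q Mx My w = norm_dy Q Mx My w'"
    unfolding norm_dx_def norm_dy_def delta_x_def delta_y_def
    using assms by (auto intro!: arg_cong[of _ _ sqrt] arg_cong2[of _ _ _ _ "(*)"] sum.cong)
  then show ?thesis by (simp add: grad_norm_def)
qed

lemma grad_norm_add_scaled_le:
  assumes h: "0 \<le> hx Q Mx * hy Q My" and "0 \<le> c"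
  shows "grad_norm Q Mx My (\<lambda>i j. a i j + c * b i j)
    \<le> 2 * (grad_norm Q Mx My a + c * grad_norm Q Mx My b)"
proof -
  have sq: "(x + c * y)\<^sup>2 \<le> 2 * x\<^sup>2 + 2 * (c\<^sup>2 * y\<^sup>2)" for x y :: real
  proof -
    have "0 \<le> (x - c * y)\<^sup>2" by simp
    then show ?thesis by (simp add: power2_sum power2_diff power_mult_distrib)
  qed
  have dx: "delta_x Q Mx (\<lambda>i j. a i j + c * b i j) i j = delta_x Q Mx a i j + c * delta_x Q Mx b i j"
    for i j by (simp add: delta_x_def add_divide_distrib diff_divide_distrib right_diff_distrib)
  have dy: "delta_y Q My (\<lambda>i j. a i j + c * b i j) i j = delta_y Q My a i j + c * delta_y Q My b i j"
    for i j by (simp add: delta_y_def add_divide_distrib diff_divide_distrib right_diff_distrib)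
  have "(norm_dx Q Mx My (\<lambda>i j. a i j + c * b i j))\<^sup>2 \<le> hx Q Mx * hy Q My *
      (\<Sum>i=0..<Mx. \<Sum>j=1..<My. 2 * (delta_x Q Mx a i j)\<^sup>2 + 2 * (c\<^sup>2 * (delta_x Q Mx b i j)\<^sup>2))"
    unfolding norm_dx_square[OF h] dx using h by (intro mult_left_mono sum_mono sq)
  also have "\<dots> = 2 * (norm_dx Q Mx My a)\<^sup>2 + 2 * (c\<^sup>2 * (norm_dx Q Mx My b)\<^sup>2)"
    unfolding norm_dx_square[OF h]
    by (simp only: sum.distrib sum_distrib_left[symmetric] distrib_left mult.left_commute)
  finally have X: "(norm_dx Q Mx My (\<lambda>i j. a i j + c * b i j))\<^sup>2
      \<le> 2 * (norm_dx Q Mx My a)\<^sup>2 + 2 * (c\<^sup>2 * (norm_dx Q Mx My b)\<^sup>2)" .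
  have "(norm_dy Q Mx My (\<lambda>i j. a i j + c * b i j))\<^sup>2 \<le> hx Q Mx * hy Q My *
      (\<Sum>i=1..<Mx. \<Sum>j=0..<My. 2 * (delta_y Q My a i j)\<^sup>2 + 2 * (c\<^sup>2 * (delta_y Q My b i j)\<^sup>2))"
    unfolding norm_dy_square[OF h] dy using h by (intro mult_left_mono sum_mono sq)
  also have "\<dots> = 2 * (norm_dy Q Mx My a)\<^sup>2 + 2 * (c\<^sup>2 * (norm_dy Q Mx My b)\<^sup>2)"
    unfolding norm_dy_square[OF h]
    by (simp only: sum.distrib sum_distrib_left[symmetric] distrib_left mult.left_commute)
  finally have "(grad_norm Q Mx My (\<lambda>i j. a i j + c * b i j))\<^sup>2
      \<le> 2 * (grad_norm Q Mx My a)\<^sup>2 + 2 * (c\<^sup>2 * (grad_norm Q Mx My b)\<^sup>2)"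
    using X unfolding grad_norm_square by (simp add: distrib_left)
  also have "\<dots> \<le> (2 * (grad_norm Q Mx My a + c * grad_norm Q Mx My b))\<^sup>2"
  proof -
    define x y where "x = grad_norm Q Mx My a" and "y = c * grad_norm Q Mx My b"
    have "0 \<le> x" "0 \<le> y" using assms(2) grad_norm_nonneg by (auto simp: x_def y_def)
    then have "2 * x\<^sup>2 + 2 * y\<^sup>2 \<le> (2 * (x + y))\<^sup>2"
      by (simp add: power2_sum power_mult_distrib)
    then show ?thesis by (simp add: x_def y_def power_mult_distrib)
  qed
  finally show ?thesis
    using assms(2) grad_norm_nonneg by (auto intro: power2_le_imp_le)
qed

lemma convex_square_le:
  assumes "0 \<le> \<theta>" "\<theta> \<le> 1"
  shows "(offset \<theta> f n)\<^sup>2 \<le> (f n)\<^sup>2 + (f (n - 1))\<^sup>2"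
proof -
  define x y where "x = f n" and "y = f (n - 1)"
  have "(1 - \<theta>) * x\<^sup>2 + \<theta> * y\<^sup>2 - ((1 - \<theta>) * x + \<theta> * y)\<^sup>2 = \<theta> * (1 - \<theta>) * (x - y)\<^sup>2"
    by (simp add: power2_eq_square algebra_simps)
  also have "\<dots> \<ge> 0" using assms by simp
  finally have "((1 - \<theta>) * x + \<theta> * y)\<^sup>2 \<le> (1 - \<theta>) * x\<^sup>2 + \<theta> * y\<^sup>2" by simp
  also have "\<dots> \<le> 1 * x\<^sup>2 + 1 * y\<^sup>2"
    using assms by (intro add_mono mult_right_mono) auto
  finally show ?thesis by (simp add: offset_def x_def y_def)
qed

lemma grid_norm_offset_le:
  assumes h: "0 \<le> hx Q Mx * hy Q My" and "0 \<le> \<theta>" "\<theta> \<le> 1"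
  shows "(grid_norm Q Mx My (\<lambda>i j. offset \<theta> (\<lambda>k. w k i j) n))\<^sup>2
    \<le> (grid_norm Q Mx My (w n))\<^sup>2 + (grid_norm Q Mx My (w (n - 1)))\<^sup>2"
  unfolding grid_norm_square[OF h] distrib_left[symmetric] sum.distrib[symmetric]
  using assms convex_square_le[OF assms(2,3)] by (intro mult_left_mono sum_mono) auto

lemma delta_x_offset:
  "delta_x Q Mx (\<lambda>i j. offset \<theta> (\<lambda>k. w k i j) n) i j = offset \<theta> (\<lambda>k. delta_x Q Mx (w k) i j) n"
  by (simp add: delta_x_def offset_def add_divide_distrib diff_divide_distrib algebra_simps)

lemma delta_y_offset:
  "delta_y Q My (\<lambda>i j. offset \<theta> (\<lambda>k. w k i j) n) i j = offset \<theta> (\<lambda>k. delta_y Q My (w k) i j) n"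
  by (simp add: delta_y_def offset_def add_divide_distrib diff_divide_distrib algebra_simps)

lemma grad_norm_offset_le:
  assumes h: "0 \<le> hx Q Mx * hy Q My" and "0 \<le> \<theta>" "\<theta> \<le> 1"
  shows "(grad_norm Q Mx My (\<lambda>i j. offset \<theta> (\<lambda>k. w k i j) n))\<^sup>2
    \<le> (grad_norm Q Mx My (w n))\<^sup>2 + (grad_norm Q Mx My (w (n - 1)))\<^sup>2"
proof -
  have "(norm_dx Q Mx My (\<lambda>i j. offset \<theta> (\<lambda>k. w k i j) n))\<^sup>2
      \<le> (norm_dx Q Mx My (w n))\<^sup>2 + (norm_dx Q Mx My (w (n - 1)))\<^sup>2"
    unfolding norm_dx_square[OF h] delta_x_offset distrib_left[symmetric] sum.distrib[symmetric]
    using assms convex_square_le[OF assms(2,3)] by (intro mult_left_mono sum_mono) auto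
  moreover have "(norm_dy Q Mx My (\<lambda>i j. offset \<theta> (\<lambda>k. w k i j) n))\<^sup>2
      \<le> (norm_dy Q Mx My (w n))\<^sup>2 + (norm_dy Q Mx My (w (n - 1)))\<^sup>2"
    unfolding norm_dy_square[OF h] delta_y_offset distrib_left[symmetric] sum.distrib[symmetric]
    using assms convex_square_le[OF assms(2,3)] by (intro mult_left_mono sum_mono) auto
  ultimately show ?thesis unfolding grad_norm_square by linarith
qed

lemma alik_D_delta_x:
  "alik_D \<beta> \<theta> t (\<lambda>k. delta_x Q Mx (w k) i j) n
    = (alik_D \<beta> \<theta> t (\<lambda>k. w k (i + 1) j) n - alik_D \<beta> \<theta> t (\<lambda>k. w k i j) n) / hx Q Mx"
  using alik_D_cmult[of \<beta> \<theta> t "1 / hx Q Mx" "\<lambda>k. w k (i + 1) j - w k i j" n]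
  by (simp add: delta_x_def alik_D_diff)

lemma alik_D_delta_y:
  "alik_D \<beta> \<theta> t (\<lambda>k. delta_y Q My (w k) i j) n
    = (alik_D \<beta> \<theta> t (\<lambda>k. w k i (j + 1)) n - alik_D \<beta> \<theta> t (\<lambda>k. w k i j) n) / hy Q My"
  using alik_D_cmult[of \<beta> \<theta> t "1 / hy Q My" "\<lambda>k. w k i (j + 1) - w k i j" n]
  by (simp add: delta_y_def alik_D_diff)

section \<open>Stability of the scheme\<close>

text \<open>A solution of the scheme on a given space-time mesh.\<close>

locale alikhanov_scheme = weighted_problem Q Cb Clow Chigh + alikhanov_mesh \<beta> \<theta> "T_end Q" N t
  for Q Cb Clow Chigh \<beta> \<theta> N t +
  fixes Mx My :: nat and \<phi> \<psi> :: "real \<times> real \<Rightarrow> real" and f :: "real \<times> real \<Rightarrow> real \<Rightarrow> real"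
    and u v :: "nat \<Rightarrow> nat \<Rightarrow> nat \<Rightarrow> real"
  assumes Mx: "0 < Mx" and My: "0 < My"
    and scheme: "scheme_solution Q \<beta> \<theta> N t Mx My \<phi> \<psi> f u v"
begin

abbreviation ut :: "nat \<Rightarrow> nat \<Rightarrow> nat \<Rightarrow> real" where
  "ut \<equiv> u_tilde Q t Mx My \<psi> u"

lemma cell_nonneg: "0 \<le> hx Q Mx * hy Q My"
  using cell_pos[OF Mx My] by simp

lemma initial: "i \<le> Mx \<Longrightarrow> j \<le> My \<Longrightarrow> u 0 i j = restrict_grid Q Mx My \<phi> i j"
  "i \<le> Mx \<Longrightarrow> j \<le> My \<Longrightarrow> v 0 i j = 0"
  using scheme by (auto simp: scheme_solution_def Let_def)

lemma boundary:
  assumes "n \<le> N" "i \<le> Mx" "j \<le> My" "\<not> interior_index Mx My i j"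
  shows "ut n i j = 0" "v n i j = 0"
proof -
  have "u n i j = 0 \<and> v n i j = 0"
  proof (cases "n = 0")
    case True
    then show ?thesis using initial assms by (simp add: restrict_grid_def)
  next
    case False
    then have "n \<in> {1..N}" using assms by simp
    then show ?thesis using scheme assms by (auto simp: scheme_solution_def Let_def)
  qed
  then show "ut n i j = 0" "v n i j = 0"
    using assms by (simp_all add: u_tilde_def restrict_grid_def)
qed

lemma interior_equations:
  assumes "1 \<le> n" "n \<le> N" "interior_index Mx My i j"
  shows "alik_D \<beta> \<theta> t (\<lambda>k. v k i j) n
      = discrete_op Q Mx My (offset \<theta> t n) (\<lambda>i j. offset \<theta> (\<lambda>k. ut k i j) n) i j
        + (f_offset Q \<theta> t Mx My f n i j + psi_offset Q \<theta> t Mx My \<psi> n i j)"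
    and "offset \<theta> (\<lambda>k. v k i j) n = alik_D \<beta> \<theta> t (\<lambda>k. ut k i j) n"
  using scheme assms by (auto simp: scheme_solution_def Let_def add.assoc)

text \<open>The second equation of the scheme extends to the boundary points, where both sides vanish; this is
  needed to apply difference quotients to it.\<close>

lemma velocity:
  assumes n: "1 \<le> n" "n \<le> N" and "i \<le> Mx" "j \<le> My"
  shows "alik_D \<beta> \<theta> t (\<lambda>k. ut k i j) n = offset \<theta> (\<lambda>k. v k i j) n"
proof (cases "interior_index Mx My i j")
  case True
  then show ?thesis using interior_equations(2)[OF n] by simp
next
  case False
  have "alik_D \<beta> \<theta> t (\<lambda>k. ut k i j) n = 0"
    unfolding alik_D_def using boundary(1)[OF _ assms(3,4) False] n by (intro sum.neutral) auto
  moreover have "offset \<theta> (\<lambda>k. v k i j) n = 0"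
    using boundary(2)[OF _ assms(3,4) False] n by (simp add: offset_def)
  ultimately show ?thesis by simp
qed

text \<open>The energy at level k. Its weights are taken at \<open>t\<^bsub>k-\<theta>\<^esub>\<close>, and at time 0 for k = 0.\<close>

definition scheme_energy :: "nat \<Rightarrow> real" where
  "scheme_energy k = grid_energy Q Mx My (offset \<theta> t k) (v k) (ut k)"

lemma energy_inequality:
  assumes n: "1 \<le> n" "n \<le> N"
  shows "alik_D \<beta> \<theta> t scheme_energy n
    \<le> lower_order_constant * ((grid_norm Q Mx My (\<lambda>i j. offset \<theta> (\<lambda>k. v k i j) n))\<^sup>2
        + (grad_norm Q Mx My (\<lambda>i j. offset \<theta> (\<lambda>k. ut k i j) n))\<^sup>2)
      + 2 * Chigh 0 * (grid_norm Q Mx My (\<lambda>i j. offset \<theta> (\<lambda>k. v k i j) n)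
        * source_norm Q \<theta> t Mx My \<psi> f n)"
proof -
  define V U where "V i j = offset \<theta> (\<lambda>k. v k i j) n" and "U i j = offset \<theta> (\<lambda>k. ut k i j) n" for i j
  define s where "s = offset \<theta> t n"
  let ?h = "hx Q Mx * hy Q My"
  let ?Z = "\<Sum>i=1..<Mx. \<Sum>j=1..<My. p0 Q (pt Q Mx My (real i) (real j)) s
      * (V i j * alik_D \<beta> \<theta> t (\<lambda>k. v k i j) n)"
  let ?X = "\<Sum>i=0..<Mx. \<Sum>j=1..<My. p1 Q (pt Q Mx My (real i + 1 / 2) (real j)) s
      * (delta_x Q Mx U i j * delta_x Q Mx V i j)"
  let ?Y = "\<Sum>i=1..<Mx. \<Sum>j=0..<My. p2 Q (pt Q Mx My (real i) (real j + 1 / 2)) s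
      * (delta_y Q My U i j * delta_y Q My V i j)"
  have s: "s \<in> {0..T_end Q}" using offset_in[OF n(2)] by (simp add: s_def)
  have times: "0 \<le> offset \<theta> t n" "offset \<theta> t k \<le> s" "s \<le> T_end Q" "0 \<le> offset \<theta> t k" if "k < n" for k
    using offset_mono[of k n] offset_in[OF n(2)] offset_in[of k] that n by (auto simp: s_def)
  have dxV: "alik_D \<beta> \<theta> t (\<lambda>k. delta_x Q Mx (ut k) i j) n = delta_x Q Mx V i j" if "i < Mx" "j < My" for i j
    unfolding alik_D_delta_x using velocity[OF n, of i j] velocity[OF n, of "i + 1" j] that
    by (simp add: delta_x_def V_def)
  have dyV: "alik_D \<beta> \<theta> t (\<lambda>k. delta_y Q My (ut k) i j) n = delta_y Q My V i j" if "i < Mx" "j < My" for i j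
    unfolding alik_D_delta_y using velocity[OF n, of i j] velocity[OF n, of i "j + 1"] that
    by (simp add: delta_y_def V_def)
  have dxU: "offset \<theta> (\<lambda>k. delta_x Q Mx (ut k) i j) n = delta_x Q Mx U i j" for i j
    unfolding U_def delta_x_offset ..
  have dyU: "offset \<theta> (\<lambda>k. delta_y Q My (ut k) i j) n = delta_y Q My U i j" for i j
    unfolding U_def delta_y_offset ..
  have "alik_D \<beta> \<theta> t scheme_energy n = ?h *
      ((\<Sum>i=1..<Mx. \<Sum>j=1..<My. alik_D \<beta> \<theta> t
          (\<lambda>k. p0 Q (pt Q Mx My (real i) (real j)) (offset \<theta> t k) * (v k i j)\<^sup>2) n)
      + (\<Sum>i=0..<Mx. \<Sum>j=1..<My. alik_D \<beta> \<theta> t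
          (\<lambda>k. p1 Q (pt Q Mx My (real i + 1 / 2) (real j)) (offset \<theta> t k) * (delta_x Q Mx (ut k) i j)\<^sup>2) n)
      + (\<Sum>i=1..<Mx. \<Sum>j=0..<My. alik_D \<beta> \<theta> t
          (\<lambda>k. p2 Q (pt Q Mx My (real i) (real j + 1 / 2)) (offset \<theta> t k) * (delta_y Q My (ut k) i j)\<^sup>2) n))"
    unfolding scheme_energy_def grid_energy_def alik_D_cmult alik_D_add alik_D_sum ..
  also have "\<dots> \<le> ?h * ((\<Sum>i=1..<Mx. \<Sum>j=1..<My. 2 * (p0 Q (pt Q Mx My (real i) (real j)) s
          * (V i j * alik_D \<beta> \<theta> t (\<lambda>k. v k i j) n)))
      + (\<Sum>i=0..<Mx. \<Sum>j=1..<My. 2 * (p1 Q (pt Q Mx My (real i + 1 / 2) (real j)) s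
          * (delta_x Q Mx U i j * delta_x Q Mx V i j)))
      + (\<Sum>i=1..<Mx. \<Sum>j=0..<My. 2 * (p2 Q (pt Q Mx My (real i) (real j + 1 / 2)) s
          * (delta_y Q My U i j * delta_y Q My V i j))))"
  proof (intro mult_left_mono add_mono sum_mono cell_nonneg)
    fix i j assume "i \<in> {1..<Mx}" "j \<in> {1..<My}"
    then have z: "pt Q Mx My (real i) (real j) \<in> Omega Q"
      by (intro pt_interior[OF Mx My]) (simp add: interior_index_def)
    show "alik_D \<beta> \<theta> t (\<lambda>k. p0 Q (pt Q Mx My (real i) (real j)) (offset \<theta> t k) * (v k i j)\<^sup>2) n
        \<le> 2 * (p0 Q (pt Q Mx My (real i) (real j)) s * (V i j * alik_D \<beta> \<theta> t (\<lambda>k. v k i j) n))"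
      unfolding V_def s_def
      using p_pos(1)[OF z s] p_decreasing(1)[OF z times(4,2,3)]
      by (intro alik_D_weighted_square_le[OF n]) (auto simp: s_def)
  next
    fix i j assume ij: "i \<in> {0..<Mx}" "j \<in> {1..<My}"
    then have z: "pt Q Mx My (real i + 1 / 2) (real j) \<in> Omega Q"
      by (intro pt_half_x[OF Mx My]) auto
    show "alik_D \<beta> \<theta> t (\<lambda>k. p1 Q (pt Q Mx My (real i + 1 / 2) (real j)) (offset \<theta> t k)
          * (delta_x Q Mx (ut k) i j)\<^sup>2) n
        \<le> 2 * (p1 Q (pt Q Mx My (real i + 1 / 2) (real j)) s * (delta_x Q Mx U i j * delta_x Q Mx V i j))"
      unfolding s_def dxU[symmetric] using ij
      by (subst dxV[symmetric])
        (auto intro!: alik_D_weighted_square_le[OF n] p_decreasing(2)[OF z] less_imp_le[OF p_pos(2)[OF z]]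
          simp: times[unfolded s_def] s[unfolded s_def, simplified])
  next
    fix i j assume ij: "i \<in> {1..<Mx}" "j \<in> {0..<My}"
    then have z: "pt Q Mx My (real i) (real j + 1 / 2) \<in> Omega Q"
      by (intro pt_half_y[OF Mx My]) auto
    show "alik_D \<beta> \<theta> t (\<lambda>k. p2 Q (pt Q Mx My (real i) (real j + 1 / 2)) (offset \<theta> t k)
          * (delta_y Q My (ut k) i j)\<^sup>2) n
        \<le> 2 * (p2 Q (pt Q Mx My (real i) (real j + 1 / 2)) s * (delta_y Q My U i j * delta_y Q My V i j))"
      unfolding s_def dyU[symmetric] using ij
      by (subst dyV[symmetric])
        (auto intro!: alik_D_weighted_square_le[OF n] p_decreasing(3)[OF z] less_imp_le[OF p_pos(3)[OF z]]
          simp: times[unfolded s_def] s[unfolded s_def, simplified])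
  qed
  also have "\<dots> = 2 * (?h * (?Z + ?X + ?Y))"
    unfolding sum_distrib_left[symmetric] by (simp add: algebra_simps)
  also have "?Z + ?X + ?Y = (\<Sum>i=1..<Mx. \<Sum>j=1..<My. p0 Q (pt Q Mx My (real i) (real j)) s *
        (V i j * (p3 Q (pt Q Mx My (real i) (real j)) s * delta_xhat Q Mx U i j
          + p4 Q (pt Q Mx My (real i) (real j)) s * delta_yhat Q My U i j
          + b3 Q (pt Q Mx My (real i) (real j)) s * U i j
          + (f_offset Q \<theta> t Mx My f n i j + psi_offset Q \<theta> t Mx My \<psi> n i j))))"
  proof (rule energy_identity[OF Mx My s])
    show "V 0 j = 0 \<and> V Mx j = 0" if "1 \<le> j" "j < My" for j
      using boundary(2)[of _ 0 j] boundary(2)[of _ Mx j] n that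
      by (simp add: V_def offset_def interior_index_def)
    show "V i 0 = 0 \<and> V i My = 0" if "1 \<le> i" "i < Mx" for i
      using boundary(2)[of _ i 0] boundary(2)[of _ i My] n that
      by (simp add: V_def offset_def interior_index_def)
    show "alik_D \<beta> \<theta> t (\<lambda>k. v k i j) n = discrete_op Q Mx My s U i j
        + (f_offset Q \<theta> t Mx My f n i j + psi_offset Q \<theta> t Mx My \<psi> n i j)"
      if "interior_index Mx My i j" for i j
      using interior_equations(1)[OF n that] unfolding U_def s_def .
  qed
  also have "2 * (?h * \<dots>) \<le> lower_order_constant * ((grid_norm Q Mx My V)\<^sup>2 + (grad_norm Q Mx My U)\<^sup>2)
      + 2 * Chigh 0 * (grid_norm Q Mx My V * (grid_norm Q Mx My (f_offset Q \<theta> t Mx My f n)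
        + grid_norm Q Mx My (psi_offset Q \<theta> t Mx My \<psi> n)))"
  proof (rule lower_order_bound[OF Mx My s])
    show "U 0 j = 0" if "1 \<le> j" "j < My" for j
      using boundary(1)[of _ 0 j] n that by (simp add: U_def offset_def interior_index_def)
  qed
  finally show ?thesis unfolding source_norm_def V_def U_def .
qed

end

context weighted_problem
begin

text \<open>The energy is at least this multiple of the squared norms.\<close>

definition coercivity :: real where
  "coercivity = min (Clow 0) (min (Clow 1) (Clow 2))"

text \<open>The coefficients of the energy and of the data in the recursion for the energy.\<close>

definition growth_rate :: real where
  "growth_rate = lower_order_constant / coercivity"

definition source_factor :: real where
  "source_factor = 2 * Chigh 0 / sqrt coercivity"

lemma coercivity_pos: "0 < coercivity"
  using constants_pos by (simp add: coercivity_def)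

lemma lower_order_constant_pos: "0 < lower_order_constant"
  using constants_pos unfolding lower_order_constant_def
  by (intro mult_pos_pos add_pos_pos zero_less_one add_pos_nonneg) auto

lemma growth_rate_pos: "0 < growth_rate"
  using lower_order_constant_pos coercivity_pos by (simp add: growth_rate_def)

lemma source_factor_pos: "0 < source_factor"
  using constants_pos coercivity_pos by (simp add: source_factor_def)

text \<open>The constant of the first bound, for a mesh with steps at most \<open>\<delta>\<close>.\<close>

definition stability_constant :: "real \<Rightarrow> real" where
  "stability_constant \<delta> = 2 * (1 + 2 * exp (T_end Q / \<delta>) / sqrt coercivity
     * (sqrt (max (Chigh 1) (Chigh 2)) + 2 * source_factor))"

lemma stability_constant_pos: "0 < stability_constant \<delta>"
proof -
  have "0 \<le> 2 * exp (T_end Q / \<delta>) / sqrt coercivity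
     * (sqrt (max (Chigh 1) (Chigh 2)) + 2 * source_factor)"
    using coercivity_pos source_factor_pos constants_pos by (simp add: max_def)
  then show ?thesis by (simp add: stability_constant_def)
qed

end

context alikhanov_scheme
begin

lemma source_norm_nonneg: "0 \<le> source_norm Q \<theta> t Mx My \<psi> f k"
  unfolding source_norm_def by (intro add_nonneg_nonneg grid_norm_nonneg cell_nonneg)

lemma scheme_energy_lower:
  assumes "k \<le> N"
  shows "coercivity * ((grid_norm Q Mx My (v k))\<^sup>2 + (grad_norm Q Mx My (ut k))\<^sup>2) \<le> scheme_energy k"
  unfolding scheme_energy_def using offset_in[OF assms]
  by (intro energy_lower[OF Mx My]) (auto simp: coercivity_def)

lemma scheme_energy_nonneg: "k \<le> N \<Longrightarrow> 0 \<le> scheme_energy k"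
  using scheme_energy_lower[of k] coercivity_pos
  by (intro order_trans[OF _ scheme_energy_lower[of k]]) auto

lemma grad_norm_le_energy:
  assumes "k \<le> N"
  shows "grad_norm Q Mx My (ut k) \<le> sqrt (scheme_energy k) / sqrt coercivity"
proof -
  have "coercivity * (grad_norm Q Mx My (ut k))\<^sup>2
      \<le> coercivity * ((grid_norm Q Mx My (v k))\<^sup>2 + (grad_norm Q Mx My (ut k))\<^sup>2)"
    using coercivity_pos by (intro mult_left_mono) auto
  also note scheme_energy_lower[OF assms]
  finally have "(grad_norm Q Mx My (ut k))\<^sup>2 \<le> scheme_energy k / coercivity"
    using coercivity_pos by (simp add: pos_le_divide_eq mult.commute)
  then show ?thesis by (simp add: real_le_rsqrt flip: real_sqrt_divide)
qed

lemma grid_norm_le_energy: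
  assumes "k \<le> N"
  shows "grid_norm Q Mx My (v k) \<le> sqrt (scheme_energy k) / sqrt coercivity"
proof -
  have "coercivity * (grid_norm Q Mx My (v k))\<^sup>2
      \<le> coercivity * ((grid_norm Q Mx My (v k))\<^sup>2 + (grad_norm Q Mx My (ut k))\<^sup>2)"
    using coercivity_pos by (intro mult_left_mono) auto
  also note scheme_energy_lower[OF assms]
  finally have "(grid_norm Q Mx My (v k))\<^sup>2 \<le> scheme_energy k / coercivity"
    using coercivity_pos by (simp add: pos_le_divide_eq mult.commute)
  then show ?thesis by (simp add: real_le_rsqrt flip: real_sqrt_divide)
qed

lemma scheme_energy_0:
  "sqrt (scheme_energy 0)
    \<le> sqrt (max (Chigh 1) (Chigh 2)) * grad_norm Q Mx My (restrict_grid Q Mx My \<phi>)"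
proof -
  have "scheme_energy 0 \<le> max (Chigh 1) (Chigh 2) * (grad_norm Q Mx My (ut 0))\<^sup>2"
    unfolding scheme_energy_def using offset_in[of 0]
    by (intro energy_upper[OF Mx My]) (auto simp: interior_index_def intro: initial(2))
  also have "grad_norm Q Mx My (ut 0) = grad_norm Q Mx My (restrict_grid Q Mx My \<phi>)"
    by (intro grad_norm_cong) (simp add: u_tilde_def t_0 initial)
  finally have "sqrt (scheme_energy 0)
      \<le> sqrt (max (Chigh 1) (Chigh 2) * (grad_norm Q Mx My (restrict_grid Q Mx My \<phi>))\<^sup>2)"
    by (rule real_sqrt_le_mono)
  then show ?thesis using grad_norm_nonneg by (simp add: real_sqrt_mult)
qed

lemma energy_recursion:
  assumes n: "1 \<le> n" "n \<le> N"
  shows "alik_D \<beta> \<theta> t scheme_energy n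
    \<le> growth_rate * (scheme_energy n + scheme_energy (n - 1))
      + source_factor * source_norm Q \<theta> t Mx My \<psi> f n
        * (sqrt (scheme_energy n) + sqrt (scheme_energy (n - 1)))"
proof -
  let ?V = "\<lambda>i j. offset \<theta> (\<lambda>k. v k i j) n" and ?U = "\<lambda>i j. offset \<theta> (\<lambda>k. ut k i j) n"
  let ?S = "source_norm Q \<theta> t Mx My \<psi> f n"
  have theta: "0 \<le> \<theta>" "\<theta> \<le> 1" using theta_pos theta_less_half by auto
  have n1: "n - 1 \<le> N" using n by simp
  have V: "(grid_norm Q Mx My ?V)\<^sup>2 \<le> (grid_norm Q Mx My (v n))\<^sup>2 + (grid_norm Q Mx My (v (n - 1)))\<^sup>2"
    by (rule grid_norm_offset_le[OF cell_nonneg theta])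
  have U: "(grad_norm Q Mx My ?U)\<^sup>2 \<le> (grad_norm Q Mx My (ut n))\<^sup>2 + (grad_norm Q Mx My (ut (n - 1)))\<^sup>2"
    by (rule grad_norm_offset_le[OF cell_nonneg theta])
  have "coercivity * ((grid_norm Q Mx My ?V)\<^sup>2 + (grad_norm Q Mx My ?U)\<^sup>2)
      \<le> coercivity * (((grid_norm Q Mx My (v n))\<^sup>2 + (grad_norm Q Mx My (ut n))\<^sup>2)
        + ((grid_norm Q Mx My (v (n - 1)))\<^sup>2 + (grad_norm Q Mx My (ut (n - 1)))\<^sup>2))"
    using U V coercivity_pos by (intro mult_left_mono) auto
  also have "\<dots> \<le> scheme_energy n + scheme_energy (n - 1)"
    using scheme_energy_lower[OF n(2)] scheme_energy_lower[OF n1] by (simp add: distrib_left)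
  finally have "(grid_norm Q Mx My ?V)\<^sup>2 + (grad_norm Q Mx My ?U)\<^sup>2
      \<le> (scheme_energy n + scheme_energy (n - 1)) / coercivity"
    using coercivity_pos by (simp add: pos_le_divide_eq mult.commute)
  then have "lower_order_constant * ((grid_norm Q Mx My ?V)\<^sup>2 + (grad_norm Q Mx My ?U)\<^sup>2)
      \<le> lower_order_constant * ((scheme_energy n + scheme_energy (n - 1)) / coercivity)"
    using lower_order_constant_pos by (intro mult_left_mono) auto
  then have quadratic: "lower_order_constant * ((grid_norm Q Mx My ?V)\<^sup>2 + (grad_norm Q Mx My ?U)\<^sup>2)
      \<le> growth_rate * (scheme_energy n + scheme_energy (n - 1))"
    by (simp add: growth_rate_def)
  have "(grid_norm Q Mx My ?V)\<^sup>2 \<le> (grid_norm Q Mx My (v n) + grid_norm Q Mx My (v (n - 1)))\<^sup>2"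
    using V grid_norm_nonneg[OF cell_nonneg] by (intro order_trans[OF V]) (simp add: power2_sum)
  then have "grid_norm Q Mx My ?V \<le> grid_norm Q Mx My (v n) + grid_norm Q Mx My (v (n - 1))"
    using grid_norm_nonneg[OF cell_nonneg] by (intro power2_le_imp_le[of "grid_norm Q Mx My ?V"]) auto
  also have "\<dots> \<le> (sqrt (scheme_energy n) + sqrt (scheme_energy (n - 1))) / sqrt coercivity"
    using grid_norm_le_energy[OF n(2)] grid_norm_le_energy[OF n1] by (simp add: add_divide_distrib)
  finally have "2 * Chigh 0 * (grid_norm Q Mx My ?V * ?S)
      \<le> 2 * Chigh 0 * ((sqrt (scheme_energy n) + sqrt (scheme_energy (n - 1))) / sqrt coercivity * ?S)"
    using constants_pos source_norm_nonneg by (intro mult_left_mono mult_right_mono) auto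
  also have "\<dots> = source_factor * ?S * (sqrt (scheme_energy n) + sqrt (scheme_energy (n - 1)))"
    by (simp add: source_factor_def)
  finally show ?thesis using energy_inequality[OF n] quadratic by linarith
qed

end

text \<open>A solution of the scheme together with the complementary kernels of its time mesh.\<close>

locale alikhanov_scheme_complementary =
  alikhanov_scheme + alikhanov_mesh_complementary \<beta> \<theta> "T_end Q" N t P for P
begin

lemma grad_norm_stability:
  assumes delta: "0 < \<delta>" and rate: "22 * growth_rate \<le> omega (1 - \<beta>) (2 * \<delta>)"
    and steps: "\<And>k. 1 \<le> k \<Longrightarrow> k \<le> N \<Longrightarrow> tau t k \<le> \<delta>" and n: "1 \<le> n" "n \<le> N"
  shows "grad_norm Q Mx My (u n) \<le> stability_constant \<delta> * (data_norm Q t Mx My \<phi> \<psi> n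
    + (MAX k\<in>{1..n}. \<Sum>j=1..k. P k j * source_norm Q \<theta> t Mx My \<psi> f j))"
proof -
  let ?S = "source_norm Q \<theta> t Mx My \<psi> f"
  define q where "q = (MAX k\<in>{1..n}. \<Sum>j=1..k. P k j * ?S j)"
  define G where "G = 2 * exp (T_end Q / \<delta>) / sqrt coercivity"
  define ch where "ch = sqrt (max (Chigh 1) (Chigh 2))"
  define F \<Psi> where "F = grad_norm Q Mx My (restrict_grid Q Mx My \<phi>)"
    and "\<Psi> = grad_norm Q Mx My (restrict_grid Q Mx My \<psi>)"
  have q_ge: "(\<Sum>j=1..k. P k j * ?S j) \<le> q" if "1 \<le> k" "k \<le> n" for k
    unfolding q_def using that by (intro Max_ge) auto
  have "0 \<le> (\<Sum>j=1..n. P n j * ?S j)"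
    using complementary_nonneg source_norm_nonneg n by (intro sum_nonneg mult_nonneg_nonneg) auto
  then have q: "0 \<le> q" using q_ge[OF n(1)] by simp
  have "sqrt (scheme_energy n)
      \<le> 2 * exp (T_end Q / \<delta>) * (sqrt (scheme_energy 0) + 2 * (source_factor * q))"
  proof (rule discrete_gronwall[OF growth_rate_pos delta rate steps n])
    show "0 \<le> scheme_energy k" if "k \<le> n" for k
      using scheme_energy_nonneg that n by simp
    show "0 \<le> source_factor * ?S k" for k
      using source_factor_pos source_norm_nonneg by simp
    show "alik_D \<beta> \<theta> t scheme_energy m \<le> growth_rate * (scheme_energy m + scheme_energy (m - 1))
        + source_factor * ?S m * (sqrt (scheme_energy m) + sqrt (scheme_energy (m - 1)))"
      if "1 \<le> m" "m \<le> n" for m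
      using energy_recursion[of m] that n by simp
    show "(\<Sum>j=1..m. P m j * (source_factor * ?S j)) \<le> source_factor * q" if "1 \<le> m" "m \<le> n" for m
    proof -
      have "(\<Sum>j=1..m. P m j * (source_factor * ?S j)) = source_factor * (\<Sum>j=1..m. P m j * ?S j)"
        unfolding sum_distrib_left by (intro sum.cong) auto
      then show ?thesis using q_ge[OF that] source_factor_pos by simp
    qed
  qed
  also have "\<dots> \<le> 2 * exp (T_end Q / \<delta>) * (ch * F + 2 * (source_factor * q))"
    using scheme_energy_0 by (intro mult_left_mono) (auto simp: ch_def F_def)
  finally have "sqrt (scheme_energy n) / sqrt coercivity
      \<le> 2 * exp (T_end Q / \<delta>) * (ch * F + 2 * (source_factor * q)) / sqrt coercivity"
    using coercivity_pos by (intro divide_right_mono) auto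
  then have bound: "grad_norm Q Mx My (ut n) \<le> G * (ch * F + 2 * (source_factor * q))"
    using grad_norm_le_energy[OF n(2)] by (simp add: G_def)
  have "grad_norm Q Mx My (u n) = grad_norm Q Mx My (\<lambda>i j. ut n i j + t n * restrict_grid Q Mx My \<psi> i j)"
    by (simp add: u_tilde_def)
  also have "\<dots> \<le> 2 * (grad_norm Q Mx My (ut n) + t n * \<Psi>)"
    unfolding \<Psi>_def using t_nonneg[OF n(2)] by (rule grad_norm_add_scaled_le[OF cell_nonneg])
  also have "\<dots> \<le> 2 * (G * (ch * F + 2 * (source_factor * q)) + t n * \<Psi>)"
    using bound by simp
  also have "\<dots> \<le> 2 * (1 + G * (ch + 2 * source_factor)) * ((F + t n * \<Psi>) + q)"
  proof -
    have "0 \<le> G" "0 \<le> ch" "0 \<le> F" "0 \<le> t n * \<Psi>" "0 \<le> source_factor"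
      using coercivity_pos constants_pos grad_norm_nonneg t_nonneg[OF n(2)] source_factor_pos
      by (auto simp: G_def ch_def F_def \<Psi>_def max_def)
    then have "0 \<le> (F + q) + G * ch * (t n * \<Psi> + q) + G * (2 * source_factor) * (F + t n * \<Psi>)"
      using q by simp
    then show ?thesis by (simp add: algebra_simps)
  qed
  finally show ?thesis
    by (simp add: stability_constant_def G_def ch_def F_def \<Psi>_def q_def data_norm_def)
qed

end

text \<open>The step restriction is the \<open>\<delta>\<close> at which the kernel value reaches the rate that the energy requires.\<close>

lemma omega_arbitrarily_large:
  assumes "0 < \<beta>" "\<beta> < 1" "0 < y"
  obtains \<delta> where "0 < \<delta>" "omega (1 - \<beta>) (2 * \<delta>) = y"
proof
  have Gamma_pos: "0 < Gamma (1 - \<beta>)" using assms by (simp add: Gamma_real_pos)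
  then have Gamma_nz: "Gamma (1 - \<beta>) \<noteq> 0" by linarith
  let ?r = "(y * Gamma (1 - \<beta>)) powr (- 1 / \<beta>)"
  show "0 < ?r / 2" using assms by (simp add: Gamma_nz)
  have "?r powr - \<beta> = y * Gamma (1 - \<beta>)"
    using assms Gamma_pos by (simp add: powr_powr Gamma_nz)
  then show "omega (1 - \<beta>) (2 * (?r / 2)) = y"
    by (simp add: omega_def Gamma_nz)
qed

theorem theorem4p3:
  fixes Q :: problem and \<alpha> \<beta> \<theta> :: real and Cb Clow Chigh :: "nat \<Rightarrow> real"
  assumes "1 < \<alpha>" and "\<alpha> < 2" and "\<beta> = \<alpha> / 2" and "\<theta> = \<beta> / 2"
    and "standing_assumptions Q Cb Clow Chigh"
    and "\<forall>z\<in>Omega Q. \<forall>t\<in>{0..T_end Q}. 0 < a1 Q z t \<and> 0 < a2 Q z t"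
    and "\<forall>z\<in>Omega Q. C1_time (T_end Q) (a1 Q z) \<and> C1_time (T_end Q) (a2 Q z)"
    and "0 < C_p Q"
    and "\<forall>z\<in>Omega Q. \<forall>t\<in>{0..T_end Q}.
           \<bar>dt_on (T_end Q) (a1 Q z) t / a1 Q z t\<bar> + \<bar>dt_on (T_end Q) (a2 Q z) t / a2 Q z t\<bar> \<le> C_p Q"
  shows "\<exists>C>0. \<exists>C'>0. \<exists>tau_max>0.
    \<forall>N t Mx My \<phi> \<psi> f u v P.
      time_mesh (T_end Q) N t \<and> 0 < Mx \<and> 0 < My \<and>
      complementary_kernels \<beta> \<theta> N t P \<and>
      scheme_solution Q \<beta> \<theta> N t Mx My \<phi> \<psi> f u v \<longrightarrow>
      (\<forall>n\<in>{1..N}.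
        ((\<forall>k\<in>{1..N}. tau t k \<le> tau_max) \<longrightarrow>
          grad_norm Q Mx My (u n)
            \<le> C * (data_norm Q t Mx My \<phi> \<psi> n +
                   (MAX k\<in>{1..n}. \<Sum>j=1..k. P k j * source_norm Q \<theta> t Mx My \<psi> f j))) \<and>
        C * (data_norm Q t Mx My \<phi> \<psi> n +
             (MAX k\<in>{1..n}. \<Sum>j=1..k. P k j * source_norm Q \<theta> t Mx My \<psi> f j))
          \<le> C' * (data_norm Q t Mx My \<phi> \<psi> n +
                  (MAX k\<in>{1..n}. t k powr (\<alpha> / 2) * source_norm Q \<theta> t Mx My \<psi> f k)))"
proof -
  interpret weighted_problem Q Cb Clow Chigh
    using assms by unfold_locales auto
  have beta: "0 < \<beta>" "\<beta> < 1" "2 * \<theta> = \<beta>" using assms by auto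
  obtain \<delta> where delta: "0 < \<delta>" "omega (1 - \<beta>) (2 * \<delta>) = 22 * growth_rate"
    using omega_arbitrarily_large[OF beta(1,2), of "22 * growth_rate"] growth_rate_pos by auto
  define K where "K = 11 / 4 * Gamma (1 - \<beta>)"
  have K: "0 < K" using beta by (simp add: K_def Gamma_real_pos)
  define C where "C = stability_constant \<delta>"
  have C: "0 < C" using stability_constant_pos by (simp add: C_def)
  have "0 < C * (1 + K)" using C K by simp
  show ?thesis
  proof (rule exI[of _ C], intro conjI C, rule exI[of _ "C * (1 + K)"], intro conjI \<open>0 < C * (1 + K)\<close>,
      rule exI[of _ \<delta>], intro conjI delta(1) allI impI ballI)
    fix N t Mx My \<phi> \<psi> f u v P n
    assume asm: "time_mesh (T_end Q) N t \<and> 0 < Mx \<and> 0 < My \<and>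
      complementary_kernels \<beta> \<theta> N t P \<and> scheme_solution Q \<beta> \<theta> N t Mx My \<phi> \<psi> f u v"
      and "n \<in> {1..N}"
    then have n: "1 \<le> n" "n \<le> N" by auto
    interpret S: alikhanov_scheme_complementary Q Cb Clow Chigh \<beta> \<theta> N t Mx My \<phi> \<psi> f u v P
      using asm beta by unfold_locales auto
    let ?S = "source_norm Q \<theta> t Mx My \<psi> f"
    let ?q = "MAX k\<in>{1..n}. \<Sum>j=1..k. P k j * ?S j"
    let ?m = "MAX k\<in>{1..n}. t k powr \<beta> * ?S k"
    show "grad_norm Q Mx My (u n) \<le> C * (data_norm Q t Mx My \<phi> \<psi> n + ?q)"
      if "\<forall>k\<in>{1..N}. tau t k \<le> \<delta>"
      unfolding C_def using that n delta by (intro S.grad_norm_stability) auto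
    have "?q \<le> K * ?m"
      unfolding K_def using n S.sum_complementary_le_Max[OF _ _ n(2) S.source_norm_nonneg]
      by (subst Max_le_iff) auto
    moreover have "0 \<le> data_norm Q t Mx My \<phi> \<psi> n"
      unfolding data_norm_def using S.t_nonneg[OF n(2)] grad_norm_nonneg by simp
    moreover have "0 \<le> ?m"
    proof -
      have "t n powr \<beta> * ?S n \<le> ?m" using n by (intro Max_ge) auto
      moreover have "0 \<le> t n powr \<beta> * ?S n" using S.source_norm_nonneg by simp
      ultimately show ?thesis by linarith
    qed
    ultimately have "data_norm Q t Mx My \<phi> \<psi> n + ?q \<le> (1 + K) * (data_norm Q t Mx My \<phi> \<psi> n + ?m)"
      using K by (simp add: algebra_simps add_increasing add_mono)
    then have "C * (data_norm Q t Mx My \<phi> \<psi> n + ?q)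
        \<le> C * ((1 + K) * (data_norm Q t Mx My \<phi> \<psi> n + ?m))"
      using C by (intro mult_left_mono) auto
    then show "C * (data_norm Q t Mx My \<phi> \<psi> n + ?q) \<le> C * (1 + K) * (data_norm Q t Mx My \<phi> \<psi> n +
        (MAX k\<in>{1..n}. t k powr (\<alpha> / 2) * ?S k))"
      using assms(3) by (simp add: mult.assoc)
  qed
qed

end
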